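(* Let $\mathbb{P}$ be a translation-invariant Gibbs random field on $\mathbb{Z}^d$, $d\ge2$, which is non-uniformly exponentially $\varphi$-mixing. Then there exists $\epsilon_0>0$ such that for all $\epsilon>\epsilon_0$, for $\mathbb{P}$-almost every $\sigma$ one has, for all sufficiently large $n$ (depending on $\sigma$), $$-\epsilon\log n\le\log\left[(\mathbf{r}_n(\sigma))^d\ \mathbb{P}(\mathcal{C}(\sigma_{C_n}))\right]\le\log\log n^{\epsilon}.$$ In particular, $$\lim_{n\to\infty}\frac{d}{n^d}\log\mathbf{r}_n(\sigma)=s(\mathbb{P})\quad\text{for }\mathbb{P}\text{-almost every }\sigma.$$
   Context: Setting. $\mathcal{A}$ is a finite set, $\Omega=\mathcal{A}^{\mathbb{Z}^d}$ with the product topology and its Borel sigma-field, $\mathcal{S}$ is the set of (nonempty) finite subsets of $\mathbb{Z}^d$, $|\mathbf{x}|=\sum_i|x_i|$, $d(A,B)=\min\{|\mathbf{x}-\mathbf{y}|:\mathbf{x}\in A,\mathbf{y}\in B\}$ for $A,B\in\mathcal{S}$. $\sigma_V$ is the restriction of $\sigma$ to $V$, $\Omega_V=\mathcal{A}^V$, $\mathcal{F}_V$ is the sigma-field generated by $\sigma(\mathbf{x})$, $\mathbf{x}\in V$, and $(\tau_{\mathbf{x}}\sigma)(\mathbf{y})=\sigma(\mathbf{x}+\mathbf{y})$. Patterns. $C_n=[0,n]^d\cap\mathbb{Z}^d$; for $A_n\in\Omega_{C_n}$, $\mathcal{C}(A_n)=\{\sigma:\sigma_{C_n}=A_n\}$.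 First repetition: $\mathbf{r}_n(\sigma)$ is the minimal $k\in\mathbb{N}$ such that there is $\mathbf{x}\in\mathbb{Z}_+^d$ with $|\mathbf{x}|>0$, $0\le x_i\le k$ for all $i$, and $(\tau_{\mathbf{x}}\sigma)_{C_n}=\sigma_{C_n}$. Entropy. $s(\mathbb{P})=\lim_{n\to\infty}-\frac{1}{n^d}\sum_{A_n\in\Omega_{C_n}}\mathbb{P}(\mathcal{C}(A_n))\log\mathbb{P}(\mathcal{C}(A_n))$. Gibbs fields. A translation-invariant interaction is $U:\mathcal{S}\times\Omega\to\mathbb{R}$ such that $U(A,\sigma)$ depends only on $\sigma_A$, $U(A+\mathbf{x},\tau_{-\mathbf{x}}\sigma)=U(A,\sigma)$, and $\sum_{A\ni 0}\sup_\sigma|U(A,\sigma)|<\infty$. Put $H^\zeta_\Lambda(\sigma)=\sum_{A\cap\Lambda\ne\emptyset}U(A,\sigma_\Lambda\zeta_{\Lambda^c})$. A translation-invariant Gibbs random field (with interaction $U$) is a translation-invariant probability measure $\mathbb{P}$ on $\Omega$ such that for every $\Lambda\in\mathcal{S}$ the conditional distribution of $\sigma_\Lambda$ given $\sigma_{\Lambda^c}=\zeta_{\Lambda^c}$ is, for $\mathbb{P}$-a.e. $\zeta$, proportional to $e^{-H^\zeta_\Lambda(\sigma)}$. Mixing. For $m>0$, $\varphi(m)=\sup\frac{1}{|A_1|}\left|\mathbb{P}(E_{A_1}\mid E_{A_2})-\mathbb{P}(E_{A_1})\right|$, the supremum over finite $A_1,A_2\subset\mathbb{Z}^d$ with $d(A_1,A_2)\ge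 m$ and $E_{A_i}\in\mathcal{F}_{A_i}$ with $\mathbb{P}(E_{A_2})>0$. $\mathbb{P}$ is non-uniformly exponentially $\varphi$-mixing if there are $C_1,C_2>0$ with $\varphi(m)\le C_1e^{-C_2m}$ for all $m>0$. *)

theory Defs
  imports "HOL-Probability.Probability"
begin

text \<open>
  The lattice is \<^typ>\<open>int ^ 'd\<close>, of dimension \<^term>\<open>CARD('d)\<close>, and the alphabet is a
  finite type. A pattern on \<open>V\<close> is an extensional function, i.e. an element of
  \<open>V \<rightarrow>\<^sub>E UNIV\<close>, so that \<open>restrict \<sigma> V\<close> is the restriction of \<open>\<sigma>\<close> to \<open>V\<close>.
\<close>

type_synonym ('d, 'a) config = "int ^ 'd \<Rightarrow> 'a"

definition config_borel :: "('d::finite, 'a::finite) config measure" where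
  "config_borel =
     sigma UNIV {S. openin (product_topology (\<lambda>_. discrete_topology UNIV) UNIV) S}"

definition sigma_field_on :: "(int ^ 'd::finite) set \<Rightarrow> ('d, 'a::finite) config measure" where
  "sigma_field_on V = sigma UNIV {(\<lambda>\<sigma>. \<sigma> x) -` B | x B. x \<in> V}"

definition shift :: "int ^ 'd::finite \<Rightarrow> ('d, 'a) config \<Rightarrow> ('d, 'a) config" where
  "shift x \<sigma> = (\<lambda>y. \<sigma> (x + y))"

definition l1_norm :: "int ^ 'd::finite \<Rightarrow> int" where
  "l1_norm x = (\<Sum>i\<in>UNIV. \<bar>x $ i\<bar>)"

text \<open>Meaningful for nonempty finite sets only.\<close>

definition set_distance :: "(int ^ 'd::finite) set \<Rightarrow> (int ^ 'd) set \<Rightarrow> int" where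
  "set_distance A B = Min {l1_norm (x - y) | x y. x \<in> A \<and> y \<in> B}"

definition cube :: "nat \<Rightarrow> (int ^ 'd::finite) set" where
  "cube n = {x. \<forall>i. 0 \<le> x $ i \<and> x $ i \<le> int n}"

definition cylinder :: "(int ^ 'd::finite) set \<Rightarrow> ('d, 'a) config \<Rightarrow> ('d, 'a) config set" where
  "cylinder V p = {\<sigma>. restrict \<sigma> V = p}"

text \<open>
  For a translation-invariant probability measure, Poincare recurrence shows that for almost
  every \<open>\<sigma>\<close> a suitable \<open>k\<close> exists for all \<open>n\<close>; otherwise the value is unspecified.
\<close>

definition first_repetition :: "nat \<Rightarrow> ('d::finite, 'a) config \<Rightarrow> nat" where
  "first_repetition n \<sigma> = (LEAST k. \<exists>x. l1_norm x > 0 \<and> (\<forall>i. 0 \<le> x $ i \<and> x $ i \<le> int k) \<and>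
     restrict (shift x \<sigma>) (cube n) = restrict \<sigma> (cube n))"

text \<open>The convention \<open>0 log 0 = 0\<close> holds automatically.\<close>

definition specific_entropy :: "('d::finite, 'a::finite) config measure \<Rightarrow> real" where
  "specific_entropy P = lim (\<lambda>n. - (1 / real n ^ CARD('d)) *
     (\<Sum>p \<in> cube n \<rightarrow>\<^sub>E UNIV. measure P (cylinder (cube n) p) * ln (measure P (cylinder (cube n) p))))"

text \<open>
  An interaction is only evaluated at nonempty finite sets. Since the alphabet is finite, the
  locality condition makes \<open>U A\<close> bounded, so the suprema are genuine.
\<close>

definition translation_invariant_interaction ::
    "((int ^ 'd::finite) set \<Rightarrow> ('d, 'a::finite) config \<Rightarrow> real) \<Rightarrow> bool" where
  "translation_invariant_interaction U \<longleftrightarrow>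
     (\<forall>A \<sigma> \<sigma>'. finite A \<longrightarrow> A \<noteq> {} \<longrightarrow> restrict \<sigma> A = restrict \<sigma>' A \<longrightarrow> U A \<sigma> = U A \<sigma>') \<and>
     (\<forall>A x \<sigma>. finite A \<longrightarrow> A \<noteq> {} \<longrightarrow> U ((\<lambda>y. y + x) ` A) (shift (- x) \<sigma>) = U A \<sigma>) \<and>
     (\<lambda>A. SUP \<sigma>. \<bar>U A \<sigma>\<bar>) summable_on {A. finite A \<and> 0 \<in> A}"

text \<open>\<open>hamiltonian U \<Lambda> \<zeta> \<sigma>\<close>: energy of \<open>\<sigma>\<close> in \<open>\<Lambda>\<close> with boundary condition \<open>\<zeta>\<close> outside \<open>\<Lambda>\<close>.\<close>

definition hamiltonian ::
    "((int ^ 'd::finite) set \<Rightarrow> ('d, 'a::finite) config \<Rightarrow> real) \<Rightarrow> (int ^ 'd) set \<Rightarrow>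
     ('d, 'a) config \<Rightarrow> ('d, 'a) config \<Rightarrow> real" where
  "hamiltonian U \<Lambda> \<zeta> \<sigma> = (\<Sum>\<^sub>\<infinity>A\<in>{A. finite A \<and> A \<inter> \<Lambda> \<noteq> {}}. U A (override_on \<zeta> \<sigma> \<Lambda>))"

definition translation_invariant :: "('d::finite, 'a) config measure \<Rightarrow> bool" where
  "translation_invariant P \<longleftrightarrow> (\<forall>x. distr P P (shift x) = P)"

definition translation_invariant_gibbs ::
    "((int ^ 'd::finite) set \<Rightarrow> ('d, 'a::finite) config \<Rightarrow> real) \<Rightarrow> ('d, 'a) config measure \<Rightarrow> bool" where
  "translation_invariant_gibbs U P \<longleftrightarrow>
     translation_invariant_interaction U \<and>
     prob_space P \<and> sets P = sets config_borel \<and> translation_invariant P \<and>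
     (\<forall>\<Lambda>. finite \<Lambda> \<longrightarrow> \<Lambda> \<noteq> {} \<longrightarrow>
       (AE \<zeta> in P. \<forall>p \<in> \<Lambda> \<rightarrow>\<^sub>E UNIV.
          real_cond_exp P (sigma_field_on (- \<Lambda>)) (indicator (cylinder \<Lambda> p)) \<zeta> =
            exp (- hamiltonian U \<Lambda> \<zeta> p) / (\<Sum>q \<in> \<Lambda> \<rightarrow>\<^sub>E UNIV. exp (- hamiltonian U \<Lambda> \<zeta> q))))"

text \<open>The set below is nonempty and bounded by \<open>1\<close> for every probability measure.\<close>

definition phi_mixing_coeff :: "('d::finite, 'a::finite) config measure \<Rightarrow> real \<Rightarrow> real" where
  "phi_mixing_coeff P m = Sup
     {1 / real (card A1) *
        \<bar>\<P>(\<sigma> in P. \<sigma> \<in> E1 \<bar> \<sigma> \<in> E2) - measure P E1\<bar> | A1 A2 E1 E2.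
      finite A1 \<and> A1 \<noteq> {} \<and> finite A2 \<and> A2 \<noteq> {} \<and> m \<le> real_of_int (set_distance A1 A2) \<and>
      E1 \<in> sets (sigma_field_on A1) \<and> E2 \<in> sets (sigma_field_on A2) \<and> measure P E2 > 0}"

definition exponentially_phi_mixing :: "('d::finite, 'a::finite) config measure \<Rightarrow> bool" where
  "exponentially_phi_mixing P \<longleftrightarrow>
     (\<exists>C1>0. \<exists>C2>0. \<forall>m>0. phi_mixing_coeff P m \<le> C1 * exp (- C2 * m))"

end

theory Submission
  imports Defs "HOL-Real_Asymp.Real_Asymp"
begin

text \<open>
  Two properties of a Gibbs field with summable interaction are used. Finite energy: prescribing
  one more spin costs a factor in \<open>[\<delta>, 1 - \<delta>]\<close>. Factorization: a cube is independent of any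
  outside pattern up to a factor \<open>exp (c n)\<close> with \<open>c n = o(n\<^sup>d)\<close>, the energy crossing its boundary.

  Since \<open>d \<ge> 2\<close>, a repetition of the pattern on \<open>cube n\<close> at any \<open>x \<noteq> 0\<close> prescribes at
  least \<open>n + 1\<close> new spins and so has conditional probability at most \<open>(1 - \<delta>)\<^sup>n\<^sup>+\<^sup>1\<close>; this
  disposes of all \<open>x\<close> of polynomial size in \<open>n\<close>, overlapping ones included. Beyond a distance of
  order \<open>n\<^sup>d\<close> the additive mixing error is below the probability of any pattern, so occurrences
  there behave as if independent. A first moment bound then excludes early repetitions.
  For late ones, the search region is cut into \<open>O(log n)\<close> separated slabs whose volume is
  comparable to the inverse probability of the pattern: by the second moment method each contains an
  occurrence with probability at least \<open>1/4\<close>, and mixing multiplies the failure probabilities.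

  For the entropy statement, factorization turns \<open>ln P\<close> of a large cube into a sum of local terms
  over a tiling by blocks of a fixed size, whose variance is controlled by mixing; Chebyshev's inequality is
  summable because \<open>d \<ge> 2\<close>. Taking expectations in the same comparison gives the existence
  of the specific entropy.
\<close>

subsection \<open>Patterns and local events\<close>

text \<open>The range searched for a repetition depends on the pattern through its probability P.
  Every estimate is therefore made on the event that a fixed pattern occurs at the origin, with an
  error proportional to P, and is then summed over patterns. This forces the additive mixing error
  to be compared with the least possible P, of order \<delta> to the power (n+1)^d, hence gaps of
  order n^d. The search range is exponentially larger than such gaps, which leaves room for
  separated slabs. The two sides of the bound have different sources: the lower one needs
  n^(-\<epsilon>) summable, so \<epsilon> > 1; the upper one needs about 2 ln n / ln (8/7) slabs of
  volume at least 1/P for a failure probability n^(-2), and this fixes the threshold for \<epsilon>.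
  A cost factor below 1 per spin exists only with at least two letters, so a one-letter alphabet is
  separated off. The specific entropy is defined by \<open>lim\<close>, so convergence must be
  proved before it says anything; one double limit, cube size before block size, serves both the
  means and almost every configuration.\<close>

definition agree :: "'x set \<Rightarrow> ('x \<Rightarrow> 'b) \<Rightarrow> ('x \<Rightarrow> 'b) set" where
  "agree V p = {\<sigma>. \<forall>y\<in>V. \<sigma> y = p y}"

text \<open>Set-theoretic stand-in for membership in the sigma-field of \<open>V\<close>: invariance
  under changes off \<open>V\<close> passes to intersections and shifts by pure logic, and
  measurability is recovered for finite \<open>V\<close>.\<close>

definition depends_on :: "'x set \<Rightarrow> ('x \<Rightarrow> 'b) set \<Rightarrow> bool" where
  "depends_on V E \<longleftrightarrow> (\<forall>\<sigma> \<sigma>'. (\<forall>y\<in>V. \<sigma> y = \<sigma>' y) \<longrightarrow> (\<sigma> \<in> E \<longleftrightarrow> \<sigma>' \<in> E))"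

lemma depends_on_agree: "depends_on V (agree V p)"
  by (auto simp: depends_on_def agree_def)

lemma depends_on_mono: "depends_on V E \<Longrightarrow> V \<subseteq> W \<Longrightarrow> depends_on W E"
  unfolding depends_on_def by blast

lemma depends_on_Int: "depends_on V E \<Longrightarrow> depends_on V F \<Longrightarrow> depends_on V (E \<inter> F)"
  unfolding depends_on_def by blast

lemma agree_restrict [simp]: "agree V (restrict p V) = agree V p"
  by (auto simp: agree_def)

lemma agree_cong: "(\<And>y. y \<in> V \<Longrightarrow> p y = q y) \<Longrightarrow> agree V p = agree V q"
  by (auto simp: agree_def)

lemma agree_empty [simp]: "agree {} p = UNIV"
  by (simp add: agree_def)

lemma agree_Un: "agree (V \<union> W) p = agree V p \<inter> agree W p"
  by (auto simp: agree_def)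

lemma agree_antimono: "V \<subseteq> W \<Longrightarrow> agree W p \<subseteq> agree V p"
  by (auto simp: agree_def)

lemma agree_self [simp]: "p \<in> agree V p"
  by (simp add: agree_def)

text \<open>\<open>agree V p\<close> makes sense for any configuration \<open>p\<close>, whereas
  \<open>cylinder V p\<close> is empty unless \<open>p\<close> is extensional on \<open>V\<close>.
  Extensional patterns serve mainly to index finite sums.\<close>

lemma cylinder_eq_agree: "p \<in> V \<rightarrow>\<^sub>E UNIV \<Longrightarrow> cylinder V p = agree V p"
  unfolding cylinder_def agree_def
  by (auto simp: PiE_def extensional_def fun_eq_iff restrict_def)

lemma cylinder_restrict: "cylinder V (restrict \<sigma> V) = agree V \<sigma>"
  by (subst cylinder_eq_agree) auto

lemma disjoint_family_agree: "disjoint_family_on (agree V) (V \<rightarrow>\<^sub>E UNIV)"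
proof (unfold disjoint_family_on_def, intro ballI impI)
  fix p q :: "'a \<Rightarrow> 'b"
  assume pq: "p \<in> V \<rightarrow>\<^sub>E UNIV" "q \<in> V \<rightarrow>\<^sub>E UNIV" "p \<noteq> q"
  then obtain y where "y \<in> V" "p y \<noteq> q y"
    by (meson PiE_ext)
  then show "agree V p \<inter> agree V q = {}"
    by (auto simp: agree_def)
qed

lemma UN_agree: "(\<Union>p\<in>V \<rightarrow>\<^sub>E UNIV. agree V p) = UNIV"
proof (rule UNIV_eq_I[symmetric])
  fix \<sigma>
  show "\<sigma> \<in> (\<Union>p\<in>V \<rightarrow>\<^sub>E UNIV. agree V p)"
    by (rule UN_I[of "restrict \<sigma> V"]) auto
qed

lemma depends_on_eq_UN_agree:
  assumes "depends_on V E"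
  shows "E = (\<Union>p\<in>(\<lambda>\<sigma>. restrict \<sigma> V) ` E. agree V p)"
  using assms by (fastforce simp: depends_on_def agree_def)

lemma space_config_borel [simp]: "space config_borel = UNIV"
  by (simp add: config_borel_def space_measure_of_conv)

lemma space_sigma_field_on [simp]: "space (sigma_field_on V) = UNIV"
  by (simp add: sigma_field_on_def space_measure_of_conv)

lemma sets_sigma_field_on:
  "sets (sigma_field_on V) = sigma_sets UNIV {(\<lambda>\<sigma>. \<sigma> x) -` B | x B. x \<in> V}"
  by (simp add: sigma_field_on_def)

lemma sets_config_borel:
  "sets config_borel =
     sigma_sets UNIV {S. openin (product_topology (\<lambda>_. discrete_topology UNIV) UNIV) S}"
  by (simp add: config_borel_def)

lemma agree_in_sigma_field_on:
  assumes "finite W" "W \<subseteq> V"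
  shows "agree W p \<in> sets (sigma_field_on V)"
  using assms
proof (induction W)
  case empty
  show ?case using sets.top[of "sigma_field_on V"] by simp
next
  case (insert x W)
  have "agree (insert x W) p = ((\<lambda>\<sigma>. \<sigma> x) -` {p x}) \<inter> agree W p"
    by (auto simp: agree_def)
  moreover have "(\<lambda>\<sigma>. \<sigma> x) -` {p x} \<in> sets (sigma_field_on V)"
    using insert.prems unfolding sets_sigma_field_on by (intro sigma_sets.Basic) blast
  ultimately show ?case using insert by auto
qed

lemma finite_patterns [simp]:
  fixes V :: "(int ^ 'd::finite) set"
  assumes "finite V"
  shows "finite (V \<rightarrow>\<^sub>E (UNIV :: 'a::finite set))"
  using assms by (intro finite_PiE) auto

lemma depends_on_in_sigma_field_on:
  fixes E :: "('d::finite, 'a::finite) config set"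
  assumes "finite V" "depends_on V E"
  shows "E \<in> sets (sigma_field_on V)"
proof -
  have "finite ((\<lambda>\<sigma>. restrict \<sigma> V) ` E)"
    by (rule finite_subset[of _ "V \<rightarrow>\<^sub>E UNIV"]) (use assms in auto)
  then show ?thesis
    by (subst depends_on_eq_UN_agree[OF assms(2)], intro sets.finite_UN agree_in_sigma_field_on) (use assms in auto)
qed

lemma sigma_field_on_subset_config_borel:
  "sets (sigma_field_on V :: ('d::finite, 'a::finite) config measure) \<subseteq> sets config_borel"
  unfolding sets_sigma_field_on
proof (rule sets.sigma_sets_subset[of _ config_borel, simplified], safe)
  fix x :: "int ^ 'd" and B :: "'a set"
  assume "x \<in> V"
  let ?T = "product_topology (\<lambda>_::int ^ 'd. discrete_topology (UNIV :: 'a set)) UNIV"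
  have "continuous_map ?T (discrete_topology UNIV) (\<lambda>\<sigma>. \<sigma> x)"
    by (rule continuous_map_product_projection) simp
  from openin_continuous_map_preimage[OF this, of B]
  have "openin ?T ((\<lambda>\<sigma>. \<sigma> x) -` B)"
    by (simp add: vimage_def)
  then show "(\<lambda>\<sigma>. \<sigma> x) -` B \<in> sets config_borel"
    unfolding sets_config_borel by (intro sigma_sets.Basic) simp
qed

lemma agree_in_config_borel:
  "finite V \<Longrightarrow> agree V p \<in> sets (config_borel :: ('d::finite, 'a::finite) config measure)"
  using agree_in_sigma_field_on[of V V p] sigma_field_on_subset_config_borel by blast

lemma depends_on_in_config_borel:
  fixes E :: "('d::finite, 'a::finite) config set"
  shows "finite V \<Longrightarrow> depends_on V E \<Longrightarrow> E \<in> sets config_borel"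
  using depends_on_in_sigma_field_on sigma_field_on_subset_config_borel by blast

lemma shift_measurable:
  "shift x \<in> measurable (config_borel :: ('d::finite, 'a::finite) config measure) config_borel"
proof -
  let ?T = "product_topology (\<lambda>_::int ^ 'd. discrete_topology (UNIV :: 'a set)) UNIV"
  have cont: "continuous_map ?T ?T (shift x)"
    unfolding continuous_map_componentwise_UNIV shift_def
    by (auto intro: continuous_map_product_projection)
  show ?thesis
    unfolding config_borel_def
  proof (rule measurable_measure_of)
    fix S :: "('d, 'a) config set"
    assume "S \<in> {S. openin ?T S}"
    with cont have "openin ?T (shift x -` S)"
      using openin_continuous_map_preimage[OF cont, of S] by (simp add: vimage_def)
    then show "shift x -` S \<inter> space (sigma UNIV {S. openin ?T S}) \<in> sets (sigma UNIV {S. openin ?T S})"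
      by (auto simp: space_measure_of_conv)
  qed (auto simp: space_measure_of_conv)
qed

lemma shift_shift: "shift x (shift y \<sigma>) = shift (y + x) \<sigma>"
  by (simp add: shift_def add.assoc)

lemma shift_zero [simp]: "shift 0 \<sigma> = \<sigma>"
  by (simp add: shift_def)

lemma vimage_shift_agree:
  "shift x -` agree V p = agree ((\<lambda>y. x + y) ` V) (shift (- x) p)"
  by (auto simp: agree_def shift_def)

lemma depends_on_vimage_shift:
  "depends_on V E \<Longrightarrow> depends_on ((\<lambda>y. x + y) ` V) (shift x -` E)"
  unfolding depends_on_def by (auto simp: shift_def)

subsection \<open>Boxes of the lattice\<close>

text \<open>One shape covers cubes, slabs, neighbourhoods and block indices, so that all their
  cardinalities come from \<open>card_box_vec\<close>.\<close>

definition box_vec :: "('d::finite \<Rightarrow> int set) \<Rightarrow> (int ^ 'd) set" where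
  "box_vec S = {x. \<forall>i. x $ i \<in> S i}"

lemma box_vec_image: "box_vec S = vec_lambda ` (PiE UNIV (S :: 'd::finite \<Rightarrow> int set))"
proof (intro set_eqI iffI)
  fix x
  assume "x \<in> box_vec S"
  then show "x \<in> vec_lambda ` (PiE UNIV S)"
    by (intro image_eqI[of _ _ "vec_nth x"]) (auto simp: box_vec_def)
qed (auto simp: box_vec_def PiE_iff)

lemma card_box_vec: "card (box_vec S) = (\<Prod>i\<in>UNIV. card (S i))"
proof -
  have "inj_on vec_lambda (PiE UNIV S)"
    by (meson injI inj_on_subset subset_UNIV vec_lambda_inject[OF UNIV_I UNIV_I])
  then show ?thesis
    by (simp add: box_vec_image card_image card_PiE)
qed

lemma finite_box_vec [intro]: "(\<And>i. finite (S i)) \<Longrightarrow> finite (box_vec S)"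
  by (simp add: box_vec_image finite_PiE)

lemma cube_eq_box_vec: "cube n = box_vec (\<lambda>_. {0..int n})"
  by (auto simp: cube_def box_vec_def)

lemma finite_cube [simp]: "finite (cube n)"
  by (auto simp: cube_eq_box_vec)

lemma card_cube: "card (cube n :: (int ^ 'd::finite) set) = (n + 1) ^ CARD('d)"
  by (simp add: cube_eq_box_vec card_box_vec nat_add_distrib)

lemma zero_in_cube [simp]: "0 \<in> cube n"
  by (simp add: cube_def)

lemma cube_nonempty [simp]: "cube n \<noteq> {}"
  using zero_in_cube by blast

subsection \<open>Interaction energies\<close>

definition interaction_norm ::
    "((int ^ 'd::finite) set \<Rightarrow> ('d, 'a) config \<Rightarrow> real) \<Rightarrow> (int ^ 'd) set \<Rightarrow> real" where
  "interaction_norm U A = (SUP \<sigma>. \<bar>U A \<sigma>\<bar>)"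

lemma infsum_le_infsum_add:
  fixes f g h :: "'x \<Rightarrow> real"
  assumes "f summable_on X" "g summable_on X" "h summable_on X"
    and "\<And>A. A \<in> X \<Longrightarrow> \<bar>f A - g A\<bar> \<le> h A"
  shows "\<bar>infsum f X - infsum g X\<bar> \<le> infsum h X"
proof -
  have "infsum f X \<le> infsum (\<lambda>A. g A + h A) X" "infsum g X \<le> infsum (\<lambda>A. f A + h A) X"
    by (intro infsum_mono summable_on_add assms; use assms(4) in force)+
  with assms show ?thesis
    by (simp add: infsum_add)
qed

context
  fixes U :: "(int ^ 'd::finite) set \<Rightarrow> ('d, 'a::finite) config \<Rightarrow> real"
  assumes inter: "translation_invariant_interaction U"
begin

text \<open>By locality \<open>U A\<close> takes only the finitely many values attained on patterns
  of \<open>A\<close>; this boundedness is what makes the supremum in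
  \<open>interaction_norm\<close> a genuine upper bound.\<close>

lemma abs_interaction_le:
  assumes "finite A" "A \<noteq> {}"
  shows "\<bar>U A \<sigma>\<bar> \<le> interaction_norm U A"
proof -
  have loc: "restrict \<sigma> A = restrict \<sigma>' A \<Longrightarrow> U A \<sigma> = U A \<sigma>'" for \<sigma> \<sigma>'
    using inter assms unfolding translation_invariant_interaction_def by blast
  have "range (\<lambda>\<sigma>. \<bar>U A \<sigma>\<bar>) \<subseteq> (\<lambda>\<sigma>. \<bar>U A \<sigma>\<bar>) ` (A \<rightarrow>\<^sub>E UNIV)"
  proof (rule image_subsetI)
    fix \<sigma>
    show "\<bar>U A \<sigma>\<bar> \<in> (\<lambda>\<sigma>. \<bar>U A \<sigma>\<bar>) ` (A \<rightarrow>\<^sub>E UNIV)"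
      by (rule image_eqI[of _ _ "restrict \<sigma> A"], rule arg_cong[where f = abs], rule loc) auto
  qed
  then have "finite (range (\<lambda>\<sigma>. \<bar>U A \<sigma>\<bar>))"
    by (rule finite_subset) (use assms in simp)
  then show ?thesis
    unfolding interaction_norm_def by (intro cSUP_upper bdd_above_finite) auto
qed

lemma interaction_norm_nonneg: "finite A \<Longrightarrow> A \<noteq> {} \<Longrightarrow> 0 \<le> interaction_norm U A"
  using abs_interaction_le[of A undefined] by linarith

lemma interaction_norm_translate:
  assumes "finite A" "A \<noteq> {}"
  shows "interaction_norm U ((\<lambda>y. y + x) ` A) = interaction_norm U A"
proof -
  have *: "U ((\<lambda>y. y + x) ` A) (shift (- x) \<sigma>) = U A \<sigma>" for \<sigma>
    using inter assms unfolding translation_invariant_interaction_def by blast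
  have "surj (shift (- x) :: ('d, 'a) config \<Rightarrow> _)"
    by (rule surjI[of _ "shift x"]) (simp add: shift_shift)
  then have "range (\<lambda>\<sigma>. \<bar>U ((\<lambda>y. y + x) ` A) \<sigma>\<bar>) =
      (\<lambda>\<sigma>. \<bar>U ((\<lambda>y. y + x) ` A) \<sigma>\<bar>) ` range (shift (- x))"
    by simp
  also have "\<dots> = range (\<lambda>\<sigma>. \<bar>U ((\<lambda>y. y + x) ` A) (shift (- x) \<sigma>)\<bar>)"
    by (rule image_image)
  finally show ?thesis
    unfolding interaction_norm_def * by simp
qed

definition total_norm :: real where
  "total_norm = infsum (interaction_norm U) {A. finite A \<and> 0 \<in> A}"

definition tail_norm :: "nat \<Rightarrow> real" where
  "tail_norm R = infsum (interaction_norm U)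
     {A. finite A \<and> 0 \<in> A \<and> \<not> A \<subseteq> box_vec (\<lambda>_. {- int R..int R})}"

lemma summable_at_zero: "interaction_norm U summable_on {A. finite A \<and> 0 \<in> A}"
  using inter unfolding translation_invariant_interaction_def interaction_norm_def by blast

text \<open>The predicate \<open>Q\<close> travels with the translation, so one bijection serves
  both the full sum at a site and the part of it that leaves a cube.\<close>

lemma bij_translate_sets:
  "bij_betw (\<lambda>A. (\<lambda>y. y + x) ` A) {A. finite A \<and> (0::int ^ 'd) \<in> A \<and> Q ((\<lambda>y. y + x) ` A)}
     {A. finite A \<and> x \<in> A \<and> Q A}"
proof (rule bij_betw_byWitness[where f' = "\<lambda>A. (\<lambda>y. y + - x) ` A"])
  show "(\<lambda>A. (\<lambda>y. y + - x) ` A) ` {A. finite A \<and> x \<in> A \<and> Q A}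
      \<subseteq> {A. finite A \<and> 0 \<in> A \<and> Q ((\<lambda>y. y + x) ` A)}"
    by (auto simp: image_image image_iff)
qed (auto simp: image_image)

lemma summable_at: "interaction_norm U summable_on {A. finite A \<and> x \<in> A}"
proof -
  have "(\<lambda>A. interaction_norm U ((\<lambda>y. y + x) ` A)) summable_on {A. finite A \<and> 0 \<in> A}"
    by (subst summable_on_cong[OF interaction_norm_translate]) (auto simp: summable_at_zero)
  then show ?thesis
    using summable_on_reindex_bij_betw[OF bij_translate_sets[of x "\<lambda>_. True"], of "interaction_norm U"]
    by simp
qed

lemma infsum_at:
  "infsum (interaction_norm U) {A. finite A \<and> x \<in> A \<and> Q A} =
   infsum (interaction_norm U) {A. finite A \<and> 0 \<in> A \<and> Q ((\<lambda>y. y + x) ` A)}"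
proof -
  have "infsum (interaction_norm U) {A. finite A \<and> x \<in> A \<and> Q A} =
      infsum (\<lambda>A. interaction_norm U ((\<lambda>y. y + x) ` A)) {A. finite A \<and> 0 \<in> A \<and> Q ((\<lambda>y. y + x) ` A)}"
    by (rule infsum_reindex_bij_betw[OF bij_translate_sets, symmetric])
  also have "\<dots> = infsum (interaction_norm U) {A. finite A \<and> 0 \<in> A \<and> Q ((\<lambda>y. y + x) ` A)}"
    by (rule infsum_cong, rule interaction_norm_translate) auto
  finally show ?thesis .
qed

lemma summable_meeting:
  assumes "finite \<Lambda>"
  shows "interaction_norm U summable_on {A. finite A \<and> A \<inter> \<Lambda> \<noteq> {}}"
  using assms
proof (induction \<Lambda>)
  case (insert x \<Lambda>)
  have "{A. finite A \<and> A \<inter> insert x \<Lambda> \<noteq> {}} = {A. finite A \<and> x \<in> A} \<union> {A. finite A \<and> A \<inter> \<Lambda> \<noteq> {}}"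
    by auto
  then show ?case
    using insert summable_at[of x] by (simp add: summable_on_union)
qed auto

lemma infsum_meeting_le:
  assumes "finite \<Lambda>"
  shows "infsum (interaction_norm U) {A. finite A \<and> A \<inter> \<Lambda> \<noteq> {} \<and> Q A} \<le>
    (\<Sum>x\<in>\<Lambda>. infsum (interaction_norm U) {A. finite A \<and> x \<in> A \<and> Q A})"
  using assms
proof (induction \<Lambda>)
  case (insert x \<Lambda>)
  let ?B = "{A. finite A \<and> x \<in> A \<and> Q A}" and ?C = "{A. finite A \<and> A \<inter> \<Lambda> \<noteq> {} \<and> Q A}"
  have sB: "interaction_norm U summable_on ?B"
    by (rule summable_on_subset_banach[OF summable_at[of x]]) auto
  have sC: "interaction_norm U summable_on ?C"
    by (rule summable_on_subset_banach[OF summable_meeting[OF insert.hyps(1)]]) auto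
  have sD: "interaction_norm U summable_on (?C - ?B)"
    by (rule summable_on_subset_banach[OF sC]) auto
  have eq: "{A. finite A \<and> A \<inter> insert x \<Lambda> \<noteq> {} \<and> Q A} = ?B \<union> (?C - ?B)"
    by auto
  have "infsum (interaction_norm U) {A. finite A \<and> A \<inter> insert x \<Lambda> \<noteq> {} \<and> Q A} =
      infsum (interaction_norm U) ?B + infsum (interaction_norm U) (?C - ?B)"
    unfolding eq by (rule infsum_Un_disjoint[OF sB sD]) auto
  also have "infsum (interaction_norm U) (?C - ?B) \<le> infsum (interaction_norm U) ?C"
    by (rule infsum_mono2[OF sD sC]) (auto intro!: interaction_norm_nonneg)
  finally show ?case
    using insert by simp
qed simp

lemma infsum_at_le_total: "infsum (interaction_norm U) {A. finite A \<and> x \<in> A \<and> Q A} \<le> total_norm"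
  unfolding total_norm_def
  by (subst infsum_at, rule infsum_mono2[OF summable_on_subset_banach[OF summable_at_zero] summable_at_zero])
    (auto intro!: interaction_norm_nonneg)

lemma total_norm_nonneg: "0 \<le> total_norm"
  unfolding total_norm_def by (rule infsum_nonneg) (auto intro!: interaction_norm_nonneg)

text \<open>A finite subfamily carries the sum up to r/2 and occupies finitely many sites. Once the
  box contains those sites, every set leaving the box lies outside the subfamily.\<close>

lemma tail_norm_tendsto_0: "tail_norm \<longlonglongrightarrow> 0"
proof (rule LIMSEQ_I)
  fix r :: real
  assume "r > 0"
  let ?S = "{A. finite A \<and> (0::int ^ 'd) \<in> A}"
  obtain F where F: "finite F" "F \<subseteq> ?S"
    and d: "dist (sum (interaction_norm U) F) (infsum (interaction_norm U) ?S) \<le> r / 2"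
    using infsum_finite_approximation[OF summable_at_zero, of "r / 2"] \<open>r > 0\<close> by auto
  have "finite (\<Union> F)" using F by auto
  define R0 where "R0 = (\<Sum>y\<in>\<Union>F. \<Sum>i\<in>UNIV. nat \<bar>y $ i\<bar>)"
  have R0: "nat \<bar>y $ i\<bar> \<le> R0" if "y \<in> \<Union>F" for y i
  proof -
    have "nat \<bar>y $ i\<bar> \<le> (\<Sum>i\<in>UNIV. nat \<bar>y $ i\<bar>)"
      by (rule member_le_sum) auto
    also have "\<dots> \<le> R0"
      unfolding R0_def by (rule member_le_sum[of y _ "\<lambda>y. \<Sum>i\<in>UNIV. nat \<bar>y $ i\<bar>"]) (use that \<open>finite (\<Union>F)\<close> in auto)
    finally show ?thesis .
  qed
  show "\<exists>N. \<forall>R\<ge>N. norm (tail_norm R - 0) < r"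
  proof (intro exI allI impI)
    fix R
    assume "R \<ge> R0"
    let ?T = "{A. finite A \<and> 0 \<in> A \<and> \<not> A \<subseteq> box_vec (\<lambda>_. {- int R..int R}) }"
    have sub: "A \<subseteq> box_vec (\<lambda>_. {- int R..int R})" if "A \<in> F" for A
    proof
      fix y assume "y \<in> A"
      then have "nat \<bar>y $ i\<bar> \<le> R" for i using R0[of y i] that \<open>R \<ge> R0\<close> by force
      then have "\<bar>y $ i\<bar> \<le> int R" for i by (simp add: nat_le_iff)
      then show "y \<in> box_vec (\<lambda>_. {- int R..int R})"
        by (auto simp: box_vec_def abs_le_iff) (metis minus_le_iff)
    qed
    have T: "?T \<subseteq> ?S - F" using sub by blast
    have s: "interaction_norm U summable_on (?S - F)" "interaction_norm U summable_on ?T"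
      by (rule summable_on_subset_banach[OF summable_at_zero]; auto)+
    have "tail_norm R \<le> infsum (interaction_norm U) (?S - F)"
      unfolding tail_norm_def
      by (rule infsum_mono2[OF s(2,1) T]) (auto intro!: interaction_norm_nonneg)
    moreover have "infsum (interaction_norm U) (F \<union> (?S - F)) =
        sum (interaction_norm U) F + infsum (interaction_norm U) (?S - F)"
      by (subst infsum_Un_disjoint) (use F s in auto)
    moreover have "F \<union> (?S - F) = ?S" using F by auto
    moreover have "0 \<le> tail_norm R"
      unfolding tail_norm_def by (rule infsum_nonneg) (auto intro!: interaction_norm_nonneg)
    ultimately show "norm (tail_norm R - 0) < r"
      using d \<open>r > 0\<close> by (simp add: dist_real_def)
  qed
qed

definition crossing_norm :: "(int ^ 'd) set \<Rightarrow> real" where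
  "crossing_norm \<Lambda> = infsum (interaction_norm U) {A. finite A \<and> A \<inter> \<Lambda> \<noteq> {} \<and> \<not> A \<subseteq> \<Lambda>}"

lemma crossing_norm_nonneg: "0 \<le> crossing_norm \<Lambda>"
  unfolding crossing_norm_def by (rule infsum_nonneg) (auto intro!: interaction_norm_nonneg)

text \<open>A set through a site at depth at least R that leaves the cube also leaves the box of
  radius R around that site, so such sites contribute only \<open>tail_norm R\<close>. The remaining
  shell of sites is charged the full norm. For fixed R and large n both terms are small against n^d,
  up to the factor \<open>tail_norm R\<close>.\<close>

lemma crossing_norm_cube_le:
  assumes "2 * R \<le> n"
  shows "crossing_norm (cube n) \<le> real (n + 1) ^ CARD('d) * tail_norm R +
    (real (n + 1) ^ CARD('d) - real (n + 1 - 2 * R) ^ CARD('d)) * total_norm"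
proof -
  let ?I = "box_vec (\<lambda>_. {int R..int n - int R}) :: (int ^ 'd) set"
  let ?f = "\<lambda>x. infsum (interaction_norm U) {A. finite A \<and> x \<in> A \<and> \<not> A \<subseteq> cube n}"
  have sub: "?I \<subseteq> cube n"
  proof
    fix x :: "int ^ 'd"
    assume "x \<in> ?I"
    then have "int R \<le> x $ i" "x $ i \<le> int n - int R" for i by (auto simp: box_vec_def)
    then have "0 \<le> x $ i" "x $ i \<le> int n" for i by (smt (verit) of_nat_0_le_iff)+
    then show "x \<in> cube n" by (simp add: cube_def)
  qed
  have int_le: "?f x \<le> tail_norm R" if x: "x \<in> ?I" for x
    unfolding tail_norm_def
  proof (subst infsum_at, rule infsum_mono2)
    show "{A. finite A \<and> 0 \<in> A \<and> \<not> (\<lambda>y. y + x) ` A \<subseteq> cube n}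
      \<subseteq> {A. finite A \<and> 0 \<in> A \<and> \<not> A \<subseteq> box_vec (\<lambda>_. {- int R..int R})}"
    proof safe
      fix A y
      assume A: "A \<subseteq> box_vec (\<lambda>_. {- int R..int R})" "y \<in> A" "y + x \<notin> cube n"
      have "- int R \<le> y $ i \<and> y $ i \<le> int R \<and> int R \<le> x $ i \<and> x $ i \<le> int n - int R" for i
        using A x by (auto simp: box_vec_def)
      then have "0 \<le> y $ i + x $ i \<and> y $ i + x $ i \<le> int n" for i
        by (smt (verit))
      with A show False by (simp add: cube_def)
    qed
  qed (auto intro!: interaction_norm_nonneg summable_on_subset_banach[OF summable_at_zero])
  have cardI: "real (card ?I) = real (n + 1 - 2 * R) ^ CARD('d)"
    using assms by (simp add: card_box_vec add.commute add_diff_eq)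
  have card_diff: "real (card (cube n - ?I)) = real (n + 1) ^ CARD('d) - real (n + 1 - 2 * R) ^ CARD('d)"
    using sub cardI card_mono[OF finite_cube sub]
    by (subst card_Diff_subset) (auto simp: card_cube of_nat_diff finite_subset[OF sub finite_cube])
  have tail_nn: "0 \<le> tail_norm R"
      unfolding tail_norm_def by (rule infsum_nonneg) (auto intro!: interaction_norm_nonneg)
  have "crossing_norm (cube n) \<le> (\<Sum>x\<in>cube n. ?f x)"
    unfolding crossing_norm_def by (rule infsum_meeting_le) simp
  also have "\<dots> = (\<Sum>x\<in>?I. ?f x) + (\<Sum>x\<in>cube n - ?I. ?f x)"
    by (simp add: sum.subset_diff[OF sub] add.commute)
  also have "\<dots> \<le> (\<Sum>x\<in>?I. tail_norm R) + (\<Sum>x\<in>cube n - ?I. total_norm)"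
    by (intro add_mono sum_mono int_le infsum_at_le_total)
  also have "\<dots> = real (card ?I) * tail_norm R + real (card (cube n - ?I)) * total_norm"
    by simp
  also have "real (card ?I) * tail_norm R \<le> real (n + 1) ^ CARD('d) * tail_norm R"
    unfolding cardI by (intro mult_right_mono power_mono tail_nn) auto
  finally show ?thesis
    unfolding card_diff by simp
qed

lemma hamiltonian_terms_summable:
  assumes "finite \<Lambda>"
  shows "(\<lambda>A. U A (g A)) summable_on {A. finite A \<and> A \<inter> \<Lambda> \<noteq> {}}"
  by (rule abs_summable_summable, rule summable_on_comparison_test[OF summable_meeting[OF assms]])
    (auto intro!: abs_interaction_le)

text \<open>Terms with A inside \<Lambda> do not see the boundary condition; each other term changes
  by at most twice its norm.\<close>

lemma abs_hamiltonian_diff_le: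
  assumes "finite \<Lambda>"
  shows "\<bar>hamiltonian U \<Lambda> \<zeta> p - hamiltonian U \<Lambda> \<zeta>' p\<bar> \<le> 2 * crossing_norm \<Lambda>"
proof -
  let ?X = "{A. finite A \<and> A \<inter> \<Lambda> \<noteq> {}}"
  let ?h = "\<lambda>A. if A \<subseteq> \<Lambda> then 0 else 2 * interaction_norm U A"
  have "\<bar>hamiltonian U \<Lambda> \<zeta> p - hamiltonian U \<Lambda> \<zeta>' p\<bar> \<le> infsum ?h ?X"
    unfolding hamiltonian_def
  proof (rule infsum_le_infsum_add)
    show "?h summable_on ?X"
      by (rule summable_on_comparison_test[OF summable_on_cmult_right[OF summable_meeting[OF assms], of 2]])
        (auto intro!: interaction_norm_nonneg)
    fix A
    assume A: "A \<in> ?X"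
    show "\<bar>U A (override_on \<zeta> p \<Lambda>) - U A (override_on \<zeta>' p \<Lambda>)\<bar> \<le> ?h A"
    proof (cases "A \<subseteq> \<Lambda>")
      case True
      then have "restrict (override_on \<zeta> p \<Lambda>) A = restrict (override_on \<zeta>' p \<Lambda>) A"
        by (intro ext) (auto simp: restrict_def override_on_def)
      then have "U A (override_on \<zeta> p \<Lambda>) = U A (override_on \<zeta>' p \<Lambda>)"
        using inter A unfolding translation_invariant_interaction_def by blast
      with True show ?thesis by simp
    next
      case False
      have "finite A" "A \<noteq> {}" using A by auto
      from abs_interaction_le[OF this, of "override_on \<zeta> p \<Lambda>"]
        abs_interaction_le[OF this, of "override_on \<zeta>' p \<Lambda>"] False
      show ?thesis by simp
    qed
  qed (rule hamiltonian_terms_summable[OF assms])+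
  also have "infsum ?h ?X = infsum (\<lambda>A. 2 * interaction_norm U A) {A. finite A \<and> A \<inter> \<Lambda> \<noteq> {} \<and> \<not> A \<subseteq> \<Lambda>}"
    by (rule infsum_cong_neutral) auto
  also have "\<dots> = 2 * crossing_norm \<Lambda>"
    by (simp add: infsum_cmult_right' crossing_norm_def)
  finally show ?thesis .
qed

lemma abs_hamiltonian_single_le: "\<bar>hamiltonian U {x} \<zeta> p\<bar> \<le> total_norm"
proof -
  let ?X = "{A. finite A \<and> A \<inter> {x} \<noteq> {}}"
  have "\<bar>hamiltonian U {x} \<zeta> p - infsum (\<lambda>_. 0) ?X\<bar> \<le> infsum (interaction_norm U) ?X"
    unfolding hamiltonian_def
    by (rule infsum_le_infsum_add[OF hamiltonian_terms_summable _ summable_meeting])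
      (auto intro!: abs_interaction_le)
  also have "?X = {A. finite A \<and> x \<in> A \<and> True}" by auto
  finally show ?thesis
    using infsum_at_le_total[of x "\<lambda>_. True"] by simp
qed

end

subsection \<open>Translation-invariant fields\<close>

locale stationary_field = prob_space P for P :: "('d::finite, 'a::finite) config measure" +
  assumes sets_P: "sets P = sets config_borel"
    and invariant: "translation_invariant P"
begin

lemma space_P [simp]: "space P = UNIV"
  using sets_eq_imp_space_eq[OF sets_P] by simp

lemma sigma_field_on_subset: "E \<in> sets (sigma_field_on V) \<Longrightarrow> E \<in> events"
  using sigma_field_on_subset_config_borel sets_P by blast

lemma agree_events [simp]: "finite V \<Longrightarrow> agree V p \<in> events"
  by (simp add: sets_P agree_in_config_borel)

lemma depends_on_events: "finite V \<Longrightarrow> depends_on V E \<Longrightarrow> E \<in> events"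
  by (simp add: sets_P depends_on_in_config_borel)

lemma shift_measurable_P: "shift x \<in> measurable P P"
  using shift_measurable by (simp cong: measurable_cong_sets add: sets_P)

lemma shift_events: "E \<in> events \<Longrightarrow> shift x -` E \<in> events"
  using measurable_sets[OF shift_measurable_P] by simp

lemma prob_shift: "E \<in> events \<Longrightarrow> prob (shift x -` E) = prob E"
  using measure_distr[OF shift_measurable_P[of x], of E] invariant
  by (simp add: translation_invariant_def)

lemma sum_prob_agree:
  assumes "finite V" "E \<in> events"
  shows "(\<Sum>p\<in>V \<rightarrow>\<^sub>E UNIV. prob (agree V p \<inter> E)) = prob E"
proof -
  have "prob (\<Union>p\<in>V \<rightarrow>\<^sub>E UNIV. agree V p \<inter> E) = (\<Sum>p\<in>V \<rightarrow>\<^sub>E UNIV. prob (agree V p \<inter> E))"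
  proof (rule finite_measure_finite_Union)
    show "disjoint_family_on (\<lambda>p. agree V p \<inter> E) (V \<rightarrow>\<^sub>E UNIV)"
    proof (unfold disjoint_family_on_def, intro ballI impI)
      fix p q :: "('d, 'a) config"
      assume "p \<in> V \<rightarrow>\<^sub>E UNIV" "q \<in> V \<rightarrow>\<^sub>E UNIV" "p \<noteq> q"
      then have "agree V p \<inter> agree V q = {}"
        using disjoint_family_onD[OF disjoint_family_agree] by metis
      then show "agree V p \<inter> E \<inter> (agree V q \<inter> E) = {}" by auto
    qed
  qed (use assms in auto)
  also have "(\<Union>p\<in>V \<rightarrow>\<^sub>E UNIV. agree V p \<inter> E) = E"
    by (simp add: UN_agree)
  finally show ?thesis by simp
qed

lemma sum_prob_agree_1:
  assumes "finite V"
  shows "(\<Sum>p\<in>V \<rightarrow>\<^sub>E UNIV. prob (agree V p)) = 1"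
  using sum_prob_agree[OF assms, of UNIV] prob_space by (simp add: sets.top[of P, simplified])

end

lemma gibbs_stationary_field: "translation_invariant_gibbs U P \<Longrightarrow> stationary_field P"
  by (simp add: translation_invariant_gibbs_def stationary_field_def stationary_field_axioms_def)

section \<open>Finite energy and factorization from the Gibbs condition\<close>

definition gibbs_weight ::
    "((int ^ 'd::finite) set \<Rightarrow> ('d, 'a::finite) config \<Rightarrow> real) \<Rightarrow> (int ^ 'd) set \<Rightarrow>
     ('d, 'a) config \<Rightarrow> ('d, 'a) config \<Rightarrow> real" where
  "gibbs_weight U \<Lambda> \<zeta> p =
     exp (- hamiltonian U \<Lambda> \<zeta> p) / (\<Sum>q \<in> \<Lambda> \<rightarrow>\<^sub>E UNIV. exp (- hamiltonian U \<Lambda> \<zeta> q))"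

context
  fixes U :: "(int ^ 'd::finite) set \<Rightarrow> ('d, 'a::finite) config \<Rightarrow> real"
    and P :: "('d, 'a) config measure"
  assumes gibbs: "translation_invariant_gibbs U P"
begin

interpretation stationary_field P
  by (rule gibbs_stationary_field[OF gibbs])

lemma gibbs_interaction: "translation_invariant_interaction U"
  using gibbs by (simp add: translation_invariant_gibbs_def)

text \<open>Integrating the conditional probability of the pattern over \<open>E\<close> gives the
  joint probability, so bounds on the weight that hold for all boundary conditions become factors of
  \<open>prob E\<close>.\<close>

lemma gibbs_prob_bounds:
  assumes "finite \<Lambda>" "\<Lambda> \<noteq> {}" "p \<in> \<Lambda> \<rightarrow>\<^sub>E UNIV" and E: "E \<in> sets (sigma_field_on (- \<Lambda>))"
  shows "(\<And>\<zeta>. lo \<le> gibbs_weight U \<Lambda> \<zeta> p) \<Longrightarrow> lo * prob E \<le> prob (agree \<Lambda> p \<inter> E)"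
    and "(\<And>\<zeta>. gibbs_weight U \<Lambda> \<zeta> p \<le> hi) \<Longrightarrow> prob (agree \<Lambda> p \<inter> E) \<le> hi * prob E"
proof -
  let ?F = "sigma_field_on (- \<Lambda>) :: ('d, 'a) config measure"
  let ?f = "indicator (agree \<Lambda> p) :: ('d, 'a) config \<Rightarrow> real"
  interpret F: finite_measure_subalgebra P ?F
    by standard (auto simp: subalgebra_def intro: sigma_field_on_subset)
  have AE: "AE \<zeta> in P. real_cond_exp P ?F ?f \<zeta> = gibbs_weight U \<Lambda> \<zeta> p"
  proof -
    have "AE \<zeta> in P. \<forall>p \<in> \<Lambda> \<rightarrow>\<^sub>E UNIV.
          real_cond_exp P ?F (indicator (cylinder \<Lambda> p)) \<zeta> = gibbs_weight U \<Lambda> \<zeta> p"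
      using gibbs assms(1,2) unfolding translation_invariant_gibbs_def gibbs_weight_def by blast
    then show ?thesis
      by eventually_elim (use assms(3) cylinder_eq_agree[OF assms(3)] in auto)
  qed
  have int_f: "integrable P ?f"
    using assms(1) by (intro integrable_real_indicator) (auto simp: emeasure_eq_measure)
  have EM: "E \<in> events" using E by (rule sigma_field_on_subset)
  have int_c: "set_integrable P E (\<lambda>_. c)" for c :: real
    unfolding set_integrable_def using EM by (intro integrable_mult_indicator) auto
  have int_r: "set_integrable P E (real_cond_exp P ?F ?f)"
    unfolding set_integrable_def
    by (intro integrable_mult_indicator EM F.real_cond_exp_int(1) int_f)
  have "prob (agree \<Lambda> p \<inter> E) = (LINT \<zeta>:E|P. ?f \<zeta>)"
    unfolding set_lebesgue_integral_def using assms(1) EM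
    by (simp add: indicator_inter_arith[symmetric] Int_commute)
  also have "\<dots> = (LINT \<zeta>:E|P. real_cond_exp P ?F ?f \<zeta>)"
    by (rule F.real_cond_exp_intA[OF int_f E])
  finally have eq: "prob (agree \<Lambda> p \<inter> E) = (LINT \<zeta>:E|P. real_cond_exp P ?F ?f \<zeta>)" .
  have const: "(LINT \<zeta>:E|P. c) = c * prob E" for c :: real
    using EM by (simp add: set_lebesgue_integral_def)
  show "lo * prob E \<le> prob (agree \<Lambda> p \<inter> E)" if "\<And>\<zeta>. lo \<le> gibbs_weight U \<Lambda> \<zeta> p"
    unfolding eq const[symmetric]
    by (rule set_integral_mono_AE[OF int_c int_r]) (use AE that in \<open>auto elim: eventually_mono\<close>)
  show "prob (agree \<Lambda> p \<inter> E) \<le> hi * prob E" if "\<And>\<zeta>. gibbs_weight U \<Lambda> \<zeta> p \<le> hi"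
    unfolding eq const[symmetric]
    by (rule set_integral_mono_AE[OF int_r int_c]) (use AE that in \<open>auto elim: eventually_mono\<close>)
qed

lemma partition_function_pos:
  assumes "finite \<Lambda>"
  shows "0 < (\<Sum>q \<in> \<Lambda> \<rightarrow>\<^sub>E UNIV. exp (- hamiltonian U \<Lambda> \<zeta> q))"
  using assms by (intro sum_pos) (auto simp: PiE_eq_empty_iff)

lemma gibbs_weight_pos: "finite \<Lambda> \<Longrightarrow> 0 < gibbs_weight U \<Lambda> \<zeta> p"
  using partition_function_pos by (simp add: gibbs_weight_def)

text \<open>Changing the boundary condition alters each energy by at most twice the crossing norm.
  This enters once through the numerator and once through the partition function, whence the factor
  4.\<close>

lemma gibbs_weight_le:
  assumes "finite \<Lambda>"
  shows "gibbs_weight U \<Lambda> \<zeta> p \<le> exp (4 * crossing_norm U \<Lambda>) * gibbs_weight U \<Lambda> \<zeta>' p"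
proof -
  let ?D = "2 * crossing_norm U \<Lambda>"
  let ?Z = "\<lambda>\<zeta>. \<Sum>q \<in> \<Lambda> \<rightarrow>\<^sub>E UNIV. exp (- hamiltonian U \<Lambda> \<zeta> q)"
  have D: "\<bar>hamiltonian U \<Lambda> \<zeta> q - hamiltonian U \<Lambda> \<zeta>' q\<bar> \<le> ?D" for q
    by (rule abs_hamiltonian_diff_le[OF gibbs_interaction assms])
  have "exp (- ?D) * ?Z \<zeta>' \<le> ?Z \<zeta>"
    unfolding sum_distrib_left exp_add[symmetric]
    by (intro sum_mono) (use D in \<open>auto simp: abs_le_iff algebra_simps\<close>)
  then have "exp (- hamiltonian U \<Lambda> \<zeta> p) / ?Z \<zeta>
      \<le> exp (?D + - hamiltonian U \<Lambda> \<zeta>' p) / (exp (- ?D) * ?Z \<zeta>')"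
    by (intro frac_le) (use D[of p] partition_function_pos[OF assms] in auto)
  also have "\<dots> = exp (4 * crossing_norm U \<Lambda>) * gibbs_weight U \<Lambda> \<zeta>' p"
    using partition_function_pos[OF assms, of \<zeta>']
    by (simp add: gibbs_weight_def exp_minus exp_add field_simps flip: exp_double)
      (simp flip: exp_add)
  finally show ?thesis by (simp add: gibbs_weight_def)
qed

text \<open>Both \<open>prob (agree \<Lambda> p)\<close> and the ratio of the joint probability to
  \<open>prob E\<close> lie within a factor exp(c) of one reference weight, so their logarithms
  differ by at most 2c, that is 8 crossing norms.\<close>

lemma gibbs_factorization:
  assumes "finite \<Lambda>" "\<Lambda> \<noteq> {}" and E: "E \<in> sets (sigma_field_on (- \<Lambda>))" and "0 < prob E"
  shows "\<bar>ln (prob (agree \<Lambda> p \<inter> E)) - ln (prob (agree \<Lambda> p)) - ln (prob E)\<bar> \<le> 8 * crossing_norm U \<Lambda>"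
    "0 < prob (agree \<Lambda> p \<inter> E)"
proof -
  define c where "c = 4 * crossing_norm U \<Lambda>"
  \<comment> \<open>The reference weight is taken at one fixed boundary condition;
    \<open>undefined\<close> stands for an arbitrary configuration.\<close>
  define w where "w = gibbs_weight U \<Lambda> undefined (restrict p \<Lambda>)"
  have w: "0 < w" unfolding w_def using assms by (simp add: gibbs_weight_pos)
  have "gibbs_weight U \<Lambda> \<zeta> (restrict p \<Lambda>) \<le> exp c * w" for \<zeta>
    unfolding c_def w_def using gibbs_weight_le[OF assms(1)] .
  moreover have "exp (- c) * w \<le> gibbs_weight U \<Lambda> \<zeta> (restrict p \<Lambda>)" for \<zeta>
    using gibbs_weight_le[OF assms(1), of undefined "restrict p \<Lambda>" \<zeta>]
    by (simp add: c_def w_def exp_minus field_simps)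
  ultimately have *: "exp (- c) * w * prob F \<le> prob (agree \<Lambda> p \<inter> F)"
      "prob (agree \<Lambda> p \<inter> F) \<le> exp c * w * prob F"
    if "F \<in> sets (sigma_field_on (- \<Lambda>))" for F
    using gibbs_prob_bounds[OF assms(1,2) _ that, of "restrict p \<Lambda>"] by auto
  have top: "UNIV \<in> sets (sigma_field_on (- \<Lambda>))"
    using sets.top[of "sigma_field_on (- \<Lambda>)"] by simp
  have P1: "prob UNIV = 1" using prob_space by simp
  have lower: "0 < exp (- c) * w * prob E" using w assms by simp
  then show pos: "0 < prob (agree \<Lambda> p \<inter> E)" using *(1)[OF E] by linarith
  have pos1: "0 < prob (agree \<Lambda> p)"
    using *(1)[OF top] w P1 by (simp add: less_le_trans[rotated])
  have l: "- c + ln w + ln (prob E) \<le> ln (prob (agree \<Lambda> p \<inter> E))"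
      "ln (prob (agree \<Lambda> p \<inter> E)) \<le> c + ln w + ln (prob E)"
      "- c + ln w \<le> ln (prob (agree \<Lambda> p))" "ln (prob (agree \<Lambda> p)) \<le> c + ln w"
    using ln_mono[OF *(1)[OF E]] ln_mono[OF *(2)[OF E]] ln_mono[OF *(1)[OF top]] ln_mono[OF *(2)[OF top]]
      pos pos1 w assms(4) P1 by (auto simp: ln_mult)
  then show "\<bar>ln (prob (agree \<Lambda> p \<inter> E)) - ln (prob (agree \<Lambda> p)) - ln (prob E)\<bar> \<le> 8 * crossing_norm U \<Lambda>"
    unfolding c_def by linarith
qed

text \<open>Single-site energies are at most \<open>total_norm U\<close> in absolute value, which
  bounds the numerator from below and each of the \<open>CARD('a)\<close> terms of the partition
  function from above.\<close>

lemma gibbs_weight_single: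
  "exp (- 2 * total_norm U) / CARD('a) \<le> gibbs_weight U {x} \<zeta> p"
proof -
  let ?Z = "\<Sum>q \<in> {x} \<rightarrow>\<^sub>E UNIV. exp (- hamiltonian U {x} \<zeta> q)"
  have h: "\<bar>hamiltonian U {x} \<zeta> q\<bar> \<le> total_norm U" for q
    by (rule abs_hamiltonian_single_le[OF gibbs_interaction])
  have "?Z \<le> (\<Sum>q \<in> {x} \<rightarrow>\<^sub>E (UNIV::'a set). exp (total_norm U))"
  proof (intro sum_mono)
    show "exp (- hamiltonian U {x} \<zeta> q) \<le> exp (total_norm U)" for q
      using h[of q] by simp
  qed
  also have "\<dots> = CARD('a) * exp (total_norm U)"
    by (simp add: card_PiE)
  finally have "exp (- total_norm U) / (CARD('a) * exp (total_norm U)) \<le> gibbs_weight U {x} \<zeta> p"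
    unfolding gibbs_weight_def
    by (intro frac_le) (use h[of p] partition_function_pos[of "{x}" \<zeta>] in auto)
  moreover have "exp (- 2 * total_norm U) = exp (- total_norm U) / exp (total_norm U)"
    by (simp flip: exp_diff)
  ultimately show ?thesis by (simp add: mult.commute)
qed

lemma gibbs_finite_energy:
  assumes "finite V" "x \<notin> V"
  shows "exp (- 2 * total_norm U) / CARD('a) * prob (agree V p) \<le> prob (agree (insert x V) p)"
proof -
  have "agree V p \<in> sets (sigma_field_on (- {x}))"
    using assms by (intro agree_in_sigma_field_on) auto
  from gibbs_prob_bounds(1)[OF _ _ _ this gibbs_weight_single, of "restrict p {x}"]
  show ?thesis
    by (simp flip: agree_Un)
qed

end

subsection \<open>Consequences of mixing and finite energy\<close>

lemma abs_nth_le_l1_norm: "\<bar>x $ i\<bar> \<le> l1_norm x"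
  unfolding l1_norm_def by (rule member_le_sum) auto

lemma l1_norm_pos_iff: "0 < l1_norm x \<longleftrightarrow> x \<noteq> 0"
proof
  assume "x \<noteq> 0"
  then obtain i where "x $ i \<noteq> 0" by (auto simp: vec_eq_iff)
  then show "0 < l1_norm x" using abs_nth_le_l1_norm[of x i] by linarith
qed (auto simp: l1_norm_def)

text \<open>The interaction is forgotten from here on: only these inequalities are used. The
  constants are parameters so that distances such as \<open>gap\<close> can be defined from them.
  The error \<open>c n\<close> is measured against the number (n+1)^d of sites of
  \<open>cube n\<close>.\<close>

locale mixing_gibbs_field = stationary_field P for P :: "('d::finite, 'a::finite) config measure" +
  fixes \<delta> C1 C2 :: real and c :: "nat \<Rightarrow> real"
  assumes dim: "2 \<le> CARD('d)"
    and \<delta>: "0 < \<delta>" "\<delta> < 1"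
    and energy_lower:
      "\<And>V x p. finite V \<Longrightarrow> x \<notin> V \<Longrightarrow> \<delta> * prob (agree V p) \<le> prob (agree (insert x V) p)"
    and energy_upper:
      "\<And>V x p. finite V \<Longrightarrow> x \<notin> V \<Longrightarrow> prob (agree (insert x V) p) \<le> (1 - \<delta>) * prob (agree V p)"
    and factorization:
      "\<And>n V p. finite V \<Longrightarrow> V \<inter> cube n = {} \<Longrightarrow>
        \<bar>ln (prob (agree (cube n \<union> V) p)) - ln (prob (agree (cube n) p)) - ln (prob (agree V p))\<bar> \<le> c n"
    and c_limit: "(\<lambda>n. c n / real (n + 1) ^ CARD('d)) \<longlonglongrightarrow> 0"
    and C1: "0 < C1" and C2: "0 < C2"
    and phi_le: "\<And>m. 0 < m \<Longrightarrow> phi_mixing_coeff P m \<le> C1 * exp (- C2 * m)"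

text \<open>The upper energy bound follows from the lower one: giving \<open>x\<close> a different
  letter produces a disjoint pattern inside the same event, which already takes a share \<delta>.
  For the limit of \<open>c\<close>, the radius \<open>R\<close> is fixed before n grows, so that
  the shell of width \<open>R\<close> becomes negligible.\<close>

lemma mixing_gibbs_fieldI:
  fixes U :: "(int ^ 'd::finite) set \<Rightarrow> ('d, 'a::finite) config \<Rightarrow> real"
  assumes dim: "2 \<le> CARD('d)" and gibbs: "translation_invariant_gibbs U P"
    and mixing: "exponentially_phi_mixing P" and card: "2 \<le> CARD('a)"
  obtains \<delta> C1 C2 c where "mixing_gibbs_field P \<delta> C1 C2 c"
proof -
  interpret stationary_field P
    by (rule gibbs_stationary_field[OF gibbs])
  note inter = gibbs_interaction[OF gibbs]
  from mixing obtain C1 C2 where C: "0 < C1" "0 < C2"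
      "\<And>m. 0 < m \<Longrightarrow> phi_mixing_coeff P m \<le> C1 * exp (- C2 * m)"
    unfolding exponentially_phi_mixing_def by blast
  define \<delta> where "\<delta> = exp (- 2 * total_norm U) / CARD('a)"
  define c where "c = (\<lambda>n. 8 * crossing_norm U (cube n))"
  have "exp (- 2 * total_norm U) \<le> 1"
    using total_norm_nonneg[OF inter] by simp
  \<comment> \<open>The denominator is at least 2 because there are two letters; this is the source
    of \<delta> < 1.\<close>
  then have "\<delta> \<le> 1 / 2"
    unfolding \<delta>_def by (intro frac_le) (use card in auto)
  have "0 < \<delta>" by (simp add: \<delta>_def)
  have lower: "\<delta> * prob (agree V p) \<le> prob (agree (insert x V) p)" if "finite V" "x \<notin> V" for V x p
    unfolding \<delta>_def by (rule gibbs_finite_energy[OF gibbs that])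
  have upper: "prob (agree (insert x V) p) \<le> (1 - \<delta>) * prob (agree V p)" if V: "finite V" "x \<notin> V" for V x p
  proof -
    obtain a where a: "a \<noteq> p x"
      using card by (metis (full_types) UNIV_I card_2_iff' card_le_Suc0_iff_eq finite not_less_eq_eq numeral_2_eq_2)
    let ?q = "p(x := a)"
    have "agree V ?q = agree V p" by (rule agree_cong) (use V in auto)
    then have "\<delta> * prob (agree V p) \<le> prob (agree (insert x V) ?q)"
      using lower[OF V, of ?q] by simp
    moreover have "prob (agree (insert x V) ?q) + prob (agree (insert x V) p) =
        prob (agree (insert x V) ?q \<union> agree (insert x V) p)"
    proof (rule finite_measure_Union[symmetric])
      show "agree (insert x V) ?q \<inter> agree (insert x V) p = {}"
        using a by (auto simp: agree_def)
    qed (use V in auto)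
    moreover have "agree (insert x V) ?q \<union> agree (insert x V) p \<subseteq> agree V p"
      using V by (auto simp: agree_def)
    then have "prob (agree (insert x V) ?q \<union> agree (insert x V) p) \<le> prob (agree V p)"
      by (rule finite_measure_mono) (use V in simp)
    ultimately show ?thesis by (simp add: algebra_simps)
  qed
  have pos: "0 < prob (agree V p)" if "finite V" for V p
    using that
  proof (induction V)
    case empty
    show ?case using prob_space by simp
  next
    case (insert x V)
    then have "0 < \<delta> * prob (agree V p)" using \<open>0 < \<delta>\<close> by simp
    then show ?case using lower[OF insert.hyps, of p] by linarith
  qed
  have fact: "\<bar>ln (prob (agree (cube n \<union> V) p)) - ln (prob (agree (cube n) p)) - ln (prob (agree V p))\<bar> \<le> c n"
    if "finite V" "V \<inter> cube n = {}" for n V p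
    unfolding agree_Un c_def
    by (rule gibbs_factorization[OF gibbs])
      (use that pos in \<open>auto intro!: agree_in_sigma_field_on\<close>)
  have lim: "(\<lambda>n. c n / real (n + 1) ^ CARD('d)) \<longlonglongrightarrow> 0"
  proof (rule LIMSEQ_I)
    fix r :: real
    assume "0 < r"
    \<comment> \<open>Tail and shell each get r/16, because \<open>c\<close> carries a factor
      8.\<close>
    then obtain R where "\<bar>tail_norm U R\<bar> < r / 16"
      using LIMSEQ_D[OF tail_norm_tendsto_0[OF inter], of "r / 16"] by auto
    then have R: "tail_norm U R < r / 16" by simp
    have "(\<lambda>n. (1 - (1 - real (2 * R) / real (n + 1)) ^ CARD('d)) * total_norm U) \<longlonglongrightarrow>
        (1 - (1 - 0) ^ CARD('d)) * total_norm U"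
      by (intro tendsto_intros tendsto_divide_0[OF tendsto_const] filterlim_at_top_imp_at_infinity
          filterlim_compose[OF filterlim_real_sequentially] filterlim_add_const_nat_at_top)
    then have "\<forall>\<^sub>F n in sequentially.
        (1 - (1 - real (2 * R) / real (n + 1)) ^ CARD('d)) * total_norm U < r / 16"
      by (rule order_tendstoD) (use \<open>0 < r\<close> in auto)
    then obtain N where N: "\<And>n. N \<le> n \<Longrightarrow>
        (1 - (1 - real (2 * R) / real (n + 1)) ^ CARD('d)) * total_norm U < r / 16"
      by (auto simp: eventually_sequentially)
    show "\<exists>N. \<forall>n\<ge>N. norm (c n / real (n + 1) ^ CARD('d) - 0) < r"
    proof (intro exI allI impI)
      fix n
      assume n: "max N (2 * R) \<le> n"
      let ?m = "real (n + 1) ^ CARD('d)"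
      have m: "0 < ?m" by simp
      have "real (n + 1 - 2 * R) = real (n + 1) * (1 - real (2 * R) / real (n + 1))"
        using n by (simp add: of_nat_diff field_simps)
      then have e: "real (n + 1 - 2 * R) ^ CARD('d) = ?m * (1 - real (2 * R) / real (n + 1)) ^ CARD('d)"
        by (simp only: power_mult_distrib)
      have "crossing_norm U (cube n) \<le> ?m * tail_norm U R +
          ?m * ((1 - (1 - real (2 * R) / real (n + 1)) ^ CARD('d)) * total_norm U)"
        using crossing_norm_cube_le[OF inter, of R n] n unfolding e by (simp add: algebra_simps)
      also have "\<dots> < ?m * (r / 16) + ?m * (r / 16)"
        using N[of n] n R by (intro add_strict_mono mult_strict_left_mono m) auto
      finally have "8 * crossing_norm U (cube n) < 8 * (?m * (r / 16) + ?m * (r / 16))"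
        by (simp only: mult_less_cancel_left_pos zero_less_numeral)
      also have "\<dots> = ?m * r" by simp
      finally have "c n < ?m * r" by (simp only: c_def)
      then have "c n / ?m < r"
        using m by (simp only: pos_divide_less_eq mult.commute)
      moreover have "0 \<le> c n / ?m"
        using crossing_norm_nonneg[OF inter, of "cube n"] by (simp add: c_def)
      ultimately show "norm (c n / real (n + 1) ^ CARD('d) - 0) < r"
        by simp
    qed
  qed
  have "mixing_gibbs_field P \<delta> C1 C2 c"
    by unfold_locales (use dim \<open>\<delta> \<le> 1 / 2\<close> \<open>0 < \<delta>\<close> lower upper fact lim C in auto)
  then show ?thesis by (rule that)
qed

context mixing_gibbs_field
begin

lemma prob_agree_Un_ge:
  assumes "finite V" "finite W" "W \<inter> V = {}"
  shows "\<delta> ^ card W * prob (agree V p) \<le> prob (agree (V \<union> W) p)"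
  using assms(2,3)
proof (induction W)
  case (insert x W)
  have "\<delta> ^ card (insert x W) * prob (agree V p) = \<delta> * (\<delta> ^ card W * prob (agree V p))"
    using insert by simp
  also have "\<dots> \<le> \<delta> * prob (agree (V \<union> W) p)"
    using insert \<delta> by (intro mult_left_mono) auto
  also have "\<dots> \<le> prob (agree (insert x (V \<union> W)) p)"
    by (rule energy_lower) (use insert assms in auto)
  finally show ?case by simp
qed simp

lemma prob_agree_Un_le:
  assumes "finite V" "finite W" "W \<inter> V = {}"
  shows "prob (agree (V \<union> W) p) \<le> (1 - \<delta>) ^ card W * prob (agree V p)"
  using assms(2,3)
proof (induction W)
  case (insert x W)
  have "prob (agree (insert x (V \<union> W)) p) \<le> (1 - \<delta>) * prob (agree (V \<union> W) p)"
    by (rule energy_upper) (use insert assms in auto)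
  also have "\<dots> \<le> (1 - \<delta>) * ((1 - \<delta>) ^ card W * prob (agree V p))"
    using insert \<delta> by (intro mult_left_mono) auto
  finally show ?case using insert by simp
qed simp

lemma prob_agree_ge: "finite V \<Longrightarrow> \<delta> ^ card V \<le> prob (agree V p)"
  using prob_agree_Un_ge[of "{}" V p] prob_space by simp

lemma prob_agree_le: "finite V \<Longrightarrow> prob (agree V p) \<le> (1 - \<delta>) ^ card V"
  using prob_agree_Un_le[of "{}" V p] prob_space by simp

lemma prob_agree_pos [simp]: "finite V \<Longrightarrow> 0 < prob (agree V p)"
  using prob_agree_ge[of V p] \<delta> zero_less_power[of \<delta> "card V"] by linarith

lemma prob_agree_neq_0 [simp]: "finite V \<Longrightarrow> prob (agree V p) \<noteq> 0"
  using prob_agree_pos[of V p] by linarith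

lemma ln_prob_agree_Un:
  assumes "finite V" "finite W" "W \<inter> V = {}"
  shows "\<bar>ln (prob (agree (V \<union> W) p)) - ln (prob (agree V p))\<bar> \<le> real (card W) * - ln \<delta>"
proof -
  have "ln (\<delta> ^ card W * prob (agree V p)) \<le> ln (prob (agree (V \<union> W) p))"
    using prob_agree_Un_ge[OF assms, of p] prob_agree_pos[of V p] assms \<delta>
    by (intro ln_mono mult_pos_pos) auto
  moreover have "ln (prob (agree (V \<union> W) p)) \<le> ln (prob (agree V p))"
    by (intro ln_mono finite_measure_mono agree_antimono) (use assms in auto)
  moreover have "ln (\<delta> ^ card W * prob (agree V p)) = real (card W) * ln \<delta> + ln (prob (agree V p))"
    using assms \<delta> by (simp add: ln_mult ln_realpow)
  ultimately show ?thesis by simp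
qed

text \<open>The error is relative in \<open>E2\<close> and absolute in \<open>E1\<close>, and only
  the size of \<open>A1\<close> enters; the applications choose the roles of the two events
  accordingly. In this multiplied form the case \<open>prob E2 = 0\<close> is included.\<close>

lemma mixing_ineq:
  assumes A: "finite A1" "A1 \<noteq> {}" "finite A2" "A2 \<noteq> {}"
    and far: "\<And>x y. x \<in> A1 \<Longrightarrow> y \<in> A2 \<Longrightarrow> m \<le> real_of_int (l1_norm (x - y))" and m: "0 < m"
    and dep: "depends_on A1 E1" "depends_on A2 E2"
  shows "\<bar>prob (E1 \<inter> E2) - prob E1 * prob E2\<bar> \<le> real (card A1) * (C1 * exp (- C2 * m)) * prob E2"
proof (cases "prob E2 = 0")
  case True
  have ev: "E1 \<in> events" "E2 \<in> events" using A dep by (auto intro: depends_on_events)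
  have "prob (E1 \<inter> E2) \<le> prob E2"
    by (rule finite_measure_mono) (use ev in auto)
  with True show ?thesis by (simp add: measure_le_0_iff)
next
  case False
  then have pos: "0 < prob E2" by (simp add: zero_less_measure_iff)
  have ev: "E1 \<in> events" "E2 \<in> events" using A dep by (auto intro: depends_on_events)
  let ?S = "{1 / real (card A1) *
        \<bar>\<P>(\<sigma> in P. \<sigma> \<in> E1 \<bar> \<sigma> \<in> E2) - prob E1\<bar> | A1 A2 E1 E2.
      finite A1 \<and> A1 \<noteq> {} \<and> finite A2 \<and> A2 \<noteq> {} \<and> m \<le> real_of_int (set_distance A1 A2) \<and>
      E1 \<in> sets (sigma_field_on A1) \<and> E2 \<in> sets (sigma_field_on A2) \<and> prob E2 > 0}"
  have cond: "\<P>(\<sigma> in P. \<sigma> \<in> F1 \<bar> \<sigma> \<in> F2) = prob (F1 \<inter> F2) / prob F2" for F1 F2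
    by (simp add: cond_prob_def Int_def)
  \<comment> \<open>\<open>Sup\<close> on the reals bounds its elements only for bounded sets; here
    the difference of probabilities and the factor 1 / card A1 are both at most 1.\<close>
  have bdd: "bdd_above ?S"
  proof (rule bdd_aboveI[of _ 1])
    fix z
    assume "z \<in> ?S"
    then obtain A1 A2 :: "(int ^ 'd) set" and E1 E2 :: "('d, 'a) config set" where
      z: "z = 1 / real (card A1) * \<bar>\<P>(\<sigma> in P. \<sigma> \<in> E1 \<bar> \<sigma> \<in> E2) - prob E1\<bar>" and *: "finite A1" "A1 \<noteq> {}" "E1 \<in> sets (sigma_field_on A1)" "E2 \<in> sets (sigma_field_on A2)"
      "0 < prob E2"
      by blast
    have "prob (E1 \<inter> E2) \<le> prob E2"
      by (rule finite_measure_mono) (use * sigma_field_on_subset in auto)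
    then have "prob (E1 \<inter> E2) / prob E2 \<le> 1" "0 \<le> prob (E1 \<inter> E2) / prob E2"
      using * by auto
    then have b: "\<bar>prob (E1 \<inter> E2) / prob E2 - prob E1\<bar> \<le> 1"
      using prob_le_1[of E1] measure_nonneg[of P E1] by linarith
    have "1 \<le> real (card A1)" using * by (simp add: Suc_le_eq card_gt_0_iff)
    then have "1 / real (card A1) \<le> 1" by simp
    then have "1 / real (card A1) * \<bar>prob (E1 \<inter> E2) / prob E2 - prob E1\<bar> \<le> 1 * 1"
      by (intro mult_mono b) auto
    then show "z \<le> 1"
      by (simp add: cond z)
  qed
  have "m \<le> real_of_int (set_distance A1 A2)"
  proof -
    let ?D = "{l1_norm (x - y) | x y. x \<in> A1 \<and> y \<in> A2}"
    have "?D = (\<lambda>(x, y). l1_norm (x - y)) ` (A1 \<times> A2)" by auto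
    then have "finite ?D" "?D \<noteq> {}" using A by auto
    then have "Min ?D \<in> ?D" by (rule Min_in)
    with far show ?thesis unfolding set_distance_def by auto
  qed
  then have "1 / real (card A1) * \<bar>\<P>(\<sigma> in P. \<sigma> \<in> E1 \<bar> \<sigma> \<in> E2) - prob E1\<bar> \<in> ?S"
    using A pos depends_on_in_sigma_field_on[OF A(1) dep(1)] depends_on_in_sigma_field_on[OF A(3) dep(2)]
    by blast
  then have "1 / real (card A1) * \<bar>\<P>(\<sigma> in P. \<sigma> \<in> E1 \<bar> \<sigma> \<in> E2) - prob E1\<bar> \<le> phi_mixing_coeff P m"
    unfolding phi_mixing_coeff_def by (rule cSup_upper[OF _ bdd])
  also have "\<dots> \<le> C1 * exp (- C2 * m)" by (rule phi_le[OF m])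
  finally have "1 / real (card A1) * \<bar>prob (E1 \<inter> E2) / prob E2 - prob E1\<bar> \<le> C1 * exp (- C2 * m)"
    by (simp add: cond)
  moreover have "0 < real (card A1)" using A by (simp add: card_gt_0_iff)
  ultimately have "\<bar>prob (E1 \<inter> E2) / prob E2 - prob E1\<bar> \<le> real (card A1) * (C1 * exp (- C2 * m))"
    by (simp add: field_simps)
  then have "\<bar>prob (E1 \<inter> E2) / prob E2 - prob E1\<bar> * prob E2 \<le> real (card A1) * (C1 * exp (- C2 * m)) * prob E2"
    using pos by (intro mult_right_mono) auto
  moreover have "\<bar>prob (E1 \<inter> E2) / prob E2 - prob E1\<bar> * prob E2 = \<bar>prob (E1 \<inter> E2) - prob E1 * prob E2\<bar>"
  proof -
    have "\<bar>prob (E1 \<inter> E2) / prob E2 - prob E1\<bar> * prob E2 = \<bar>(prob (E1 \<inter> E2) / prob E2 - prob E1) * prob E2\<bar>"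
      by (simp add: abs_mult)
    also have "(prob (E1 \<inter> E2) / prob E2 - prob E1) * prob E2 = prob (E1 \<inter> E2) - prob E1 * prob E2"
      using pos by (simp add: left_diff_distrib)
    finally show ?thesis .
  qed
  ultimately show ?thesis by simp
qed

end

subsection \<open>Pairs of occurrences of a pattern\<close>

text \<open>With s the root of \<rho> of order m + 1, the sequence n^(m+1) \<rho>^n is the power of
  order m + 1 of n s^n, which tends to 0. Using m + 1 in place of m keeps the root meaningful for m
  = 0.\<close>

lemma power_mult_geometric_tendsto_0:
  fixes \<rho> :: real
  assumes "0 \<le> \<rho>" "\<rho> < 1"
  shows "(\<lambda>n. real n ^ m * \<rho> ^ n) \<longlonglongrightarrow> 0"
proof -
  define s where "s = root (Suc m) \<rho>"
  have s: "0 \<le> s" "s < 1" "s ^ Suc m = \<rho>"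
    unfolding s_def using assms real_root_pow_pos2[of "Suc m" \<rho>] by (simp_all add: real_root_lt_1_iff del: power_Suc)
  have "(\<lambda>n. real n * s ^ n) \<longlonglongrightarrow> 0"
    using s by (intro powser_times_n_limit_0) auto
  then have "(\<lambda>n. (real n * s ^ n) ^ Suc m) \<longlonglongrightarrow> 0 ^ Suc m"
    by (rule tendsto_power)
  moreover have "(real n * s ^ n) ^ Suc m = real n ^ Suc m * \<rho> ^ n" for n
    unfolding s(3)[symmetric] power_mult_distrib
    by (simp only: power_mult[symmetric] mult.commute)
  ultimately have lim: "(\<lambda>n. real n ^ Suc m * \<rho> ^ n) \<longlonglongrightarrow> 0"
    by (simp only: power_0_Suc)
  show ?thesis
  proof (rule Lim_null_comparison[OF _ lim], rule eventually_sequentiallyI[of 1])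
    fix n :: nat
    assume "1 \<le> n"
    then have "real n ^ m * \<rho> ^ n \<le> real n ^ Suc m * \<rho> ^ n"
      using assms by (intro mult_right_mono power_increasing) auto
    then show "norm (real n ^ m * \<rho> ^ n) \<le> real n ^ Suc m * \<rho> ^ n"
      using assms by (simp add: abs_mult)
  qed
qed

lemma summable_power_mult_geometric:
  fixes \<rho> :: real
  assumes "0 \<le> \<rho>" "\<rho> < 1"
  shows "summable (\<lambda>n. real n ^ m * \<rho> ^ n)"
proof (rule summable_comparison_test_ev)
  show "summable (\<lambda>n. inverse (real n ^ 2))"
    by (rule inverse_power_summable) simp
  have "\<forall>\<^sub>F n in sequentially. real n ^ (m + 2) * \<rho> ^ n < 1"
    using order_tendstoD(2)[OF power_mult_geometric_tendsto_0[OF assms, of "m + 2"], of 1] by simp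
  then show "\<forall>\<^sub>F n in sequentially. norm (real n ^ m * \<rho> ^ n) \<le> inverse (real n ^ 2)"
    using eventually_gt_at_top[of 0]
    by eventually_elim (use assms in \<open>simp add: field_simps power_add power2_eq_square abs_mult\<close>)
qed

context mixing_gibbs_field
begin

definition hit :: "nat \<Rightarrow> ('d, 'a) config \<Rightarrow> int ^ 'd \<Rightarrow> ('d, 'a) config set" where
  "hit n p x = shift x -` agree (cube n) p"

lemma hit_events [simp]: "hit n p x \<in> events"
  unfolding hit_def by (intro shift_events) simp

lemma prob_hit: "prob (hit n p x) = prob (agree (cube n) p)"
  unfolding hit_def by (rule prob_shift) simp

lemma depends_on_hit: "depends_on ((+) x ` cube n) (hit n p x)"
  unfolding hit_def by (intro depends_on_vimage_shift depends_on_agree)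

text \<open>With stationarity, a pair of occurrences has the probability of a repetition at the
  difference of the two positions.\<close>

lemma hit_Int_hit: "hit n p x \<inter> hit n p y = shift x -` (agree (cube n) p \<inter> hit n p (y - x))"
  by (auto simp: hit_def shift_shift)

text \<open>Let \<open>x\<close> be nonzero in direction i. The face of the cube on the side towards
  which \<open>x\<close> moves leaves the cube entirely, and along a second direction j this face
  contains a line of n + 1 sites.\<close>

lemma card_translate_cube_diff:
  fixes x :: "int ^ 'd"
  assumes "x \<noteq> 0"
  shows "n + 1 \<le> card ((+) x ` cube n - cube n)"
proof -
  obtain i where i: "x $ i \<noteq> 0" using assms by (auto simp: vec_eq_iff)
  obtain j where j: "j \<noteq> i"
    using dim by (metis (full_types) UNIV_I card_2_iff' card_le_Suc0_iff_eq finite not_less_eq_eq numeral_2_eq_2)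
  \<comment> \<open>Points of that line: coordinate j runs, and coordinate i sits at n or at 0
    according to the sign of \<open>x $ i\<close>, so that adding \<open>x\<close> pushes it out of
    the cube.\<close>
  let ?v = "\<lambda>t. (\<chi> l. if l = j then int t else if l = i \<and> 0 < x $ i then int n else 0) :: int ^ 'd"
  have "inj_on (\<lambda>t. x + ?v t) {..n}"
  proof (rule inj_onI)
    fix s t
    assume "x + ?v s = x + ?v t"
    then have "?v s $ j = ?v t $ j" by simp
    then show "s = t" by simp
  qed
  then have "card ((\<lambda>t. x + ?v t) ` {..n}) = n + 1"
    by (simp add: card_image)
  moreover have sub: "(\<lambda>t. x + ?v t) ` {..n} \<subseteq> (+) x ` cube n - cube n"
  proof (rule image_subsetI)
    fix t
    assume "t \<in> {..n}"
    then have "?v t \<in> cube n" by (auto simp: cube_def)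
    moreover have "x + ?v t \<notin> cube n"
    proof
      assume "x + ?v t \<in> cube n"
      then have "0 \<le> (x + ?v t) $ i \<and> (x + ?v t) $ i \<le> int n"
        unfolding cube_def by blast
      then show False using i j by (auto split: if_splits)
    qed
    ultimately show "x + ?v t \<in> (+) x ` cube n - cube n" by blast
  qed
  moreover have "card ((\<lambda>t. x + ?v t) ` {..n}) \<le> card ((+) x ` cube n - cube n)"
    by (rule card_mono[OF _ sub]) simp
  ultimately show ?thesis by linarith
qed

text \<open>A repetition at \<open>x\<close> prescribes the values on the part of the translated cube outside
  the original one, which has at least \<open>n + 1\<close> sites because the dimension is at least two.\<close>

lemma prob_hit_near:
  assumes "x \<noteq> 0"
  shows "prob (agree (cube n) p \<inter> hit n p x) \<le> (1 - \<delta>) ^ (n + 1) * prob (agree (cube n) p)"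
proof -
  let ?W = "(+) x ` cube n - cube n"
  \<comment> \<open>\<open>?q\<close> is the pattern forced on the union. Compatibility of
    \<open>p\<close> with its translate on the overlap is discarded, so only an inclusion is
    claimed.\<close>
  let ?q = "\<lambda>y. if y \<in> cube n then p y else p (y - x)"
  have "agree (cube n) p \<inter> hit n p x \<subseteq> agree (cube n \<union> ?W) ?q"
    by (auto simp: agree_def hit_def shift_def)
  then have "prob (agree (cube n) p \<inter> hit n p x) \<le> prob (agree (cube n \<union> ?W) ?q)"
    by (rule finite_measure_mono) simp
  also have "\<dots> \<le> (1 - \<delta>) ^ card ?W * prob (agree (cube n) ?q)"
    by (rule prob_agree_Un_le) auto
  also have "agree (cube n) ?q = agree (cube n) p"
    by (rule agree_cong) simp
  also have "(1 - \<delta>) ^ card ?W \<le> (1 - \<delta>) ^ (n + 1)"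
    using \<delta> card_translate_cube_diff[OF assms] by (intro power_decreasing) auto
  finally show ?thesis by (simp add: mult_right_mono)
qed

text \<open>Chosen so that, with N = (n+1)^d, the decay exp(-C2 gap) is at most exp(-N (C1 + 1 - ln
  \<delta>)): the C1 absorbs the prefactor N C1, the -ln \<delta> reaches the minimal pattern
  probability \<delta>^N, and the 1 leaves a spare exp(-N).\<close>

definition gap_factor :: nat where
  "gap_factor = nat \<lceil>(C1 + 1 - ln \<delta>) / C2\<rceil>"

definition gap :: "nat \<Rightarrow> nat" where
  "gap n = gap_factor * (n + 1) ^ CARD('d)"

lemma gap_factor: "C1 + 1 - ln \<delta> \<le> C2 * real gap_factor" "0 < gap_factor"
proof -
  have *: "0 < (C1 + 1 - ln \<delta>) / C2"
    using C1 C2 \<delta> ln_less_zero[of \<delta>] by (intro divide_pos_pos) linarith+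
  then show "0 < gap_factor" by (simp add: gap_factor_def)
  have "(C1 + 1 - ln \<delta>) / C2 \<le> real gap_factor"
    unfolding gap_factor_def using * by linarith
  then show "C1 + 1 - ln \<delta> \<le> C2 * real gap_factor"
    using C2 by (simp add: field_simps)
qed

lemma gap_pos: "0 < gap n"
  using gap_factor by (simp add: gap_def)

text \<open>The prefactor is absorbed crudely by N C1 \<le> exp(N C1). The spare exp(-N) pays later
  for the number of positions in a slab, which multiplies the mixing error and is at most of order
  ln n divided by the pattern probability.\<close>

lemma gap_bound:
  fixes n defines "N \<equiv> (n + 1) ^ CARD('d)"
  shows "real N * (C1 * exp (- C2 * real (gap n))) \<le> exp (- real N) * \<delta> ^ N"
proof -
  have "real N * C1 \<le> exp (real N * C1)"
    using exp_ge_add_one_self[of "real N * C1"] by linarith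
  then have "real N * (C1 * exp (- C2 * real (gap n))) \<le> exp (real N * C1) * exp (- C2 * real (gap n))"
    by simp
  also have "\<dots> = exp (real N * (C1 - C2 * real gap_factor))"
    by (simp add: gap_def N_def algebra_simps flip: exp_add)
  also have "\<dots> \<le> exp (real N * (- 1 + ln \<delta>))"
    using gap_factor by (intro iffD2[OF exp_le_cancel_iff] mult_left_mono) auto
  also have "\<dots> = exp (- real N) * \<delta> ^ N"
    using \<delta> exp_of_nat_mult[of N "ln \<delta>"] by (simp only: distrib_left exp_add) simp
  finally show ?thesis .
qed

lemma gap_bound': 
  "real ((n + 1) ^ CARD('d)) * (C1 * exp (- C2 * real (gap n)))
    \<le> exp (- real ((n + 1) ^ CARD('d))) * prob (agree (cube n) p)"
proof -
  have "\<delta> ^ ((n + 1) ^ CARD('d)) \<le> prob (agree (cube n) p)"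
    using prob_agree_ge[of "cube n" p] by (simp add: card_cube)
  then show ?thesis
    using gap_bound[of n] by (meson exp_ge_zero mult_left_mono order_trans)
qed

text \<open>A displacement by \<open>reach n\<close> in one coordinate leaves a distance of at least
  \<open>gap n\<close> between the two cubes, since a cube has extent n.\<close>

definition reach :: "nat \<Rightarrow> nat" where
  "reach n = n + gap n"

lemma prob_hit_far:
  assumes "int (reach n) \<le> \<bar>x $ i\<bar>"
  shows "prob (agree (cube n) p \<inter> hit n p x) \<le> 2 * prob (agree (cube n) p) ^ 2"
proof -
  let ?C = "cube n :: (int ^ 'd) set"
  have "\<bar>prob (agree ?C p \<inter> hit n p x) - prob (agree ?C p) * prob (hit n p x)\<bar>
      \<le> real (card ?C) * (C1 * exp (- C2 * real (gap n))) * prob (hit n p x)"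
  proof (rule mixing_ineq[where ?A2.0 = "(+) x ` ?C"])
    fix u v
    assume "u \<in> ?C" "v \<in> (+) x ` ?C"
    then obtain w where w: "v = x + w" "w \<in> ?C" by blast
    have "0 \<le> u $ i" "u $ i \<le> int n" "0 \<le> w $ i" "w $ i \<le> int n"
      using w \<open>u \<in> ?C\<close> by (auto simp: cube_def)
    then have "int (gap n) \<le> \<bar>(u - v) $ i\<bar>"
      using assms w by (simp add: reach_def)
    also have "\<dots> \<le> l1_norm (u - v)" by (rule abs_nth_le_l1_norm)
    finally show "real (gap n) \<le> real_of_int (l1_norm (u - v))" by linarith
  qed (use gap_pos in \<open>auto intro: depends_on_agree depends_on_hit\<close>)
  also have "\<dots> \<le> exp (- real ((n + 1) ^ CARD('d))) * prob (agree ?C p) * prob (agree ?C p)"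
    unfolding card_cube prob_hit by (intro mult_right_mono gap_bound') auto
  also have "\<dots> \<le> 1 * prob (agree ?C p) * prob (agree ?C p)"
    by (intro mult_right_mono) auto
  finally show ?thesis
    unfolding prob_hit by (simp add: power2_eq_square)
qed

text \<open>Number of positions in the box of radius \<open>reach n\<close> times the cost of n + 1
  forced spins: polynomial against geometric, hence summable.\<close>

definition near_bound :: "nat \<Rightarrow> real" where
  "near_bound n = real (2 * reach n + 1) ^ CARD('d) * (1 - \<delta>) ^ (n + 1)"

text \<open>Displacements inside the box of radius \<open>reach n\<close> cost n + 1 forced spins,
  those outside behave almost independently. The same bound serves as the first moment for early
  repetitions and as the pair sum in the second moment for late ones.\<close>

lemma sum_prob_hit_le:
  assumes "finite X" "0 \<notin> X"
  shows "(\<Sum>x\<in>X. prob (agree (cube n) p \<inter> hit n p x)) \<le>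
    (near_bound n + 2 * real (card X) * prob (agree (cube n) p)) * prob (agree (cube n) p)"
proof -
  let ?P = "prob (agree (cube n) p)"
  let ?B = "box_vec (\<lambda>_. {- int (reach n)..int (reach n)}) :: (int ^ 'd) set"
  let ?b = "\<lambda>x. prob (agree (cube n) p \<inter> hit n p x)"
  have finB: "finite ?B" by auto
  have cardB: "real (card ?B) = real (2 * reach n + 1) ^ CARD('d)"
    by (simp add: card_box_vec nat_add_distrib algebra_simps)
  have "(\<Sum>x\<in>X. ?b x) = (\<Sum>x\<in>X \<inter> ?B. ?b x) + (\<Sum>x\<in>X - ?B. ?b x)"
    using sum.Int_Diff[OF assms(1), of ?b ?B] by simp
  also have "(\<Sum>x\<in>X \<inter> ?B. ?b x) \<le> real (card (X \<inter> ?B)) * ((1 - \<delta>) ^ (n + 1) * ?P)"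
    by (rule sum_bounded_above, rule prob_hit_near) (use assms in auto)
  also have "\<dots> \<le> real (card ?B) * ((1 - \<delta>) ^ (n + 1) * ?P)"
    using finB \<delta> by (intro mult_right_mono of_nat_mono card_mono) auto
  also have "(\<Sum>x\<in>X - ?B. ?b x) \<le> real (card (X - ?B)) * (2 * ?P ^ 2)"
  proof (rule sum_bounded_above)
    fix x
    assume "x \<in> X - ?B"
    then obtain i where "\<not> (- int (reach n) \<le> x $ i \<and> x $ i \<le> int (reach n))"
      by (auto simp: box_vec_def)
    then have "int (reach n) \<le> \<bar>x $ i\<bar>" by linarith
    then show "?b x \<le> 2 * ?P ^ 2" by (rule prob_hit_far)
  qed
  also have "\<dots> \<le> real (card X) * (2 * ?P ^ 2)"
    using assms by (intro mult_right_mono of_nat_mono card_mono) auto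
  finally show ?thesis
    unfolding cardB near_bound_def by (simp add: algebra_simps power2_eq_square)
qed

lemma reach_le: "real (2 * reach n + 1) \<le> real (2 * gap_factor + 2) * real (n + 1) ^ CARD('d)"
proof -
  have "real (n + 1) \<le> real (n + 1) ^ CARD('d)"
    using dim by (intro self_le_power) auto
  then have "real (2 * n + 1) \<le> 2 * real (n + 1) ^ CARD('d)"
    by simp
  then show ?thesis
    by (simp add: reach_def gap_def algebra_simps)
qed

lemma summable_near_bound: "summable near_bound"
proof -
  let ?D = "CARD('d)"
  have "summable (\<lambda>n. real n ^ (?D * ?D) * (1 - \<delta>) ^ n)"
    using \<delta> by (intro summable_power_mult_geometric) auto
  then have "summable (\<lambda>n. real (n + 1) ^ (?D * ?D) * (1 - \<delta>) ^ (n + 1))"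
    by (rule iffD2[OF summable_iff_shift])
  then have s: "summable (\<lambda>n. real (2 * gap_factor + 2) ^ ?D * (real (n + 1) ^ (?D * ?D) * (1 - \<delta>) ^ (n + 1)))"
    by (rule summable_mult)
  show ?thesis
  proof (rule summable_comparison_test[OF _ s], intro exI allI impI)
    fix n
    have "real (2 * reach n + 1) ^ ?D \<le> (real (2 * gap_factor + 2) * real (n + 1) ^ ?D) ^ ?D"
      by (intro power_mono reach_le) auto
    then have "near_bound n \<le> (real (2 * gap_factor + 2) * real (n + 1) ^ ?D) ^ ?D * (1 - \<delta>) ^ (n + 1)"
      unfolding near_bound_def using \<delta> by (intro mult_right_mono) auto
    moreover have "0 \<le> near_bound n" unfolding near_bound_def using \<delta> by simp
    ultimately show "norm (near_bound n) \<le>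
        real (2 * gap_factor + 2) ^ ?D * (real (n + 1) ^ (?D * ?D) * (1 - \<delta>) ^ (n + 1))"
      by (simp only: real_norm_def abs_of_nonneg power_mult_distrib power_mult mult.assoc)
  qed
qed

text \<open>Lets the searched region depend on the pattern: a conditional bound uniform in
  \<open>p\<close> is averaged over all patterns.\<close>

lemma prob_le_by_pattern:
  assumes "finite V" "E \<in> events" "\<And>p. p \<in> V \<rightarrow>\<^sub>E UNIV \<Longrightarrow> prob (agree V p \<inter> E) \<le> b * prob (agree V p)"
  shows "prob E \<le> b"
proof -
  have "prob E = (\<Sum>p\<in>V \<rightarrow>\<^sub>E UNIV. prob (agree V p \<inter> E))"
    by (rule sum_prob_agree[symmetric]) (use assms in auto)
  also have "\<dots> \<le> (\<Sum>p\<in>V \<rightarrow>\<^sub>E UNIV. b * prob (agree V p))"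
    by (intro sum_mono assms)
  also have "\<dots> = b"
    using sum_prob_agree_1[OF assms(1)] by (simp flip: sum_distrib_left)
  finally show ?thesis .
qed

end

subsection \<open>Early repetitions\<close>

text \<open>The three parts say that the integer part of the root is the largest natural number
  whose power of order d is at most y; regions of prescribed volume are built from it.\<close>

lemma nat_floor_root:
  fixes y :: real
  assumes "0 < d" "0 \<le> y"
  shows "real (nat \<lfloor>root d y\<rfloor>) ^ d \<le> y" "y < real (nat \<lfloor>root d y\<rfloor> + 1) ^ d"
    "real k ^ d \<le> y \<Longrightarrow> k \<le> nat \<lfloor>root d y\<rfloor>"
proof -
  have r: "0 \<le> root d y" "root d y ^ d = y"
    using assms by (auto simp: real_root_pow_pos2)
  have "real (nat \<lfloor>root d y\<rfloor>) ^ d \<le> root d y ^ d"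
    by (rule power_mono) (use r in auto)
  then show "real (nat \<lfloor>root d y\<rfloor>) ^ d \<le> y" using r by simp
  have "root d y ^ d < real (nat \<lfloor>root d y\<rfloor> + 1) ^ d"
    by (rule power_strict_mono) (use r assms in linarith)+
  then show "y < real (nat \<lfloor>root d y\<rfloor> + 1) ^ d" using r by simp
  assume "real k ^ d \<le> y"
  then have "real k \<le> root d y"
    using assms real_root_le_mono[of d "real k ^ d" y] by (simp add: real_root_power_cancel)
  then show "k \<le> nat \<lfloor>root d y\<rfloor>" by linarith
qed

text \<open>Second moment method: \<open>1\<close> minus the square of \<open>1 - a N\<close>, with \<open>N\<close> the number of events
  that occur, is at most the indicator of \<open>N > 0\<close>.\<close>

lemma (in prob_space) prob_UN_ge_quarter:
  assumes X: "finite X" and B: "\<And>x. x \<in> X \<Longrightarrow> B x \<in> events"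
    and q: "\<And>x. x \<in> X \<Longrightarrow> prob (B x) = q"
    and pairs: "\<And>x. x \<in> X \<Longrightarrow> (\<Sum>y\<in>X. prob (B x \<inter> B y)) \<le> (2 + 2 * (real (card X) * q)) * q"
    and large: "1 \<le> real (card X) * q"
  shows "1 / 4 \<le> prob (\<Union>x\<in>X. B x)"
proof -
  define t where "t = real (card X) * q"
  \<comment> \<open>This value maximises 2at - a^2 (2 + 2t) t, the lower bound obtained below. The
    maximum t / (2 + 2t) is at least 1/4 once t \<ge> 1.\<close>
  define a where "a = 1 / (2 + 2 * t)"
  have t: "1 \<le> t" using large by (simp add: t_def)
  have a: "0 < a" "a * (2 + 2 * t) = 1" using t by (auto simp: a_def)
  define N where "N = (\<lambda>\<omega>. \<Sum>x\<in>X. indicator (B x) \<omega> :: real)"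
  let ?U = "\<Union>x\<in>X. B x"
  have U: "?U \<in> events" using X B by auto
  have int1: "integrable M (indicator (B x) :: _ \<Rightarrow> real)" if "x \<in> X" for x
    using B[OF that] by (simp add: emeasure_eq_measure)
  have intN: "integrable M N"
    unfolding N_def by (intro Bochner_Integration.integrable_sum int1)
  have EN: "expectation N = t"
    unfolding N_def using X q B by (subst Bochner_Integration.integral_sum) (auto simp: t_def int1)
  have sq: "N \<omega> ^ 2 = (\<Sum>x\<in>X. \<Sum>y\<in>X. indicator (B x \<inter> B y) \<omega>)" for \<omega>
    unfolding N_def power2_eq_square sum_product by (simp add: indicator_inter_arith)
  have int2: "integrable M (indicator (B x \<inter> B y) :: _ \<Rightarrow> real)" if "x \<in> X" "y \<in> X" for x y
    using B[OF that(1)] B[OF that(2)] by (simp add: emeasure_eq_measure)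
  have intN2: "integrable M (\<lambda>\<omega>. N \<omega> ^ 2)"
    unfolding sq by (intro Bochner_Integration.integrable_sum int2)
  have "expectation (\<lambda>\<omega>. N \<omega> ^ 2) = (\<Sum>x\<in>X. \<Sum>y\<in>X. prob (B x \<inter> B y))"
  proof -
    have "expectation (\<lambda>\<omega>. \<Sum>x\<in>X. \<Sum>y\<in>X. indicator (B x \<inter> B y) \<omega> :: real) =
        (\<Sum>x\<in>X. expectation (\<lambda>\<omega>. \<Sum>y\<in>X. indicator (B x \<inter> B y) \<omega>))"
      by (rule Bochner_Integration.integral_sum) (intro Bochner_Integration.integrable_sum int2)
    also have "\<dots> = (\<Sum>x\<in>X. \<Sum>y\<in>X. expectation (indicator (B x \<inter> B y)))"
      by (intro sum.cong refl Bochner_Integration.integral_sum int2)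
    also have "\<dots> = (\<Sum>x\<in>X. \<Sum>y\<in>X. prob (B x \<inter> B y))"
      by (intro sum.cong refl) (use B in simp)
    finally show ?thesis unfolding sq .
  qed
  also have "\<dots> \<le> real (card X) * ((2 + 2 * t) * q)"
    unfolding t_def by (rule sum_bounded_above) (rule pairs)
  also have "\<dots> = (2 + 2 * t) * t" by (simp add: t_def)
  finally have EN2: "expectation (\<lambda>\<omega>. N \<omega> ^ 2) \<le> (2 + 2 * t) * t" .
  have pw: "2 * a * N \<omega> - a ^ 2 * N \<omega> ^ 2 \<le> indicator ?U \<omega>" for \<omega>
  proof (cases "\<omega> \<in> ?U")
    case True
    have "2 * a * N \<omega> - a ^ 2 * N \<omega> ^ 2 = 1 - (1 - a * N \<omega>) ^ 2"
      by (simp add: power2_eq_square algebra_simps)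
    then show ?thesis using True by simp
  next
    case False
    then have "N \<omega> = 0" unfolding N_def by (intro sum.neutral) auto
    then show ?thesis by simp
  qed
  have "2 * a * t - a ^ 2 * ((2 + 2 * t) * t) \<le> 2 * a * t - a ^ 2 * expectation (\<lambda>\<omega>. N \<omega> ^ 2)"
    using EN2 by (intro diff_left_mono mult_left_mono) auto
  also have "\<dots> = expectation (\<lambda>\<omega>. 2 * a * N \<omega> - a ^ 2 * N \<omega> ^ 2)"
    using intN intN2 EN by simp
  also have "\<dots> \<le> expectation (indicator ?U)"
    by (rule integral_mono) (use intN intN2 U pw in \<open>auto simp: emeasure_eq_measure\<close>)
  also have "\<dots> = prob ?U" using U by simp
  finally have "2 * a * t - a ^ 2 * ((2 + 2 * t) * t) \<le> prob ?U" .
  moreover have "2 * a * t - a ^ 2 * ((2 + 2 * t) * t) = 2 * a * t - a * (a * (2 + 2 * t)) * t"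
    by (simp add: power2_eq_square algebra_simps)
  moreover have "\<dots> = a * t" using a by simp
  moreover have "1 / 4 \<le> a * t" using t by (simp add: a_def field_simps)
  ultimately show ?thesis by linarith
qed

context mixing_gibbs_field
begin

text \<open>Phrased with an arbitrary side k instead of \<open>first_repetition\<close>, so that the
  event does not involve a \<open>LEAST\<close> that might not be attained.\<close>

definition too_early :: "real \<Rightarrow> nat \<Rightarrow> ('d, 'a) config set" where
  "too_early \<epsilon> n = {\<sigma>. \<exists>x k. x \<noteq> 0 \<and> (\<forall>i. 0 \<le> x $ i \<and> x $ i \<le> int k) \<and>
     real k ^ CARD('d) * prob (agree (cube n) \<sigma>) < real n powr - \<epsilon> \<and>
     shift x \<sigma> \<in> agree (cube n) \<sigma>}"

lemma too_early:
  assumes "0 < n"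
  shows "too_early \<epsilon> n \<in> events"
    "prob (too_early \<epsilon> n) \<le> near_bound n + 2 * 2 ^ CARD('d) * real n powr - \<epsilon>"
proof -
  define t where "t = real n powr - \<epsilon>"
  have t: "0 < t" using assms by (simp add: t_def)
  let ?C = "cube n :: (int ^ 'd) set"
  define X where "X p = {x :: int ^ 'd. x \<noteq> 0 \<and>
    (\<exists>k. (\<forall>i. 0 \<le> x $ i \<and> x $ i \<le> int k) \<and> real k ^ CARD('d) * prob (agree ?C p) < t)}" for p
  \<comment> \<open>The weight \<open>prob (agree (cube n) \<sigma>)\<close> depends on
    \<open>\<sigma>\<close> only through its pattern, so on \<open>agree ?C p\<close> the positions
    to be excluded form the fixed set \<open>X p\<close>.\<close>
  have eq: "agree ?C p \<inter> too_early \<epsilon> n = agree ?C p \<inter> (\<Union>x\<in>X p. hit n p x)" for p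
  proof -
    have same: "agree ?C \<sigma> = agree ?C p" if "\<sigma> \<in> agree ?C p" for \<sigma>
      using that by (intro agree_cong) (simp add: agree_def)
    have "\<sigma> \<in> too_early \<epsilon> n \<longleftrightarrow> \<sigma> \<in> (\<Union>x\<in>X p. hit n p x)" if "\<sigma> \<in> agree ?C p" for \<sigma>
      unfolding too_early_def X_def hit_def t_def using same[OF that] by auto
    then show ?thesis by (intro set_eqI) (simp add: Int_iff del: UN_iff cong: conj_cong)
  qed
  have X: "finite (X p)" "real (card (X p)) * prob (agree ?C p) \<le> 2 ^ CARD('d) * t" for p
  proof -
    let ?P = "prob (agree ?C p)"
    define K where "K = nat \<lfloor>root CARD('d) (t / ?P)\<rfloor>"
    have P: "0 < ?P" by simp
    have K: "real K ^ CARD('d) \<le> t / ?P" "real k ^ CARD('d) \<le> t / ?P \<Longrightarrow> k \<le> K" for k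
      unfolding K_def using t P nat_floor_root[of "CARD('d)" "t / ?P"] by simp_all
    have sub: "X p \<subseteq> box_vec (\<lambda>_. {0..int K})"
    proof
      fix x
      assume "x \<in> X p"
      then obtain k where k: "\<forall>i. 0 \<le> x $ i \<and> x $ i \<le> int k" "real k ^ CARD('d) * ?P < t"
        unfolding X_def by blast
      then have "real k ^ CARD('d) \<le> t / ?P" using P by (simp add: field_simps)
      then have "k \<le> K" by (rule K(2))
      then have "0 \<le> x $ i \<and> x $ i \<le> int K" for i
        using k(1) by (meson of_nat_mono order_trans)
      then show "x \<in> box_vec (\<lambda>_. {0..int K})"
        by (simp add: box_vec_def)
    qed
    have fin: "finite (box_vec (\<lambda>_. {0..int K}) :: (int ^ 'd) set)" by auto
    show "finite (X p)" using finite_subset[OF sub fin] .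
    \<comment> \<open>Zero is not in \<open>X p\<close>, so if \<open>X p\<close> is nonempty some
      admissible k is at least 1. Then K \<ge> 1 and (K + 1)^d \<le> (2K)^d, which is where 2^d
      comes from.\<close>
    show "real (card (X p)) * ?P \<le> 2 ^ CARD('d) * t"
    proof (cases "X p = {}")
      case False
      then obtain x where "x \<in> X p" by auto
      then obtain k where xk: "x \<noteq> 0" "\<forall>i. 0 \<le> x $ i \<and> x $ i \<le> int k" "real k ^ CARD('d) * ?P < t"
        unfolding X_def by blast
      have "k \<noteq> 0"
      proof
        assume "k = 0"
        then have "x $ i = 0" for i using spec[OF xk(2), of i] by simp
        then have "x = 0" by (simp add: vec_eq_iff)
        with xk(1) show False by contradiction
      qed
      moreover have "k \<le> K" by (rule K(2)) (use xk(3) P in \<open>simp add: field_simps\<close>)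
      ultimately have "1 \<le> K" by simp
      have "card (X p) \<le> card (box_vec (\<lambda>_. {0..int K}) :: (int ^ 'd) set)"
        by (rule card_mono[OF fin sub])
      also have "\<dots> = (K + 1) ^ CARD('d)" by (simp add: card_box_vec nat_add_distrib)
      finally have "real (card (X p)) \<le> real (K + 1) ^ CARD('d)"
        by (metis of_nat_le_iff of_nat_power)
      also have "\<dots> \<le> (2 * real K) ^ CARD('d)"
        using \<open>1 \<le> K\<close> by (intro power_mono) auto
      also have "\<dots> \<le> 2 ^ CARD('d) * (t / ?P)"
        unfolding power_mult_distrib by (intro mult_left_mono K) auto
      finally show ?thesis using P by (simp add: field_simps)
    qed (use t in auto)
  qed
  have "too_early \<epsilon> n = (\<Union>p\<in>?C \<rightarrow>\<^sub>E UNIV. agree ?C p \<inter> too_early \<epsilon> n)"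
    by (simp add: UN_agree)
  also have "\<dots> \<in> events"
    unfolding eq by (intro sets.finite_UN sets.Int) (auto intro: X)
  finally show ev: "too_early \<epsilon> n \<in> events" .
  show "prob (too_early \<epsilon> n) \<le> near_bound n + 2 * 2 ^ CARD('d) * real n powr - \<epsilon>"
  proof (rule prob_le_by_pattern[OF finite_cube ev])
    fix p
    have "prob (agree ?C p \<inter> too_early \<epsilon> n) = prob (\<Union>x\<in>X p. agree ?C p \<inter> hit n p x)"
      unfolding eq by (simp only: Int_UN_distrib)
    also have "\<dots> \<le> (\<Sum>x\<in>X p. prob (agree ?C p \<inter> hit n p x))"
      by (rule finite_measure_subadditive_finite) (use X in auto)
    also have "\<dots> \<le> (near_bound n + 2 * real (card (X p)) * prob (agree ?C p)) * prob (agree ?C p)"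
      by (rule sum_prob_hit_le[OF X(1)]) (simp add: X_def)
    also have "\<dots> \<le> (near_bound n + 2 * 2 ^ CARD('d) * real n powr - \<epsilon>) * prob (agree ?C p)"
      using X(2)[of p] by (intro mult_right_mono add_left_mono) (auto simp: t_def)
    finally show "prob (agree ?C p \<inter> too_early \<epsilon> n)
      \<le> (near_bound n + 2 * 2 ^ CARD('d) * real n powr - \<epsilon>) * prob (agree ?C p)" .
  qed
qed

lemma AE_not_too_early:
  assumes "1 < \<epsilon>"
  shows "AE \<sigma> in P. \<forall>\<^sub>F n in sequentially. \<sigma> \<notin> too_early \<epsilon> n"
proof -
  \<comment> \<open>The index starts at 1, because the bound on \<open>too_early\<close> requires n
    > 0.\<close>
  have "AE \<sigma> in P. \<forall>\<^sub>F n in sequentially. \<sigma> \<in> space P - too_early \<epsilon> (Suc n)"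
  proof (rule borel_cantelli_AE1)
    have "summable (\<lambda>n. real n powr - \<epsilon>)"
      using assms by (simp add: summable_real_powr_iff)
    then have "summable (\<lambda>n. near_bound n + 2 * 2 ^ CARD('d) * real n powr - \<epsilon>)"
      by (intro summable_add summable_near_bound summable_mult)
    then have "summable (\<lambda>n. near_bound (Suc n) + 2 * 2 ^ CARD('d) * real (Suc n) powr - \<epsilon>)"
      by (rule iffD2[OF summable_Suc_iff])
    then show "summable (\<lambda>n. prob (too_early \<epsilon> (Suc n)))"
      by (rule summable_comparison_test[rotated])
        (use too_early(2)[of "Suc _" \<epsilon>] in auto)
  qed (use too_early in \<open>auto simp: emeasure_eq_measure\<close>)
  then show ?thesis
    by (simp add: eventually_sequentially_Suc[of "\<lambda>n. _ \<notin> too_early \<epsilon> n"])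
qed

subsection \<open>Late repetitions\<close>

definition slab :: "'d \<Rightarrow> nat \<Rightarrow> nat \<Rightarrow> nat \<Rightarrow> (int ^ 'd) set" where
  "slab i0 k a w = box_vec (\<lambda>i. if i = i0 then {int a..<int (a + w)} else {0..int k})"

lemma finite_slab [simp]: "finite (slab i0 k a w)"
  unfolding slab_def by (rule finite_box_vec) auto

lemma card_slab: "card (slab i0 k a w) = w * (k + 1) ^ (CARD('d) - 1)"
proof -
  have "card (slab i0 k a w) = (\<Prod>i\<in>UNIV. if i = i0 then w else k + 1)"
    unfolding slab_def card_box_vec by (intro prod.cong) (auto simp: nat_add_distrib)
  also have "\<dots> = w * (\<Prod>i\<in>UNIV - {i0}. if i = i0 then w else k + 1)"
    by (subst prod.remove[of _ i0]) auto
  also have "(\<Prod>i\<in>UNIV - {i0}. if i = i0 then w else k + 1) = (\<Prod>i\<in>UNIV - {i0}. k + 1)"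
    by (intro prod.cong) auto
  also have "\<dots> = (k + 1) ^ (CARD('d) - 1)"
    by (simp add: card_Diff_singleton)
  finally show ?thesis .
qed

definition miss :: "nat \<Rightarrow> ('d, 'a) config \<Rightarrow> (int ^ 'd) set \<Rightarrow> ('d, 'a) config set" where
  "miss n p S = - (\<Union>x\<in>S. hit n p x)"

lemma miss_events [simp]: "finite S \<Longrightarrow> miss n p S \<in> events"
  unfolding miss_def Compl_eq_Diff_UNIV space_P[symmetric]
  by (intro sets.compl_sets sets.finite_UN) auto

lemma depends_on_miss: "depends_on (\<Union>x\<in>S. (+) x ` cube n) (miss n p S)"
  unfolding depends_on_def
proof (intro allI impI)
  fix \<sigma> \<sigma>' :: "('d, 'a) config"
  assume *: "\<forall>y\<in>\<Union>x\<in>S. (+) x ` cube n. \<sigma> y = \<sigma>' y"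
  have "\<sigma> \<in> hit n p x \<longleftrightarrow> \<sigma>' \<in> hit n p x" if "x \<in> S" for x
  proof -
    have "\<forall>y\<in>(+) x ` cube n. \<sigma> y = \<sigma>' y" using * that by simp
    then show ?thesis using depends_on_hit[where x = x and n = n and p = p, unfolded depends_on_def] by simp
  qed
  then show "\<sigma> \<in> miss n p S \<longleftrightarrow> \<sigma>' \<in> miss n p S"
    by (auto simp: miss_def)
qed

text \<open>Pairs of positions are reduced to displacements from the origin. The diagonal and the
  near displacements each contribute at most the pattern probability, and together make the 2 in the
  pair condition of \<open>prob_UN_ge_quarter\<close>.\<close>

lemma prob_miss_le:
  assumes S: "finite S" and large: "1 \<le> real (card S) * prob (agree (cube n) p)"
    and near: "near_bound n \<le> 1"
  shows "prob (miss n p S) \<le> 3 / 4"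
proof -
  let ?P = "prob (agree (cube n) p)"
  have "1 / 4 \<le> prob (\<Union>x\<in>S. hit n p x)"
  proof (rule prob_UN_ge_quarter[OF S _ prob_hit _ large])
    fix x
    assume x: "x \<in> S"
    let ?X = "(\<lambda>y. y - x) ` (S - {x})"
    have "(\<Sum>y\<in>S. prob (hit n p x \<inter> hit n p y)) =
        ?P + (\<Sum>y\<in>S - {x}. prob (hit n p x \<inter> hit n p y))"
      using S x by (simp add: sum.remove[of _ x] prob_hit)
    also have "(\<Sum>y\<in>S - {x}. prob (hit n p x \<inter> hit n p y)) =
        (\<Sum>y\<in>S - {x}. prob (agree (cube n) p \<inter> hit n p (y - x)))"
      unfolding hit_Int_hit by (intro sum.cong refl prob_shift) auto
    also have "\<dots> = (\<Sum>z\<in>?X. prob (agree (cube n) p \<inter> hit n p z))"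
      by (subst sum.reindex) (auto simp: inj_on_def)
    also have "\<dots> \<le> (near_bound n + 2 * real (card ?X) * ?P) * ?P"
      by (rule sum_prob_hit_le) (use S in auto)
    also have "\<dots> \<le> (1 + 2 * real (card S) * ?P) * ?P"
    proof -
      have "card ?X \<le> card S"
        using S by (meson Diff_subset card_image_le card_mono finite_Diff le_trans)
      then show ?thesis
        using near by (intro mult_right_mono add_mono) auto
    qed
    finally show "(\<Sum>y\<in>S. prob (hit n p x \<inter> hit n p y)) \<le> (2 + 2 * (real (card S) * ?P)) * ?P"
      by (simp add: algebra_simps)
  qed simp
  moreover have "prob (miss n p S) = 1 - prob (\<Union>x\<in>S. hit n p x)"
    unfolding miss_def using S by (subst prob_compl[symmetric]) (auto simp: Compl_eq_Diff_UNIV)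
  ultimately show ?thesis by simp
qed

text \<open>The slabs are separated by \<open>reach n\<close> in the coordinate \<open>i0\<close>, so that a miss in one of them
  is almost independent of what happens near the previous ones.\<close>

lemma prob_miss_slabs:
  fixes w k n :: nat and i0 :: 'd
  defines "S \<equiv> \<lambda>j. slab i0 k (reach n + j * (w + reach n)) w"
  assumes w: "0 < w" "w \<le> k + 1"
    and large: "1 \<le> real (card (S 0)) * prob (agree (cube n) p)"
    and near: "near_bound n \<le> 1"
    and mix: "real (k + 1) ^ CARD('d) * prob (agree (cube n) p) * exp (- real ((n + 1) ^ CARD('d))) \<le> 1 / 8"
  shows "prob (agree (cube n) p \<inter> (\<Inter>j<m. miss n p (S j))) \<le> (7 / 8) ^ m * prob (agree (cube n) p)"
proof (induction m)
  case (Suc m)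
  let ?T = "\<lambda>j. \<Union>x\<in>S j. (+) x ` cube n"
  let ?A = "cube n \<union> (\<Union>j<m. ?T j)" and ?E = "agree (cube n) p \<inter> (\<Inter>j<m. miss n p (S j))"
  have finS: "finite (S j)" for j unfolding S_def by simp
  have cardS: "card (S j) = w * (k + 1) ^ (CARD('d) - 1)" for j
    unfolding S_def by (rule card_slab)
  have neS: "S j \<noteq> {}" for j
    using cardS[of j] w by auto
  have "card (?T m) \<le> (\<Sum>x\<in>S m. card ((+) x ` cube n))"
    by (rule card_UN_le[OF finS])
  also have "\<dots> = card (S m) * (n + 1) ^ CARD('d)"
    by (simp add: card_image card_cube)
  also have "card (S m) \<le> (k + 1) ^ CARD('d)"
  proof -
    have "card (S m) \<le> (k + 1) * (k + 1) ^ (CARD('d) - 1)"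
      unfolding cardS using w by (intro mult_right_mono) auto
    also have "\<dots> = (k + 1) ^ CARD('d)"
      by (simp flip: power_Suc)
    finally show ?thesis .
  qed
  finally have cT: "card (?T m) \<le> (k + 1) ^ CARD('d) * (n + 1) ^ CARD('d)"
    by simp
  \<comment> \<open>The miss in the new slab plays the role of \<open>E1\<close>, the pattern
    together with all earlier misses that of \<open>E2\<close>. The error is then relative to
    \<open>prob ?E\<close>, so the induction multiplies factors instead of adding errors.\<close>
  have "\<bar>prob (miss n p (S m) \<inter> ?E) - prob (miss n p (S m)) * prob ?E\<bar>
      \<le> real (card (?T m)) * (C1 * exp (- C2 * real (gap n))) * prob ?E"
  proof (rule mixing_ineq[where ?A2.0 = ?A])
    fix u v
    assume u: "u \<in> ?T m" and v: "v \<in> ?A"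
    from u obtain x y where xy: "u = x + y" "x \<in> S m" "y \<in> cube n" by blast
    then have "int (reach n + m * (w + reach n)) \<le> x $ i0" "0 \<le> y $ i0"
      unfolding S_def slab_def box_vec_def cube_def by (auto dest!: spec[of _ i0])
    then have u0: "int (reach n + m * (w + reach n)) \<le> u $ i0"
      using xy by simp
    have "v $ i0 + int (gap n) \<le> u $ i0"
      using v
    proof
      assume "v \<in> cube n"
      then have "v $ i0 \<le> int n" by (simp add: cube_def)
      moreover have "int (n + gap n) \<le> int (reach n + m * (w + reach n))"
        unfolding of_nat_le_iff reach_def by simp
      ultimately show ?thesis using u0 by linarith
    next
      assume "v \<in> (\<Union>j<m. ?T j)"
      then obtain j x' y' where j: "j < m" "v = x' + y'" "x' \<in> S j" "y' \<in> cube n" by blast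
      then have "x' $ i0 < int (reach n + j * (w + reach n) + w)" "y' $ i0 \<le> int n"
        unfolding S_def slab_def box_vec_def cube_def by (auto dest!: spec[of _ i0])
      then have v0: "v $ i0 < int (reach n + j * (w + reach n) + w + n)"
        using j by simp
      \<comment> \<open>Slabs have period w + reach n: the end of an earlier slab, extended by the
        extent n of the pattern, still leaves \<open>gap n\<close> before slab m.\<close>
      have "Suc j * (w + reach n) \<le> m * (w + reach n)"
        using j by (intro mult_le_mono1) simp
      then have "reach n + j * (w + reach n) + w + n + gap n \<le> reach n + m * (w + reach n)"
        by (simp add: reach_def)
      with u0 v0 show ?thesis by linarith
    qed
    then have "int (gap n) \<le> \<bar>(u - v) $ i0\<bar>" by simp
    also have "\<dots> \<le> l1_norm (u - v)" by (rule abs_nth_le_l1_norm)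
    finally show "real (gap n) \<le> real_of_int (l1_norm (u - v))" by linarith
  next
    show "depends_on ?A ?E"
    proof (rule depends_on_Int)
      show "depends_on ?A (\<Inter>j<m. miss n p (S j))"
        unfolding depends_on_def
      proof (intro allI impI)
        fix \<sigma> \<sigma>' :: "('d, 'a) config"
        assume *: "\<forall>y\<in>?A. \<sigma> y = \<sigma>' y"
        have "\<sigma> \<in> miss n p (S j) \<longleftrightarrow> \<sigma>' \<in> miss n p (S j)" if "j < m" for j
        proof -
          have "?T j \<subseteq> ?A" using that by (intro le_supI2 UN_upper) simp
          then have "\<forall>y\<in>?T j. \<sigma> y = \<sigma>' y" using * by (meson subsetD)
          then show ?thesis using depends_on_miss[where S = "S j" and n = n and p = p, unfolded depends_on_def] by simp
        qed
        then show "\<sigma> \<in> (\<Inter>j<m. miss n p (S j)) \<longleftrightarrow> \<sigma>' \<in> (\<Inter>j<m. miss n p (S j))"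
          by auto
      qed
    qed (rule depends_on_mono[OF depends_on_agree], simp)
  qed (use gap_pos finS neS in \<open>auto intro: depends_on_miss\<close>)
  \<comment> \<open>Keeping the mixing error below 1/8 gives the factor 3/4 + 1/8 = 7/8 per
    slab.\<close>
  also have "\<dots> \<le> 1 / 8 * prob ?E"
  proof (rule mult_right_mono)
    let ?N = "(n + 1) ^ CARD('d)"
    have "real (card (?T m)) * (C1 * exp (- C2 * real (gap n)))
        \<le> real (k + 1) ^ CARD('d) * real ?N * (C1 * exp (- C2 * real (gap n)))"
      using C1 iffD2[OF of_nat_le_iff cT] by (intro mult_right_mono) auto
    also have "\<dots> = real (k + 1) ^ CARD('d) * (real ?N * (C1 * exp (- C2 * real (gap n))))"
      by simp
    also have "\<dots> \<le> real (k + 1) ^ CARD('d) * (exp (- real ?N) * prob (agree (cube n) p))"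
      by (intro mult_left_mono gap_bound') auto
    also have "\<dots> \<le> 1 / 8" using mix by (simp add: ac_simps)
    finally show "real (card (?T m)) * (C1 * exp (- C2 * real (gap n))) \<le> 1 / 8" .
  qed simp
  finally have d: "\<bar>prob (miss n p (S m) \<inter> ?E) - prob (miss n p (S m)) * prob ?E\<bar> \<le> 1 / 8 * prob ?E" .
  have "prob (miss n p (S m) \<inter> ?E) \<le> (prob (miss n p (S m)) + 1 / 8) * prob ?E"
    unfolding distrib_right using abs_le_D1[OF d] by linarith
  also have "\<dots> \<le> (3 / 4 + 1 / 8) * prob ?E"
    by (intro mult_right_mono add_right_mono prob_miss_le finS near)
      (use large in \<open>simp_all add: cardS\<close>)
  also have "\<dots> \<le> (3 / 4 + 1 / 8) * ((7 / 8) ^ m * prob (agree (cube n) p))"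
    by (intro mult_left_mono Suc.IH) auto
  finally show ?case
    by (simp add: lessThan_Suc Int_ac)
qed simp

text \<open>For positive \<epsilon> and n this is the largest k with k^d P \<le> \<epsilon> ln n,
  where P is the pattern probability. A first repetition within this range is the claimed upper
  estimate, because ln (ln (n powr \<epsilon>)) equals ln (\<epsilon> ln n).\<close>

definition search_range :: "real \<Rightarrow> nat \<Rightarrow> ('d, 'a) config \<Rightarrow> nat" where
  "search_range \<epsilon> n p = nat \<lfloor>root CARD('d) (\<epsilon> * ln (real n) / prob (agree (cube n) p))\<rfloor>"

definition too_late :: "real \<Rightarrow> nat \<Rightarrow> ('d, 'a) config set" where
  "too_late \<epsilon> n = {\<sigma>. \<forall>x. x \<noteq> 0 \<and> (\<forall>i. 0 \<le> x $ i \<and> x $ i \<le> int (search_range \<epsilon> n \<sigma>)) \<longrightarrow>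
     shift x \<sigma> \<notin> agree (cube n) \<sigma>}"

lemma agree_Int_too_late:
  "agree (cube n) p \<inter> too_late \<epsilon> n =
   agree (cube n) p \<inter> miss n p (box_vec (\<lambda>_. {0..int (search_range \<epsilon> n p)}) - {0})"
proof -
  have same: "agree (cube n) \<sigma> = agree (cube n) p" if "\<sigma> \<in> agree (cube n) p" for \<sigma>
    using that by (intro agree_cong) (simp add: agree_def)
  have "\<sigma> \<in> too_late \<epsilon> n \<longleftrightarrow> \<sigma> \<in> miss n p (box_vec (\<lambda>_. {0..int (search_range \<epsilon> n p)}) - {0})"
    if "\<sigma> \<in> agree (cube n) p" for \<sigma>
    unfolding too_late_def miss_def hit_def search_range_def box_vec_def using same[OF that] by auto
  then show ?thesis by (intro set_eqI) (simp add: Int_iff cong: conj_cong)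
qed

lemma too_late_events [simp]: "too_late \<epsilon> n \<in> events"
proof -
  have fin: "finite (box_vec (\<lambda>_. {0..int (search_range \<epsilon> n p)}) :: (int ^ 'd) set)" for p by auto
  have "too_late \<epsilon> n = (\<Union>p\<in>cube n \<rightarrow>\<^sub>E UNIV. agree (cube n) p \<inter> too_late \<epsilon> n)"
    by (simp add: UN_agree)
  also have "\<dots> \<in> events"
    unfolding agree_Int_too_late
    by (intro sets.finite_UN sets.Int finite_patterns miss_events finite_Diff fin agree_events finite_cube)
  finally show ?thesis .
qed

lemma miss_antimono: "S \<subseteq> T \<Longrightarrow> miss n p T \<subseteq> miss n p S"
  by (auto simp: miss_def)

end

text \<open>The quotient 2 / ln (8/7) makes (7/8)^M at most n^(-2) for M about that multiple of ln
  n; the summand 1 absorbs the rounding up of M, as ln n \<ge> 1 for n \<ge> 3.\<close>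

definition slab_factor :: real where
  "slab_factor = 2 / ln (8 / 7) + 1"

definition slab_count :: "nat \<Rightarrow> nat" where
  "slab_count n = nat \<lceil>2 * ln (real n) / ln (8 / 7)\<rceil>"

lemma slab_factor_ge_1: "1 \<le> slab_factor"
  by (simp add: slab_factor_def)

lemma one_le_ln:
  assumes "3 \<le> n"
  shows "1 \<le> ln (real n)"
proof -
  have "ln 3 \<le> ln (real n)" using assms by (subst ln_le_cancel_iff) auto
  then show ?thesis using ln3_gt_1 by linarith
qed

lemma slab_count:
  assumes "3 \<le> n"
  shows "0 < slab_count n" "real (slab_count n) \<le> slab_factor * ln (real n)"
    "(7 / 8) ^ slab_count n \<le> 1 / real n ^ 2"
proof -
  define t where "t = 2 * ln (real n) / ln (8 / 7)"
  have l: "1 \<le> ln (real n)" using assms by (rule one_le_ln)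
  have "0 < t" using l by (simp add: t_def)
  then show "0 < slab_count n" by (simp add: slab_count_def t_def)
  have "real (slab_count n) \<le> t + 1"
    unfolding slab_count_def t_def[symmetric] using \<open>0 < t\<close> by linarith
  also have "\<dots> \<le> slab_factor * ln (real n)"
    using l by (simp add: slab_factor_def t_def algebra_simps)
  finally show "real (slab_count n) \<le> slab_factor * ln (real n)" .
  have "t \<le> real (slab_count n)"
    unfolding slab_count_def t_def[symmetric] by linarith
  then have "2 * ln (real n) \<le> real (slab_count n) * ln (8 / 7)"
    by (simp add: t_def field_simps)
  then have "exp (- (real (slab_count n) * ln (8 / 7))) \<le> exp (- (2 * ln (real n)))"
    by simp
  moreover have "exp (- (real (slab_count n) * ln (8 / 7))) = (7 / 8) ^ slab_count n"
    by (simp add: exp_minus exp_of_nat_mult power_divide flip: inverse_eq_divide)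
  moreover have "exp (- (2 * ln (real n))) = 1 / real n ^ 2"
    using assms by (simp add: exp_minus exp_double inverse_eq_divide power_one_over)
  ultimately show "(7 / 8) ^ slab_count n \<le> 1 / real n ^ 2" by simp
qed

context mixing_gibbs_field
begin

text \<open>One side of the search range is cut into M periods of length q, each a gap of R followed
  by a slab of width w. The slabs take at least half of that side, so each has at least (k+1)^d /
  (2M) sites. This is at least 1/P since M \<le> slab_factor ln n and \<epsilon> \<ge> 2
  slab_factor, which is the origin of the threshold.\<close>

lemma prob_agree_Int_too_late:
  assumes n: "3 \<le> n" and near: "near_bound n \<le> 1" and \<epsilon>: "2 * slab_factor \<le> \<epsilon>"
    and sparse: "real (2 * slab_count n * (reach n + 1)) ^ CARD('d) * (1 - \<delta>) ^ (n + 1) \<le> 1"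
    and indep: "2 ^ CARD('d) * (\<epsilon> * ln (real n)) * exp (- real ((n + 1) ^ CARD('d))) \<le> 1 / 8"
  shows "prob (agree (cube n) p \<inter> too_late \<epsilon> n) \<le> 1 / real n ^ 2 * prob (agree (cube n) p)"
proof -
  define M R k where "M = slab_count n" and "R = reach n" and "k = search_range \<epsilon> n p"
  let ?P = "prob (agree (cube n) p)"
  let ?y = "\<epsilon> * ln (real n) / ?P"
  have P: "0 < ?P" by simp
  have l: "1 \<le> ln (real n)" using n by (rule one_le_ln)
  have "2 \<le> \<epsilon>" using \<epsilon> slab_factor_ge_1 by simp
  have \<epsilon>l: "1 \<le> \<epsilon> * ln (real n)"
    using mult_mono[of 1 \<epsilon> 1 "ln (real n)"] l \<open>2 \<le> \<epsilon>\<close> by simp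
  have y: "0 \<le> ?y" using \<epsilon>l by simp
  have k: "real k ^ CARD('d) \<le> ?y" "?y < real (k + 1) ^ CARD('d)"
    unfolding k_def search_range_def using nat_floor_root(1,2)[OF _ y, of "CARD('d)"] by auto
  have M: "0 < M" "real M \<le> slab_factor * ln (real n)"
    unfolding M_def using slab_count[OF n] by auto
  \<comment> \<open>The range must be long enough for M gaps. Otherwise 1/P would be at most
    polynomial in n, although it is at least the inverse of (1 - \<delta>)^(n+1); this conflict is
    what \<open>sparse\<close> expresses.\<close>
  have kM: "2 * M * (R + 1) \<le> k + 1"
  proof (rule ccontr)
    assume "\<not> ?thesis"
    then have "real (k + 1) ^ CARD('d) \<le> real (2 * M * (R + 1)) ^ CARD('d)"
      by (intro power_mono) (simp_all only: of_nat_le_iff of_nat_0_le_iff)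
    then have "?y < real (2 * M * (R + 1)) ^ CARD('d)" using k by linarith
    then have "\<epsilon> * ln (real n) < real (2 * M * (R + 1)) ^ CARD('d) * ?P"
      using P by (simp only: pos_divide_less_eq)
    also have "?P \<le> (1 - \<delta>) ^ ((n + 1) ^ CARD('d))"
      using prob_agree_le[of "cube n" p] by (simp add: card_cube)
    also have "\<dots> \<le> (1 - \<delta>) ^ (n + 1)"
      using \<delta> dim by (intro power_decreasing self_le_power) auto
    finally show False
      using sparse \<epsilon>l unfolding M_def R_def by (simp add: mult_left_mono)
  qed
  define q where "q = (k + 1) div M"
  define w where "w = q - R"
  have "2 * (R + 1) = 2 * M * (R + 1) div M" using M by simp
  also have "\<dots> \<le> q" unfolding q_def using kM by (rule div_le_mono)
  finally have q: "2 * (R + 1) \<le> q" .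
  have w: "0 < w" "w + R = q" "q + 1 \<le> 2 * w" using q by (auto simp: w_def)
  have Mq: "M * q \<le> k + 1" unfolding q_def by simp
  have "k + 1 < M * (q + 1)"
    unfolding q_def using M by (metis Suc_eq_plus1 dividend_less_times_div mult_Suc_right add.commute)
  also have "\<dots> \<le> M * (2 * w)" using w by (intro mult_left_mono) auto
  finally have kw: "k + 1 \<le> 2 * M * w" by simp
  have "q \<le> M * q" using M by simp
  then have "w \<le> k + 1" using w Mq by linarith
  obtain i0 :: 'd where True by blast
  \<comment> \<open>The first slab starts at R > 0, so no slab contains the zero
    displacement.\<close>
  define S where "S = (\<lambda>j. slab i0 k (R + j * (w + R)) w)"
  have "real (k + 1) ^ CARD('d) = real (k + 1) * real (k + 1) ^ (CARD('d) - 1)"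
    by (simp flip: power_Suc)
  also have "\<dots> \<le> real (2 * M * w) * real (k + 1) ^ (CARD('d) - 1)"
    using kw by (intro mult_right_mono) (simp_all only: of_nat_le_iff zero_le_power of_nat_0_le_iff)
  also have "\<dots> = 2 * real M * real (card (S 0))"
    unfolding S_def card_slab by simp
  finally have "?y \<le> 2 * real M * real (card (S 0))" using k by linarith
  then have "\<epsilon> * ln (real n) \<le> 2 * real M * real (card (S 0)) * ?P"
    using P by (simp only: pos_divide_le_eq)
  moreover have "2 * real M \<le> \<epsilon> * ln (real n)"
    using M mult_right_mono[OF \<epsilon>, of "ln (real n)"] l by linarith
  ultimately have "2 * real M * 1 \<le> 2 * real M * (real (card (S 0)) * ?P)" by simp
  then have large: "1 \<le> real (card (S 0)) * ?P"
    using M by (subst (asm) mult_le_cancel_left_pos) auto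
  have mix: "real (k + 1) ^ CARD('d) * ?P * exp (- real ((n + 1) ^ CARD('d))) \<le> 1 / 8"
  proof -
    have "1 \<le> M * (R + 1)" using M by simp
    then have "1 \<le> k" using kM by linarith
    then have "real (k + 1) ^ CARD('d) \<le> (2 * real k) ^ CARD('d)"
      by (intro power_mono) auto
    also have "\<dots> \<le> 2 ^ CARD('d) * ?y"
      unfolding power_mult_distrib by (intro mult_left_mono k) auto
    finally have "real (k + 1) ^ CARD('d) * ?P \<le> 2 ^ CARD('d) * ?y * ?P"
      using P by (intro mult_right_mono) auto
    also have "\<dots> = 2 ^ CARD('d) * (\<epsilon> * ln (real n))" by simp
    finally have "real (k + 1) ^ CARD('d) * ?P * exp (- real ((n + 1) ^ CARD('d)))
        \<le> 2 ^ CARD('d) * (\<epsilon> * ln (real n)) * exp (- real ((n + 1) ^ CARD('d)))"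
      by (intro mult_right_mono) auto
    with indep show ?thesis by linarith
  qed
  have sub: "S j \<subseteq> box_vec (\<lambda>_. {0..int k}) - {0}" if "j < M" for j
  proof
    fix x
    assume x: "x \<in> S j"
    have "R + j * (w + R) + w = Suc j * (w + R)" by simp
    also have "\<dots> \<le> M * (w + R)" using that by (intro mult_le_mono1) simp
    also have "\<dots> \<le> k + 1" using Mq w by simp
    finally have b: "R + j * (w + R) + w \<le> k + 1" .
    have xi: "x $ i \<in> (if i = i0 then {int (R + j * (w + R))..<int (R + j * (w + R) + w)} else {0..int k})" for i
      using x unfolding S_def slab_def box_vec_def by blast
    have "x $ i \<in> {0..int k}" for i
    proof (cases "i = i0")
      case True
      then have "int (R + j * (w + R)) \<le> x $ i" "x $ i < int (R + j * (w + R) + w)"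
        using xi[of i] by auto
      then show ?thesis using b by (auto simp del: of_nat_add)
    qed (use xi[of i] in auto)
    moreover have "0 < x $ i0"
    proof -
      have "0 < R" unfolding R_def reach_def using gap_pos[of n] by simp
      then have "0 < int (R + j * (w + R))" by (simp only: of_nat_0_less_iff add_pos_nonneg zero_le)
      also have "\<dots> \<le> x $ i0" using xi[of i0] by simp
      finally show ?thesis .
    qed
    then have "x \<noteq> 0" by auto
    ultimately show "x \<in> box_vec (\<lambda>_. {0..int k}) - {0}" by (simp add: box_vec_def)
  qed
  have "agree (cube n) p \<inter> too_late \<epsilon> n \<subseteq> agree (cube n) p \<inter> (\<Inter>j<M. miss n p (S j))"
    unfolding agree_Int_too_late k_def[symmetric]
    by (intro Int_mono order_refl INT_greatest miss_antimono sub) simp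
  then have "prob (agree (cube n) p \<inter> too_late \<epsilon> n) \<le> prob (agree (cube n) p \<inter> (\<Inter>j<M. miss n p (S j)))"
  proof (rule finite_measure_mono)
    have "(\<Inter>j<M. miss n p (S j)) \<in> events"
      by (rule sets.finite_INT) (use M in \<open>auto simp: S_def\<close>)
    then show "agree (cube n) p \<inter> (\<Inter>j<M. miss n p (S j)) \<in> events" by auto
  qed
  also have "\<dots> \<le> (7 / 8) ^ M * ?P"
    unfolding S_def R_def
    by (rule prob_miss_slabs[OF w(1) \<open>w \<le> k + 1\<close> _ near mix]) (use large in \<open>simp add: S_def R_def\<close>)
  also have "\<dots> \<le> 1 / real n ^ 2 * ?P"
    unfolding M_def by (intro mult_right_mono slab_count n) auto
  finally show ?thesis .
qed

text \<open>The base grows at most like n^(d+1), the slab count being bounded by a multiple of n + 1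
  and the reach being of order n^d. Its power of order d is thus polynomial and loses against the
  geometric factor.\<close>

lemma eventually_sparse:
  "\<forall>\<^sub>F n in sequentially. real (2 * slab_count n * (reach n + 1)) ^ CARD('d) * (1 - \<delta>) ^ (n + 1) \<le> 1"
proof -
  let ?D = "CARD('d)"
  define G where "G = 2 * slab_factor * real (2 * gap_factor + 2)"
  have "(\<lambda>n. real n ^ (Suc ?D * ?D) * (1 - \<delta>) ^ n) \<longlonglongrightarrow> 0"
    using \<delta> by (intro power_mult_geometric_tendsto_0) auto
  then have "(\<lambda>n. G ^ ?D * (real (Suc n) ^ (Suc ?D * ?D) * (1 - \<delta>) ^ Suc n)) \<longlonglongrightarrow> G ^ ?D * 0"
    by (intro tendsto_mult tendsto_const) (rule LIMSEQ_Suc)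
  then have "\<forall>\<^sub>F n in sequentially. G ^ ?D * (real (Suc n) ^ (Suc ?D * ?D) * (1 - \<delta>) ^ Suc n) < 1"
    by (rule order_tendstoD(2)) simp
  then show ?thesis
    using eventually_ge_at_top[of 3]
  proof eventually_elim
    case (elim n)
    have "real (slab_count n) \<le> slab_factor * ln (real n)" by (rule slab_count[OF elim(2)])
    also have "\<dots> \<le> slab_factor * real (n + 1)"
      using ln_le_minus_one[of "real n"] slab_factor_ge_1 elim(2) by (intro mult_left_mono) auto
    finally have a: "real (slab_count n) \<le> slab_factor * real (n + 1)" .
    have b: "real (reach n + 1) \<le> real (2 * gap_factor + 2) * real (n + 1) ^ ?D"
      using reach_le[of n] by simp
    have "real (2 * slab_count n * (reach n + 1)) = 2 * real (slab_count n) * real (reach n + 1)"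
      by (simp add: algebra_simps)
    also have "\<dots> \<le> 2 * (slab_factor * real (n + 1)) * (real (2 * gap_factor + 2) * real (n + 1) ^ ?D)"
      using slab_factor_ge_1 by (intro mult_mono a b) auto
    also have "\<dots> = G * real (Suc n) ^ Suc ?D"
      by (simp add: G_def)
    finally have "real (2 * slab_count n * (reach n + 1)) ^ ?D \<le> (G * real (Suc n) ^ Suc ?D) ^ ?D"
      by (rule power_mono) simp
    then have "real (2 * slab_count n * (reach n + 1)) ^ ?D * (1 - \<delta>) ^ (n + 1)
        \<le> (G * real (Suc n) ^ Suc ?D) ^ ?D * (1 - \<delta>) ^ (n + 1)"
      using \<delta> by (intro mult_right_mono) auto
    also have "\<dots> = G ^ ?D * (real (Suc n) ^ (Suc ?D * ?D) * (1 - \<delta>) ^ Suc n)"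
      by (simp only: power_mult_distrib power_mult mult.assoc Suc_eq_plus1)
    finally show ?case using elim(1) by linarith
  qed
qed

lemma eventually_indep:
  assumes "0 \<le> \<epsilon>"
  shows "\<forall>\<^sub>F n in sequentially.
    2 ^ CARD('d) * (\<epsilon> * ln (real n)) * exp (- real ((n + 1) ^ CARD('d))) \<le> 1 / 8"
proof -
  have "(\<lambda>n. real n ^ 1 * exp (- 1) ^ n) \<longlonglongrightarrow> 0"
    by (rule power_mult_geometric_tendsto_0) auto
  then have "(\<lambda>n. 2 ^ CARD('d) * \<epsilon> * (real n ^ 1 * exp (- 1) ^ n)) \<longlonglongrightarrow> 2 ^ CARD('d) * \<epsilon> * 0"
    by (intro tendsto_mult tendsto_const)
  then have "\<forall>\<^sub>F n in sequentially. 2 ^ CARD('d) * \<epsilon> * (real n ^ 1 * exp (- 1) ^ n) < 1 / 8"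
    by (rule order_tendstoD(2)) simp
  then show ?thesis
    using eventually_ge_at_top[of 1]
  proof eventually_elim
    case (elim n)
    have "n + 1 \<le> (n + 1) ^ CARD('d)" using dim by (intro self_le_power) auto
    then have "real n \<le> real ((n + 1) ^ CARD('d))" by linarith
    then have "exp (- real ((n + 1) ^ CARD('d))) \<le> exp (- real n)" by simp
    also have "\<dots> = exp (- 1) ^ n" by (simp flip: exp_of_nat_mult)
    finally have "ln (real n) * exp (- real ((n + 1) ^ CARD('d))) \<le> real n * exp (- 1) ^ n"
      using elim ln_le_minus_one[of "real n"] by (intro mult_mono) auto
    then have "2 ^ CARD('d) * \<epsilon> * (ln (real n) * exp (- real ((n + 1) ^ CARD('d))))
        \<le> 2 ^ CARD('d) * \<epsilon> * (real n ^ 1 * exp (- 1) ^ n)"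
      using assms by (intro mult_left_mono) auto
    also have "\<dots> < 1 / 8" by (rule elim(1))
    finally show ?case by (simp only: mult.assoc less_imp_le)
  qed
qed

lemma AE_not_too_late:
  assumes \<epsilon>: "2 * slab_factor \<le> \<epsilon>"
  shows "AE \<sigma> in P. \<forall>\<^sub>F n in sequentially. \<sigma> \<notin> too_late \<epsilon> n"
proof -
  have "near_bound \<longlonglongrightarrow> 0"
    by (rule summable_LIMSEQ_zero[OF summable_near_bound])
  then have ev: "\<forall>\<^sub>F n in sequentially. near_bound n < 1"
    by (rule order_tendstoD(2)) simp
  have "0 \<le> \<epsilon>" using \<epsilon> slab_factor_ge_1 by linarith
  have "\<forall>\<^sub>F n in sequentially. norm (prob (too_late \<epsilon> n)) \<le> inverse (real n ^ 2)"
    using ev eventually_sparse eventually_indep[OF \<open>0 \<le> \<epsilon>\<close>] eventually_ge_at_top[of 3]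
  proof eventually_elim
    case (elim n)
    have "prob (too_late \<epsilon> n) \<le> 1 / real n ^ 2"
      by (rule prob_le_by_pattern[OF finite_cube too_late_events], rule prob_agree_Int_too_late)
        (use elim \<epsilon> in auto)
    then show ?case by (simp add: inverse_eq_divide)
  qed
  then have "summable (\<lambda>n. prob (too_late \<epsilon> n))"
    by (rule summable_comparison_test_ev) (simp add: inverse_power_summable)
  then have "AE \<sigma> in P. \<forall>\<^sub>F n in sequentially. \<sigma> \<in> space P - too_late \<epsilon> n"
    by (intro borel_cantelli_AE1) (auto simp: emeasure_eq_measure)
  then show ?thesis by simp
qed

end

subsection \<open>Almost sure convergence of the information density\<close>

lemma (in prob_space) second_moment_Chebyshev:
  assumes "finite J" and Z: "\<And>j. j \<in> J \<Longrightarrow> Z j \<in> borel_measurable M"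
    and bnd: "\<And>j \<omega>. j \<in> J \<Longrightarrow> \<bar>Z j \<omega>\<bar> \<le> (b :: real)"
    and pairs: "(\<Sum>i\<in>J. \<Sum>j\<in>J. expectation (\<lambda>\<omega>. Z i \<omega> * Z j \<omega>)) \<le> v"
    and t: "0 < t"
  shows "prob {\<omega> \<in> space M. t \<le> \<bar>\<Sum>j\<in>J. Z j \<omega>\<bar>} \<le> v / t ^ 2"
proof -
  let ?S = "\<lambda>\<omega>. \<Sum>j\<in>J. Z j \<omega>"
  have int: "integrable M (\<lambda>\<omega>. Z i \<omega> * Z j \<omega>)" if "i \<in> J" "j \<in> J" for i j
  proof (rule integrable_const_bound[of _ "b * b"])
    have "norm (Z i \<omega> * Z j \<omega>) \<le> b * b" for \<omega>
    proof -
      have "0 \<le> b" using bnd[OF that(1), of \<omega>] by linarith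
      then show ?thesis unfolding real_norm_def abs_mult
        by (intro mult_mono bnd that) auto
    qed
    then show "AE \<omega> in M. norm (Z i \<omega> * Z j \<omega>) \<le> b * b" by simp
  qed (use Z that in auto)
  have sq: "?S \<omega> ^ 2 = (\<Sum>i\<in>J. \<Sum>j\<in>J. Z i \<omega> * Z j \<omega>)" for \<omega>
    by (simp add: power2_eq_square sum_product)
  have S: "?S \<in> borel_measurable M" using Z by measurable
  have intS: "integrable M (\<lambda>\<omega>. ?S \<omega> ^ 2)"
    unfolding sq by (intro Bochner_Integration.integrable_sum int)
  have "expectation (\<lambda>\<omega>. ?S \<omega> ^ 2) = (\<Sum>i\<in>J. expectation (\<lambda>\<omega>. \<Sum>j\<in>J. Z i \<omega> * Z j \<omega>))"
    unfolding sq by (rule Bochner_Integration.integral_sum) (intro Bochner_Integration.integrable_sum int)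
  also have "\<dots> = (\<Sum>i\<in>J. \<Sum>j\<in>J. expectation (\<lambda>\<omega>. Z i \<omega> * Z j \<omega>))"
    by (intro sum.cong refl Bochner_Integration.integral_sum int)
  finally have E: "expectation (\<lambda>\<omega>. ?S \<omega> ^ 2) \<le> v" using pairs by simp
  have "prob {\<omega> \<in> space M. t \<le> \<bar>?S \<omega>\<bar>} = prob {\<omega> \<in> space M. t ^ 2 \<le> ?S \<omega> ^ 2}"
  proof -
    have "t \<le> \<bar>x\<bar> \<longleftrightarrow> t ^ 2 \<le> x ^ 2" for x :: real
      using abs_le_square_iff[of t x] t by simp
    then show ?thesis by simp
  qed
  also have "\<dots> \<le> expectation (\<lambda>\<omega>. ?S \<omega> ^ 2) / t ^ 2"
    by (rule integral_Markov_inequality_measure[where A = "space M"]) (use intS t in auto)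
  also have "\<dots> \<le> v / t ^ 2"
    using E by (intro divide_right_mono) auto
  finally show ?thesis .
qed

section \<open>Functions of finitely many spins and the decay of their covariances\<close>

definition local_on :: "'x set \<Rightarrow> (('x \<Rightarrow> 'b) \<Rightarrow> real) \<Rightarrow> bool" where
  "local_on V f \<longleftrightarrow> (\<forall>\<sigma> \<sigma>'. (\<forall>y\<in>V. \<sigma> y = \<sigma>' y) \<longrightarrow> f \<sigma> = f \<sigma>')"

lemma local_on_depends: "local_on V f \<Longrightarrow> depends_on V (f -` S)"
  unfolding local_on_def depends_on_def by (metis vimage_eq)

text \<open>A function of finitely many spins is a finite combination of pattern indicators;
  expectations and products thereby reduce to pattern probabilities, where mixing applies
  directly.\<close>

lemma local_on_sum_agree:
  fixes V :: "(int ^ 'd::finite) set" and f :: "('d, 'a::finite) config \<Rightarrow> real"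
  assumes "finite V" "local_on V f"
  shows "f \<sigma> = (\<Sum>p\<in>V \<rightarrow>\<^sub>E UNIV. f p * indicator (agree V p) \<sigma>)"
proof -
  have "(\<Sum>p\<in>V \<rightarrow>\<^sub>E UNIV. f p * indicator (agree V p) \<sigma>) =
      (\<Sum>p\<in>V \<rightarrow>\<^sub>E UNIV. if p = restrict \<sigma> V then f p else 0)"
  proof (rule sum.cong[OF refl])
    fix p :: "('d, 'a) config"
    assume p: "p \<in> V \<rightarrow>\<^sub>E UNIV"
    have "\<sigma> \<in> agree V p \<longleftrightarrow> p = restrict \<sigma> V"
    proof
      assume "\<sigma> \<in> agree V p"
      then show "p = restrict \<sigma> V"
        by (intro PiE_ext[OF p]) (auto simp: agree_def)
    qed (auto simp: agree_def)
    then show "f p * indicator (agree V p) \<sigma> = (if p = restrict \<sigma> V then f p else 0)"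
      by simp
  qed
  also have "\<dots> = f (restrict \<sigma> V)"
    using assms(1) by (subst sum.delta) auto
  also have "\<dots> = f \<sigma>"
    using assms(2)[unfolded local_on_def, rule_format, of "restrict \<sigma> V" \<sigma>] by simp
  finally show ?thesis by simp
qed

context mixing_gibbs_field
begin

lemma local_on_measurable:
  assumes "finite V" "local_on V f"
  shows "f \<in> borel_measurable P"
proof (rule measurableI)
  fix S :: "real set"
  show "f -` S \<inter> space P \<in> events"
    using depends_on_events[OF assms(1) local_on_depends[OF assms(2), of S]] by simp
qed simp

lemma local_on_integrable:
  assumes "finite V" "local_on V f" "\<And>\<sigma>. \<bar>f \<sigma>\<bar> \<le> b"
  shows "integrable P f"
  by (rule integrable_const_bound[of _ b]) (use assms local_on_measurable in auto)

lemma local_on_expectation: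
  assumes "finite V" "local_on V f"
  shows "expectation f = (\<Sum>p\<in>V \<rightarrow>\<^sub>E UNIV. f p * prob (agree V p))"
proof -
  have "expectation f = expectation (\<lambda>\<sigma>. \<Sum>p\<in>V \<rightarrow>\<^sub>E UNIV. f p * indicator (agree V p) \<sigma>)"
    by (rule arg_cong[where f = expectation], rule ext, rule local_on_sum_agree[OF assms])
  also have "\<dots> = (\<Sum>p\<in>V \<rightarrow>\<^sub>E UNIV. expectation (\<lambda>\<sigma>. f p * indicator (agree V p) \<sigma>))"
    using assms(1)
    by (intro Bochner_Integration.integral_sum integrable_mult_right) (auto simp: emeasure_eq_measure)
  also have "\<dots> = (\<Sum>p\<in>V \<rightarrow>\<^sub>E UNIV. f p * prob (agree V p))"
    using assms(1) by (intro sum.cong) auto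
  finally show ?thesis .
qed

lemma local_on_expectation_mult:
  assumes "finite V" "local_on V f" "finite W" "local_on W g"
  shows "expectation (\<lambda>\<sigma>. f \<sigma> * g \<sigma>) =
    (\<Sum>p\<in>V \<rightarrow>\<^sub>E UNIV. \<Sum>q\<in>W \<rightarrow>\<^sub>E UNIV. f p * g q * prob (agree V p \<inter> agree W q))"
proof -
  let ?h = "\<lambda>p q \<sigma>. f p * g q * indicator (agree V p \<inter> agree W q) \<sigma>"
  have int: "integrable P (?h p q)" for p q
    using assms
    by (intro integrable_mult_right integrable_real_indicator sets.Int) (auto simp: emeasure_eq_measure)
  have "f \<sigma> * g \<sigma> = (\<Sum>p\<in>V \<rightarrow>\<^sub>E UNIV. \<Sum>q\<in>W \<rightarrow>\<^sub>E UNIV. ?h p q \<sigma>)" for \<sigma>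
    by (subst local_on_sum_agree[OF assms(1,2)], subst local_on_sum_agree[OF assms(3,4)])
      (simp add: sum_product indicator_inter_arith ac_simps)
  then have "expectation (\<lambda>\<sigma>. f \<sigma> * g \<sigma>) =
      expectation (\<lambda>\<sigma>. \<Sum>p\<in>V \<rightarrow>\<^sub>E UNIV. \<Sum>q\<in>W \<rightarrow>\<^sub>E UNIV. ?h p q \<sigma>)"
    by simp
  also have "\<dots> = (\<Sum>p\<in>V \<rightarrow>\<^sub>E UNIV. expectation (\<lambda>\<sigma>. \<Sum>q\<in>W \<rightarrow>\<^sub>E UNIV. ?h p q \<sigma>))"
    by (intro Bochner_Integration.integral_sum Bochner_Integration.integrable_sum int)
  also have "\<dots> = (\<Sum>p\<in>V \<rightarrow>\<^sub>E UNIV. \<Sum>q\<in>W \<rightarrow>\<^sub>E UNIV. expectation (?h p q))"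
    by (intro sum.cong refl Bochner_Integration.integral_sum int)
  also have "\<dots> = (\<Sum>p\<in>V \<rightarrow>\<^sub>E UNIV. \<Sum>q\<in>W \<rightarrow>\<^sub>E UNIV. f p * g q * prob (agree V p \<inter> agree W q))"
    using assms by (intro sum.cong refl) simp
  finally show ?thesis .
qed

text \<open>Both functions are expanded over patterns. The mixing error is relative to the pattern
  on \<open>W\<close>, and those probabilities sum to 1, so only the number of patterns on
  \<open>V\<close> enters the bound.\<close>

lemma covariance_le:
  assumes V: "finite V" "V \<noteq> {}" "local_on V f" "\<And>\<sigma>. \<bar>f \<sigma>\<bar> \<le> b"
    and W: "finite W" "W \<noteq> {}" "local_on W g" "\<And>\<sigma>. \<bar>g \<sigma>\<bar> \<le> b"
    and far: "\<And>x y. x \<in> V \<Longrightarrow> y \<in> W \<Longrightarrow> m \<le> real_of_int (l1_norm (x - y))" and m: "0 < m"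
  shows "\<bar>expectation (\<lambda>\<sigma>. f \<sigma> * g \<sigma>) - expectation f * expectation g\<bar> \<le>
    b ^ 2 * real CARD('a) ^ card V * (real (card V) * C1 * exp (- C2 * m))"
proof -
  let ?V = "V \<rightarrow>\<^sub>E (UNIV :: 'a set)" and ?W = "W \<rightarrow>\<^sub>E (UNIV :: 'a set)"
  let ?e = "real (card V) * (C1 * exp (- C2 * m))"
  let ?d = "\<lambda>p q. prob (agree V p \<inter> agree W q) - prob (agree V p) * prob (agree W q)"
  have b: "0 \<le> b" using V(4)[of undefined] by linarith
  have "expectation (\<lambda>\<sigma>. f \<sigma> * g \<sigma>) - expectation f * expectation g =
      (\<Sum>p\<in>?V. \<Sum>q\<in>?W. f p * g q * ?d p q)"
    unfolding local_on_expectation_mult[OF V(1,3) W(1,3)] local_on_expectation[OF V(1,3)]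
      local_on_expectation[OF W(1,3)] sum_product sum_subtractf[symmetric]
    by (intro sum.cong refl) (simp add: algebra_simps)
  also have "\<bar>\<dots>\<bar> \<le> (\<Sum>p\<in>?V. \<Sum>q\<in>?W. \<bar>f p * g q * ?d p q\<bar>)"
    by (intro order_trans[OF sum_abs] sum_mono sum_abs)
  also have "\<dots> \<le> (\<Sum>p\<in>?V. \<Sum>q\<in>?W. b * b * (?e * prob (agree W q)))"
    unfolding abs_mult
    by (intro sum_mono mult_mono V W b mixing_ineq[OF V(1,2) W(1,2) far m] depends_on_agree)
      (use b in auto)
  also have "\<dots> = real (card ?V) * (b * b * ?e) * (\<Sum>q\<in>?W. prob (agree W q))"
    by (simp add: sum_distrib_left ac_simps)
  also have "\<dots> = b ^ 2 * real CARD('a) ^ card V * (real (card V) * C1 * exp (- C2 * m))"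
    using sum_prob_agree_1[OF W(1)] V(1) by (simp add: card_PiE power2_eq_square)
  finally show ?thesis .
qed

text \<open>Taken without the usual minus sign, hence nonpositive. It would be exactly additive over
  disjoint sets if the spins were independent.\<close>

definition information :: "(int ^ 'd) set \<Rightarrow> ('d, 'a) config \<Rightarrow> real" where
  "information V \<sigma> = ln (prob (agree V \<sigma>))"

lemma local_on_information: "local_on V (information V)"
  unfolding local_on_def information_def
  by (intro allI impI arg_cong[where f = ln] arg_cong[where f = prob] agree_cong) auto

lemma abs_information_le:
  assumes "finite V"
  shows "\<bar>information V \<sigma>\<bar> \<le> real (card V) * - ln \<delta>"
  using ln_prob_agree_Un[of "{}" V \<sigma>] assms prob_space by (simp add: information_def)

lemma integrable_information: "finite V \<Longrightarrow> integrable P (information V)"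
  by (rule local_on_integrable[OF _ local_on_information abs_information_le]) auto

lemma prob_agree_translate:
  assumes "finite V"
  shows "prob (agree ((+) x ` V) p) = prob (agree V (shift x p))"
  using prob_shift[of "agree V (shift x p)" x] assms
  unfolding vimage_shift_agree by (simp add: shift_shift)

lemma information_translate: "finite V \<Longrightarrow> information ((+) x ` V) \<sigma> = information V (shift x \<sigma>)"
  by (simp add: information_def prob_agree_translate)

lemma expectation_shift:
  assumes "f \<in> borel_measurable P"
  shows "expectation (\<lambda>\<sigma>. f (shift x \<sigma>)) = (expectation f :: real)"
  using integral_distr[OF shift_measurable_P[of x] assms] invariant
  by (simp add: translation_invariant_def)

lemma factorization_translate:
  assumes "finite V" "V \<inter> (+) x ` cube n = {}"
  shows "\<bar>information ((+) x ` cube n \<union> V) \<sigma> - information ((+) x ` cube n) \<sigma> - information V \<sigma>\<bar> \<le> c n"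
proof -
  define W where "W = (+) (- x) ` V"
  have VW: "V = (+) x ` W" unfolding W_def by (simp add: image_image)
  have W: "finite W" "W \<inter> cube n = {}"
  proof -
    show "finite W" using assms(1) by (simp add: W_def)
    have "x + y \<in> V \<inter> (+) x ` cube n" if "y \<in> W \<inter> cube n" for y
      using that by (auto simp: W_def)
    then show "W \<inter> cube n = {}" using assms(2) by blast
  qed
  have "information (cube n \<union> W) (shift x \<sigma>) - information (cube n) (shift x \<sigma>) - information W (shift x \<sigma>)
      = information ((+) x ` cube n \<union> V) \<sigma> - information ((+) x ` cube n) \<sigma> - information V \<sigma>"
    unfolding VW image_Un[symmetric] using W(1) by (simp add: information_translate)
  then show ?thesis
    using factorization[OF W, of "shift x \<sigma>"] unfolding information_def by simp
qed

text \<open>Blocks are removed one at a time. Factorization holds for a cube against an arbitrary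
  finite pattern outside it, so each block costs \<open>c n\<close> regardless of how many others
  are joined to it.\<close>

lemma information_blocks:
  assumes J: "finite J" and disj: "disjoint_family_on (\<lambda>j. (+) (s j) ` cube n) J"
  shows "\<bar>information (\<Union>j\<in>J. (+) (s j) ` cube n) \<sigma> - (\<Sum>j\<in>J. information ((+) (s j) ` cube n) \<sigma>)\<bar>
    \<le> real (card J) * c n"
  using J disj
proof (induction J)
  case empty
  show ?case using prob_space by (simp add: information_def)
next
  case (insert j J)
  let ?V = "\<Union>j\<in>J. (+) (s j) ` cube n"
  have dj: "disjoint_family_on (\<lambda>j. (+) (s j) ` cube n) J"
    using insert.prems by (auto simp: disjoint_family_on_def)
  have "?V \<inter> (+) (s j) ` cube n = {}"
    using insert.prems insert.hyps(2) unfolding disjoint_family_on_def by fastforce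
  from factorization_translate[OF _ this, of \<sigma>] insert.IH[OF dj] insert.hyps
  show ?case by (simp add: algebra_simps abs_le_iff)
qed

text \<open>Used for the sites not covered by the tiling: by finite energy each costs at most -ln
  \<delta>.\<close>

lemma information_superset:
  assumes "finite V" "W \<subseteq> V"
  shows "\<bar>information V \<sigma> - information W \<sigma>\<bar> \<le> (real (card V) - real (card W)) * - ln \<delta>"
proof -
  have fin: "finite W" using assms finite_subset by blast
  have "W \<union> (V - W) = V" using assms by auto
  moreover have "real (card (V - W)) = real (card V) - real (card W)"
    using assms fin by (simp add: card_Diff_subset of_nat_diff card_mono)
  ultimately show ?thesis
    using ln_prob_agree_Un[of W "V - W" \<sigma>] assms fin by (simp add: information_def Diff_disjoint Int_commute)
qed

section \<open>Tiling by blocks of side n + 1 and deviations of block sums\<close>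

definition corner :: "nat \<Rightarrow> int ^ 'd \<Rightarrow> int ^ 'd" where
  "corner n j = (\<chi> i. int (n + 1) * j $ i)"

definition block :: "nat \<Rightarrow> int ^ 'd \<Rightarrow> (int ^ 'd) set" where
  "block n j = (+) (corner n j) ` cube n"

definition block_index :: "nat \<Rightarrow> (int ^ 'd) set" where
  "block_index q = box_vec (\<lambda>_. {0..<int q})"

definition block_sum :: "nat \<Rightarrow> nat \<Rightarrow> ('d, 'a) config \<Rightarrow> real" where
  "block_sum n q \<sigma> = (\<Sum>j\<in>block_index q. information (block n j) \<sigma>)"

definition mean_information :: "nat \<Rightarrow> real" where
  "mean_information n = expectation (information (cube n))"

lemma finite_block_index [simp]: "finite (block_index q)"
  by (auto simp: block_index_def)

lemma card_block_index: "card (block_index q) = q ^ CARD('d)"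
  by (simp add: block_index_def card_box_vec)

lemma finite_block [simp]: "finite (block n j)"
  by (simp add: block_def)

lemma block_nonempty [simp]: "block n j \<noteq> {}"
  by (simp add: block_def)

lemma card_block: "card (block n j) = (n + 1) ^ CARD('d)"
  by (simp add: block_def card_image card_cube)

lemma block_nth:
  assumes "x \<in> block n j"
  shows "int (n + 1) * j $ i \<le> x $ i" "x $ i \<le> int (n + 1) * j $ i + int n" "x $ i div int (n + 1) = j $ i"
proof -
  obtain y where y: "x = corner n j + y" "y \<in> cube n"
    using assms by (auto simp: block_def)
  then have "x $ i = int (n + 1) * j $ i + y $ i" "0 \<le> y $ i" "y $ i \<le> int n"
    by (auto simp: corner_def cube_def)
  then show "int (n + 1) * j $ i \<le> x $ i" "x $ i \<le> int (n + 1) * j $ i + int n" "x $ i div int (n + 1) = j $ i"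
    by auto
qed

lemma disjoint_blocks: "disjoint_family_on (block n) J"
proof (unfold disjoint_family_on_def, intro ballI impI)
  fix j j' :: "int ^ 'd"
  assume "j \<noteq> j'"
  then obtain i where "j $ i \<noteq> j' $ i" by (auto simp: vec_eq_iff)
  then show "block n j \<inter> block n j' = {}"
    using block_nth(3)[of _ n _ i] by (metis disjoint_iff)
qed

text \<open>An index difference of at least h + 1 in one coordinate separates the blocks by at least
  (n+1)(h+1) - n, which is at least h + 1.\<close>

lemma block_distance:
  assumes "x \<in> block n j" "y \<in> block n j'" "int h < \<bar>j $ i - j' $ i\<bar>"
  shows "real (h + 1) \<le> real_of_int (l1_norm (x - y))"
proof -
  have le: "int h + 1 \<le> int (n + 1) * t - int n" if "int h + 1 \<le> t" for t
  proof -
    have "0 \<le> int n * (t - 1)" using that by (intro mult_nonneg_nonneg) auto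
    with that show ?thesis by (simp add: algebra_simps)
  qed
  note x = block_nth(1,2)[OF assms(1), of i] and y = block_nth(1,2)[OF assms(2), of i]
  have "int h + 1 \<le> \<bar>(x - y) $ i\<bar>"
  proof (cases "j' $ i \<le> j $ i")
    case True
    then have "int h + 1 \<le> int (n + 1) * (j $ i - j' $ i) - int n"
      using assms(3) by (intro le) auto
    then show ?thesis using x y by (simp add: right_diff_distrib)
  next
    case False
    then have "int h + 1 \<le> int (n + 1) * (j' $ i - j $ i) - int n"
      using assms(3) by (intro le) auto
    then show ?thesis using x y by (simp add: right_diff_distrib)
  qed
  also have "\<dots> \<le> l1_norm (x - y)" by (rule abs_nth_le_l1_norm)
  finally show ?thesis by linarith
qed

lemma expectation_block: "expectation (information (block n j)) = mean_information n"
proof -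
  have "expectation (information (block n j)) = expectation (\<lambda>\<sigma>. information (cube n) (shift (corner n j) \<sigma>))"
    unfolding block_def
    by (rule arg_cong[where f = expectation], rule ext) (simp add: information_translate)
  also have "\<dots> = mean_information n"
    unfolding mean_information_def
    by (rule expectation_shift, rule local_on_measurable[OF _ local_on_information]) simp
  finally show ?thesis .
qed

text \<open>In the variance, at most (2h+1)^d indices of a row lie within distance h, and each
  contributes at most 4 b^2. The others are controlled by \<open>covariance_le\<close>, whose
  prefactor is \<open>A\<close> when \<open>b\<close> bounds the information of a block. The radius
  h is free and is chosen afterwards.\<close>

lemma prob_block_sum_deviation:
  fixes n :: nat
  defines "b \<equiv> real ((n + 1) ^ CARD('d)) * - ln \<delta>"
  defines "A \<equiv> b ^ 2 * real CARD('a) ^ ((n + 1) ^ CARD('d)) * (real ((n + 1) ^ CARD('d)) * C1)"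
  assumes q: "0 < q" and \<eta>: "0 < \<eta>"
  shows "prob {\<sigma>. \<eta> * real q ^ CARD('d) \<le> \<bar>block_sum n q \<sigma> - real q ^ CARD('d) * mean_information n\<bar>}
    \<le> (real (2 * h + 1) ^ CARD('d) * (4 * b ^ 2) / real q ^ CARD('d) + A * exp (- C2 * real (h + 1))) / \<eta> ^ 2"
proof -
  let ?D = "CARD('d)" and ?J = "block_index q :: (int ^ 'd) set" and ?\<mu> = "mean_information n"
  let ?Y = "\<lambda>j. information (block n j)"
  define Z where "Z = (\<lambda>j \<sigma>. ?Y j \<sigma> - ?\<mu>)"
  have Yb: "\<bar>?Y j \<sigma>\<bar> \<le> b" for j \<sigma>
    using abs_information_le[of "block n j" \<sigma>] by (simp add: card_block b_def)
  have b: "0 \<le> b" using Yb[of undefined undefined] by linarith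
  have intY: "integrable P (?Y j)" for j by (rule integrable_information) simp
  have \<mu>b: "\<bar>?\<mu>\<bar> \<le> b"
  proof -
    have "\<bar>expectation (?Y 0)\<bar> \<le> expectation (\<lambda>\<sigma>. \<bar>?Y 0 \<sigma>\<bar>)"
      by (rule integral_abs_bound)
    also have "\<dots> \<le> b"
      by (rule integral_le_const) (use intY Yb in auto)
    finally show ?thesis by (simp add: expectation_block)
  qed
  have Zb: "\<bar>Z j \<sigma>\<bar> \<le> 2 * b" for j \<sigma>
    using Yb[of j \<sigma>] \<mu>b unfolding Z_def by linarith
  have Zm: "Z j \<in> borel_measurable P" for j
    unfolding Z_def using local_on_measurable[OF finite_block local_on_information] by measurable
  have intYY: "integrable P (\<lambda>\<sigma>. ?Y i \<sigma> * ?Y j \<sigma>)" for i j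
  proof (rule integrable_const_bound[of _ "b * b"])
    have "norm (?Y i \<sigma> * ?Y j \<sigma>) \<le> b * b" for \<sigma>
      unfolding real_norm_def abs_mult by (intro mult_mono Yb b) auto
    then show "AE \<sigma> in P. norm (?Y i \<sigma> * ?Y j \<sigma>) \<le> b * b" by simp
  qed (use local_on_measurable[OF finite_block local_on_information] in measurable)
  have EZ: "expectation (\<lambda>\<sigma>. Z i \<sigma> * Z j \<sigma>) = expectation (\<lambda>\<sigma>. ?Y i \<sigma> * ?Y j \<sigma>) - expectation (?Y i) * expectation (?Y j)" for i j
  proof -
    have "expectation (\<lambda>\<sigma>. Z i \<sigma> * Z j \<sigma>) =
        expectation (\<lambda>\<sigma>. ?Y i \<sigma> * ?Y j \<sigma> - ?\<mu> * ?Y i \<sigma> - ?\<mu> * ?Y j \<sigma> + ?\<mu> * ?\<mu>)"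
      by (intro Bochner_Integration.integral_cong refl) (simp add: Z_def algebra_simps)
    also have "\<dots> = expectation (\<lambda>\<sigma>. ?Y i \<sigma> * ?Y j \<sigma>) - ?\<mu> * ?\<mu>"
      using intY intYY prob_space by (simp add: expectation_block)
    finally show ?thesis by (simp add: expectation_block)
  qed
  have near: "expectation (\<lambda>\<sigma>. Z i \<sigma> * Z j \<sigma>) \<le> 4 * b ^ 2" for i j
  proof (rule integral_le_const)
    have "Z i \<sigma> * Z j \<sigma> \<le> 4 * b ^ 2" for \<sigma>
    proof -
      have "Z i \<sigma> * Z j \<sigma> \<le> \<bar>Z i \<sigma>\<bar> * \<bar>Z j \<sigma>\<bar>" by (simp flip: abs_mult)
      also have "\<dots> \<le> (2 * b) * (2 * b)" by (intro mult_mono Zb) (use b in auto)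
      finally show ?thesis by (simp add: power2_eq_square)
    qed
    then show "AE \<sigma> in P. Z i \<sigma> * Z j \<sigma> \<le> 4 * b ^ 2" by simp
    have "integrable P (\<lambda>\<sigma>. ?Y i \<sigma> * ?Y j \<sigma> - ?\<mu> * ?Y i \<sigma> - ?\<mu> * ?Y j \<sigma> + ?\<mu> * ?\<mu>)"
      using intY intYY by simp
    then show "integrable P (\<lambda>\<sigma>. Z i \<sigma> * Z j \<sigma>)"
      by (simp add: Z_def algebra_simps)
  qed
  have far: "expectation (\<lambda>\<sigma>. Z i \<sigma> * Z j \<sigma>) \<le> A * exp (- C2 * real (h + 1))"
    if "int h < \<bar>i $ l - j $ l\<bar>" for i j l
  proof -
    have "\<bar>expectation (\<lambda>\<sigma>. Z i \<sigma> * Z j \<sigma>)\<bar>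
      \<le> b ^ 2 * real CARD('a) ^ card (block n i) * (real (card (block n i)) * C1 * exp (- C2 * real (h + 1)))"
      unfolding EZ
      by (rule covariance_le[where W = "block n j"])
        (use that in \<open>auto intro: local_on_information Yb block_distance[simplified]\<close>)
    then show ?thesis by (simp add: A_def card_block mult.assoc)
  qed
  have A: "0 \<le> A" using C1 b by (simp add: A_def)
  have row: "(\<Sum>j\<in>?J. expectation (\<lambda>\<sigma>. Z i \<sigma> * Z j \<sigma>))
      \<le> real (2 * h + 1) ^ ?D * (4 * b ^ 2) + real q ^ ?D * (A * exp (- C2 * real (h + 1)))" for i
  proof -
    let ?B = "box_vec (\<lambda>l. {i $ l - int h..i $ l + int h}) :: (int ^ 'd) set"
    have finB: "finite ?B" by auto
    have cardB: "real (card ?B) = real (2 * h + 1) ^ ?D"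
      by (simp add: card_box_vec nat_add_distrib algebra_simps)
    have "(\<Sum>j\<in>?J. expectation (\<lambda>\<sigma>. Z i \<sigma> * Z j \<sigma>)) =
        (\<Sum>j\<in>?J \<inter> ?B. expectation (\<lambda>\<sigma>. Z i \<sigma> * Z j \<sigma>)) + (\<Sum>j\<in>?J - ?B. expectation (\<lambda>\<sigma>. Z i \<sigma> * Z j \<sigma>))"
      using sum.Int_Diff[OF finite_block_index, of "\<lambda>j. expectation (\<lambda>\<sigma>. Z i \<sigma> * Z j \<sigma>)" q ?B] by simp
    also have "(\<Sum>j\<in>?J \<inter> ?B. expectation (\<lambda>\<sigma>. Z i \<sigma> * Z j \<sigma>)) \<le> real (card (?J \<inter> ?B)) * (4 * b ^ 2)"
      by (rule sum_bounded_above) (rule near)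
    also have "\<dots> \<le> real (card ?B) * (4 * b ^ 2)"
      using finB by (intro mult_right_mono of_nat_mono card_mono) auto
    also have "(\<Sum>j\<in>?J - ?B. expectation (\<lambda>\<sigma>. Z i \<sigma> * Z j \<sigma>)) \<le> real (card (?J - ?B)) * (A * exp (- C2 * real (h + 1)))"
    proof (rule sum_bounded_above)
      fix j
      assume "j \<in> ?J - ?B"
      then obtain l where "\<not> (i $ l - int h \<le> j $ l \<and> j $ l \<le> i $ l + int h)"
        by (auto simp: box_vec_def)
      then have "int h < \<bar>i $ l - j $ l\<bar>" by linarith
      then show "expectation (\<lambda>\<sigma>. Z i \<sigma> * Z j \<sigma>) \<le> A * exp (- C2 * real (h + 1))" by (rule far)
    qed
    also have "\<dots> \<le> real (card ?J) * (A * exp (- C2 * real (h + 1)))"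
      using A by (intro mult_right_mono of_nat_mono card_mono) auto
    finally show ?thesis unfolding cardB card_block_index by simp
  qed
  let ?Q = "real q ^ ?D"
  have Q: "0 < ?Q" using q by simp
  have sumZ: "(\<Sum>j\<in>?J. Z j \<sigma>) = block_sum n q \<sigma> - ?Q * ?\<mu>" for \<sigma>
    by (simp add: Z_def sum_subtractf block_sum_def card_block_index)
  have "prob {\<sigma> \<in> space P. \<eta> * ?Q \<le> \<bar>\<Sum>j\<in>?J. Z j \<sigma>\<bar>} \<le>
      (?Q * (real (2 * h + 1) ^ ?D * (4 * b ^ 2) + ?Q * (A * exp (- C2 * real (h + 1))))) / (\<eta> * ?Q) ^ 2"
  proof (rule second_moment_Chebyshev[OF finite_block_index Zm Zb])
    have "(\<Sum>i\<in>?J. \<Sum>j\<in>?J. expectation (\<lambda>\<sigma>. Z i \<sigma> * Z j \<sigma>)) \<le> real (card ?J) *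
        (real (2 * h + 1) ^ ?D * (4 * b ^ 2) + ?Q * (A * exp (- C2 * real (h + 1))))"
      by (rule sum_bounded_above) (rule row)
    then show "(\<Sum>i\<in>?J. \<Sum>j\<in>?J. expectation (\<lambda>\<sigma>. Z i \<sigma> * Z j \<sigma>))
      \<le> ?Q * (real (2 * h + 1) ^ ?D * (4 * b ^ 2) + ?Q * (A * exp (- C2 * real (h + 1))))"
      by (simp add: card_block_index)
  qed (use \<eta> Q in auto)
  also have "\<dots> = (real (2 * h + 1) ^ ?D * (4 * b ^ 2) / ?Q + A * exp (- C2 * real (h + 1))) / \<eta> ^ 2"
  proof -
    have "(Q * (B + Q * E)) / (\<eta> * Q) ^ 2 = (B / Q + E) / \<eta> ^ 2" if "0 < Q" for Q B E :: real
      using that \<eta> by (simp add: field_simps power2_eq_square)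
    from this[OF Q] show ?thesis .
  qed
  finally show ?thesis unfolding sumZ by simp
qed

lemma block_sum_measurable [measurable]: "block_sum n q \<in> borel_measurable P"
  unfolding block_sum_def using local_on_measurable[OF finite_block local_on_information] by measurable

text \<open>With h of order q^(1/(2d)) there are about q^(1/2) near indices per row, and division by
  q^d \<ge> q^2 leaves q^(-3/2); this is where d \<ge> 2 is used. The far term is a stretched
  exponential in q.\<close>

lemma summable_block_sum_deviation:
  assumes \<eta>: "0 < \<eta>"
  shows "summable (\<lambda>q. prob {\<sigma>. \<eta> * real q ^ CARD('d) \<le>
    \<bar>block_sum n q \<sigma> - real q ^ CARD('d) * mean_information n\<bar>})"
proof -
  let ?D = "CARD('d)"
  define b where "b = real ((n + 1) ^ CARD('d)) * - ln \<delta>"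
  define A where "A = b ^ 2 * real CARD('a) ^ ((n + 1) ^ CARD('d)) * (real ((n + 1) ^ CARD('d)) * C1)"
  have A: "0 \<le> A" using C1 by (simp add: A_def)
  \<comment> \<open>Degree 4d is chosen because (h+1)^(2d) > q makes (h+1)^(4d) exceed q^2, hence
    q^(3/2). The bound K then turns the exponential into a multiple of q^(-3/2).\<close>
  have "(\<lambda>x. real x ^ (4 * ?D) * exp (- C2) ^ x) \<longlonglongrightarrow> 0"
    by (rule power_mult_geometric_tendsto_0) (use C2 in auto)
  then have "Bseq (\<lambda>x. real x ^ (4 * ?D) * exp (- C2) ^ x)"
    by (intro convergent_imp_Bseq convergentI)
  then obtain K where K: "0 < K" "\<And>x. norm (real x ^ (4 * ?D) * exp (- C2) ^ x) \<le> K"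
    by (auto elim: BseqE)
  define G where "G = (3 ^ ?D * (4 * b ^ 2) + A * K) / \<eta> ^ 2"
  have main: "prob {\<sigma>. \<eta> * real q ^ ?D \<le> \<bar>block_sum n q \<sigma> - real q ^ ?D * mean_information n\<bar>}
      \<le> G * real q powr (- 3 / 2)" if q: "1 \<le> q" for q
  proof -
    define h where "h = nat \<lfloor>root (2 * ?D) (real q)\<rfloor>"
    have D: "0 < 2 * ?D" by simp
    have h: "real h ^ (2 * ?D) \<le> real q" "real q < real (h + 1) ^ (2 * ?D)" "1 \<le> h"
      using nat_floor_root[OF D, of "real q"] q unfolding h_def by (auto simp del: One_nat_def intro: nat_floor_root(3)[OF D, of _ 1, simplified])
    have q2: "real q ^ 2 \<le> real q ^ ?D" using q dim by (intro power_increasing) auto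
    have "(real h ^ ?D) ^ 2 \<le> real q" using h(1) by (simp add: power_mult[symmetric] mult.commute)
    then have "real h ^ ?D \<le> sqrt (real q)" by (rule real_le_rsqrt)
    then have hD: "real h ^ ?D \<le> real q powr (1 / 2)" using q by (simp add: powr_half_sqrt)
    have "real (2 * h + 1) ^ ?D \<le> (3 * real h) ^ ?D"
      using h(3) by (intro power_mono) auto
    also have "\<dots> \<le> 3 ^ ?D * real q powr (1 / 2)"
      unfolding power_mult_distrib using hD by (intro mult_left_mono) auto
    finally have "real (2 * h + 1) ^ ?D * (4 * b ^ 2) \<le> 3 ^ ?D * real q powr (1 / 2) * (4 * b ^ 2)"
      by (intro mult_right_mono) auto
    then have t1: "real (2 * h + 1) ^ ?D * (4 * b ^ 2) \<le> 3 ^ ?D * (4 * b ^ 2) * real q powr (1 / 2)"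
      by (simp only: ac_simps)
    have "real (2 * h + 1) ^ ?D * (4 * b ^ 2) / real q ^ ?D
        \<le> (3 ^ ?D * (4 * b ^ 2) * real q powr (1 / 2)) / real q ^ 2"
      by (rule frac_le) (use t1 q2 q in auto)
    also have "\<dots> = 3 ^ ?D * (4 * b ^ 2) * (real q powr (1 / 2) / real q powr 2)"
      using q by simp
    also have "real q powr (1 / 2) / real q powr 2 = real q powr (- 3 / 2)"
      by (subst powr_diff[symmetric]) simp
    finally have term1: "real (2 * h + 1) ^ ?D * (4 * b ^ 2) / real q ^ ?D
        \<le> 3 ^ ?D * (4 * b ^ 2) * real q powr (- 3 / 2)" .
    have "real q powr (3 / 2) \<le> real q powr 2" using q by (intro powr_mono) auto
    also have "\<dots> = real q ^ 2" using q by simp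
    also have "\<dots> \<le> (real (h + 1) ^ (2 * ?D)) ^ 2"
      using h(2) by (intro power_mono) auto
    also have "\<dots> = real (h + 1) ^ (4 * ?D)" by (simp add: power_mult[symmetric])
    finally have "real q powr (3 / 2) * exp (- C2) ^ (h + 1) \<le> real (h + 1) ^ (4 * ?D) * exp (- C2) ^ (h + 1)"
      by (intro mult_right_mono) auto
    also have "\<dots> \<le> K" using K(2)[of "h + 1"] by simp
    also have "exp (- C2) ^ (h + 1) = exp (- C2 * real (h + 1))"
      by (simp only: exp_of_nat_mult[symmetric] mult.commute)
    finally have "exp (- C2 * real (h + 1)) \<le> K * real q powr (- 3 / 2)"
      using q by (simp add: powr_minus field_simps)
    then have term2: "A * exp (- C2 * real (h + 1)) \<le> A * K * real q powr (- 3 / 2)"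
      using mult_left_mono[OF _ A] by (simp add: mult.assoc)
    have "prob {\<sigma>. \<eta> * real q ^ ?D \<le> \<bar>block_sum n q \<sigma> - real q ^ ?D * mean_information n\<bar>}
        \<le> (real (2 * h + 1) ^ ?D * (4 * b ^ 2) / real q ^ ?D + A * exp (- C2 * real (h + 1))) / \<eta> ^ 2"
      unfolding A_def b_def by (rule prob_block_sum_deviation) (use q \<eta> in auto)
    also have "\<dots> \<le> (3 ^ ?D * (4 * b ^ 2) * real q powr (- 3 / 2) + A * K * real q powr (- 3 / 2)) / \<eta> ^ 2"
      by (intro divide_right_mono add_mono term1 term2) auto
    also have "\<dots> = G * real q powr (- 3 / 2)"
      by (simp add: G_def distrib_right)
    finally show ?thesis .
  qed
  show ?thesis
  proof (rule summable_comparison_test_ev)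
    show "summable (\<lambda>q. G * real q powr (- 3 / 2))"
      by (intro summable_mult) (simp add: summable_real_powr_iff)
    show "\<forall>\<^sub>F q in sequentially. norm (prob {\<sigma>. \<eta> * real q ^ ?D \<le>
      \<bar>block_sum n q \<sigma> - real q ^ ?D * mean_information n\<bar>}) \<le> G * real q powr (- 3 / 2)"
      using eventually_ge_at_top[of 1] by eventually_elim (use main in auto)
  qed
qed

text \<open>Borel-Cantelli for the countably many tolerances 1/(m+1), with the block size n
  fixed.\<close>

lemma AE_block_average:
  "AE \<sigma> in P. (\<lambda>q. block_sum n q \<sigma> / real q ^ CARD('d)) \<longlonglongrightarrow> mean_information n"
proof -
  let ?D = "CARD('d)"
  have "AE \<sigma> in P. \<forall>\<^sub>F q in sequentially.
      \<bar>block_sum n q \<sigma> - real q ^ ?D * mean_information n\<bar> < 1 / real (Suc m) * real q ^ ?D" for m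
  proof -
    have "AE \<sigma> in P. \<forall>\<^sub>F q in sequentially. \<sigma> \<in> space P - {\<sigma> \<in> space P. 1 / real (Suc m) * real q ^ ?D \<le>
      \<bar>block_sum n q \<sigma> - real q ^ ?D * mean_information n\<bar>}"
    proof (rule borel_cantelli_AE1)
      show "{\<sigma> \<in> space P. 1 / real (Suc m) * real q ^ ?D \<le>
        \<bar>block_sum n q \<sigma> - real q ^ ?D * mean_information n\<bar>} \<in> events" for q
        by measurable
      show "summable (\<lambda>q. prob {\<sigma> \<in> space P. 1 / real (Suc m) * real q ^ ?D \<le>
        \<bar>block_sum n q \<sigma> - real q ^ ?D * mean_information n\<bar>})"
        using summable_block_sum_deviation[of "1 / real (Suc m)" n] by simp
    qed (simp add: emeasure_eq_measure)
    then show ?thesis by (simp add: not_le)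
  qed
  then have "AE \<sigma> in P. \<forall>m. \<forall>\<^sub>F q in sequentially.
      \<bar>block_sum n q \<sigma> - real q ^ ?D * mean_information n\<bar> < 1 / real (Suc m) * real q ^ ?D"
    by (simp add: AE_all_countable)
  then show ?thesis
  proof eventually_elim
    case (elim \<sigma>)
    show ?case
    proof (rule tendstoI)
      fix e :: real
      assume "0 < e"
      then obtain m where m: "1 / real (Suc m) < e"
        using nat_approx_posE by blast
      show "\<forall>\<^sub>F q in sequentially. dist (block_sum n q \<sigma> / real q ^ ?D) (mean_information n) < e"
        using elim[rule_format, of m] eventually_gt_at_top[of 0]
      proof eventually_elim
        case (elim q)
        let ?Q = "real q ^ ?D"
        have Q: "0 < ?Q" using elim by simp
        have "block_sum n q \<sigma> / ?Q - mean_information n = (block_sum n q \<sigma> - ?Q * mean_information n) / ?Q"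
          using Q by (simp add: field_simps)
        then have "dist (block_sum n q \<sigma> / ?Q) (mean_information n) = \<bar>block_sum n q \<sigma> - ?Q * mean_information n\<bar> / ?Q"
          using Q by (simp add: dist_real_def)
        also have "\<dots> < 1 / real (Suc m)"
          using elim(1) Q by (simp only: pos_divide_less_eq)
        finally show ?case using m by linarith
      qed
    qed
  qed
qed

end

text \<open>Two indices n and n' are compared with the same a N, which makes m Cauchy although no
  convergence of m is assumed. The limit depends only on m, so two sequences compared with the same
  m share it: this identifies the almost sure limit with that of the means.\<close>

lemma approximate_limits:
  fixes m \<eta> :: "nat \<Rightarrow> real"
  assumes \<eta>: "\<eta> \<longlonglongrightarrow> 0"
    and a: "\<And>n e. 0 < e \<Longrightarrow> \<forall>\<^sub>F N in sequentially. \<bar>a N - m n\<bar> \<le> \<eta> n + e"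
  shows "convergent m" "a \<longlonglongrightarrow> lim m"
proof -
  have diff: "\<bar>m n - m n'\<bar> \<le> \<eta> n + \<eta> n'" for n n'
  proof (rule field_le_epsilon)
    fix e :: real
    assume "0 < e"
    then have "\<forall>\<^sub>F N in sequentially. \<bar>a N - m n\<bar> \<le> \<eta> n + e / 2 \<and> \<bar>a N - m n'\<bar> \<le> \<eta> n' + e / 2"
      by (intro eventually_conj a) auto
    then obtain N where "\<bar>a N - m n\<bar> \<le> \<eta> n + e / 2" "\<bar>a N - m n'\<bar> \<le> \<eta> n' + e / 2"
      using eventually_happens'[OF sequentially_bot] by blast
    then show "\<bar>m n - m n'\<bar> \<le> \<eta> n + \<eta> n' + e" by linarith
  qed
  have "Cauchy m"
  proof (rule CauchyI)
    fix e :: real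
    assume "0 < e"
    then obtain N where "\<And>n. N \<le> n \<Longrightarrow> \<bar>\<eta> n\<bar> < e / 2"
      using LIMSEQ_D[OF \<eta>, of "e / 2"] by auto
    then have "norm (m n - m n') < e" if "N \<le> n" "N \<le> n'" for n n'
      using diff[of n n'] that by (smt (verit) field_sum_of_halves real_norm_def)
    then show "\<exists>N. \<forall>n\<ge>N. \<forall>n'\<ge>N. norm (m n - m n') < e" by blast
  qed
  then show conv: "convergent m" by (simp add: Cauchy_convergent_iff)
  then have m: "m \<longlonglongrightarrow> lim m" by (simp add: convergent_LIMSEQ_iff)
  show "a \<longlonglongrightarrow> lim m"
  proof (rule tendstoI)
    fix e :: real
    assume e: "0 < e"
    have "\<forall>\<^sub>F n in sequentially. dist (m n) (lim m) < e / 3 \<and> dist (\<eta> n) 0 < e / 3"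
      using e by (intro eventually_conj tendstoD[OF m] tendstoD[OF \<eta>]) auto
    then obtain n where n: "\<bar>m n - lim m\<bar> < e / 3" "\<bar>\<eta> n\<bar> < e / 3"
      using eventually_happens'[OF sequentially_bot] by (fastforce simp: dist_real_def)
    have "\<forall>\<^sub>F N in sequentially. \<bar>a N - m n\<bar> \<le> \<eta> n + e / 3"
      using e by (intro a) auto
    then show "\<forall>\<^sub>F N in sequentially. dist (a N) (lim m) < e"
      by eventually_elim (use n in \<open>unfold dist_real_def, linarith\<close>)
  qed
qed

lemma tendsto_div_ratio:
  assumes "0 < L"
  shows "(\<lambda>N. real ((N + 1) div L) / real N) \<longlonglongrightarrow> 1 / real L"
proof (rule real_tendsto_sandwich)
  have *: "real (N + 1) / real L - 1 \<le> real ((N + 1) div L)" "real ((N + 1) div L) \<le> real (N + 1) / real L" for N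
    using floor_divide_of_nat_eq[of "N + 1" L, where 'a = real] by linarith+
  show "\<forall>\<^sub>F N in sequentially. (real (N + 1) / real L - 1) / real N \<le> real ((N + 1) div L) / real N"
    by (intro always_eventually allI divide_right_mono *) simp
  show "\<forall>\<^sub>F N in sequentially. real ((N + 1) div L) / real N \<le> (real (N + 1) / real L) / real N"
    by (intro always_eventually allI divide_right_mono *) simp
  show "(\<lambda>N. (real (N + 1) / real L - 1) / real N) \<longlonglongrightarrow> 1 / real L"
    using assms by real_asymp (simp add: inverse_eq_divide)
  show "(\<lambda>N. (real (N + 1) / real L) / real N) \<longlonglongrightarrow> 1 / real L"
    using assms by real_asymp (simp add: inverse_eq_divide)
qed

section \<open>Comparison of a large cube with its tiling, and the specific entropy\<close>

context mixing_gibbs_field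
begin

text \<open>Factorization cost of the blocks that fit, plus finite-energy cost of the uncovered
  sites. Divided by N^d with n fixed, the second part vanishes in the limit and c n / (n+1)^d
  remains.\<close>

definition tiling_error :: "nat \<Rightarrow> nat \<Rightarrow> real" where
  "tiling_error n N = real ((N + 1) div (n + 1)) ^ CARD('d) * c n +
     (real (N + 1) ^ CARD('d) - real ((N + 1) div (n + 1)) ^ CARD('d) * real (n + 1) ^ CARD('d)) * - ln \<delta>"

lemma abs_information_cube_le:
  "\<bar>information (cube N) \<sigma> - block_sum n ((N + 1) div (n + 1)) \<sigma>\<bar> \<le> tiling_error n N"
proof -
  define q where "q = (N + 1) div (n + 1)"
  let ?W = "\<Union>j\<in>block_index q. block n j"
  have "(n + 1) * q \<le> N + 1" unfolding q_def by (rule times_div_less_eq_dividend)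
  then have qN: "int (n + 1) * int q \<le> int N + 1"
    by (metis of_nat_1 of_nat_add of_nat_le_iff of_nat_mult)
  have sub: "?W \<subseteq> cube N"
  proof
    fix x
    assume "x \<in> ?W"
    then obtain j where j: "j \<in> block_index q" "x \<in> block n j" by blast
    have "0 \<le> x $ i \<and> x $ i \<le> int N" for i
    proof -
      have ji: "0 \<le> j $ i" "j $ i \<le> int q - 1" using j(1) by (auto simp: block_index_def box_vec_def)
      have "int (n + 1) * j $ i \<le> int (n + 1) * (int q - 1)" using ji by (intro mult_left_mono) auto
      also have "\<dots> \<le> int N - int n" using qN by (simp add: algebra_simps)
      finally have "int (n + 1) * j $ i \<le> int N - int n" .
      moreover have "0 \<le> int (n + 1) * j $ i" using ji by (intro mult_nonneg_nonneg) auto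
      ultimately show ?thesis using block_nth(1,2)[OF j(2), of i] by linarith
    qed
    then show "x \<in> cube N" by (simp add: cube_def)
  qed
  have "card ?W = (\<Sum>j\<in>block_index q. card (block n j))"
    by (rule card_UN_disjoint) (use disjoint_blocks[of n UNIV] in \<open>auto simp: disjoint_family_on_def\<close>)
  also have "\<dots> = q ^ CARD('d) * (n + 1) ^ CARD('d)"
    by (simp add: card_block card_block_index)
  finally have cardW: "real (card ?W) = real q ^ CARD('d) * real (n + 1) ^ CARD('d)"
    by (metis of_nat_mult of_nat_power)
  have "\<bar>information (cube N) \<sigma> - information ?W \<sigma>\<bar>
      \<le> (real (N + 1) ^ CARD('d) - real q ^ CARD('d) * real (n + 1) ^ CARD('d)) * - ln \<delta>"
    using information_superset[OF finite_cube sub, of \<sigma>] unfolding cardW card_cube by simp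
  moreover have "\<bar>information ?W \<sigma> - block_sum n q \<sigma>\<bar> \<le> real q ^ CARD('d) * c n"
    using information_blocks[OF finite_block_index, of "corner n" n q \<sigma>] disjoint_blocks[of n "block_index q"]
    unfolding block_sum_def block_def card_block_index by simp
  ultimately show ?thesis unfolding tiling_error_def q_def[symmetric] by linarith
qed

lemma tendsto_tiling_ratio:
  "(\<lambda>N. real ((N + 1) div (n + 1)) ^ CARD('d) / real N ^ CARD('d)) \<longlonglongrightarrow> 1 / real (n + 1) ^ CARD('d)"
proof -
  have "(\<lambda>N. (real ((N + 1) div (n + 1)) / real N) ^ CARD('d)) \<longlonglongrightarrow> (1 / real (n + 1)) ^ CARD('d)"
    by (intro tendsto_power tendsto_div_ratio) simp
  then show ?thesis by (simp only: power_divide power_one)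
qed

lemma tendsto_tiling_error:
  "(\<lambda>N. tiling_error n N / real N ^ CARD('d)) \<longlonglongrightarrow> c n / real (n + 1) ^ CARD('d)"
proof -
  let ?D = "CARD('d)"
  let ?r = "\<lambda>N. real ((N + 1) div (n + 1)) ^ ?D / real N ^ ?D"
  have "(\<lambda>N. real (N + 1) / real N) \<longlonglongrightarrow> 1" by real_asymp
  then have "(\<lambda>N. ?r N * c n + ((real (N + 1) / real N) ^ ?D - ?r N * real (n + 1) ^ ?D) * - ln \<delta>)
      \<longlonglongrightarrow> 1 / real (n + 1) ^ ?D * c n + (1 ^ ?D - 1 / real (n + 1) ^ ?D * real (n + 1) ^ ?D) * - ln \<delta>"
    by (intro tendsto_intros tendsto_tiling_ratio)
  moreover have "1 / real (n + 1) ^ ?D * c n + (1 ^ ?D - 1 / real (n + 1) ^ ?D * real (n + 1) ^ ?D) * - ln \<delta>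
      = c n / real (n + 1) ^ ?D"
  proof -
    have "1 / z * x + (1 ^ ?D - 1 / z * z) * - y = x / z" if "z \<noteq> 0" for x y z :: real
      using that by simp
    then show ?thesis by simp
  qed
  moreover have "?r N * c n + ((real (N + 1) / real N) ^ ?D - ?r N * real (n + 1) ^ ?D) * - ln \<delta>
      = tiling_error n N / real N ^ ?D" for N
    unfolding tiling_error_def power_divide
    by (simp only: times_divide_eq_left diff_divide_distrib[symmetric] add_divide_distrib[symmetric])
  ultimately show ?thesis by simp
qed

lemma expectation_block_sum: "expectation (block_sum n q) = real q ^ CARD('d) * mean_information n"
proof -
  have "expectation (block_sum n q) = (\<Sum>j\<in>block_index q. expectation (information (block n j)))"
    unfolding block_sum_def[abs_def]
    by (rule Bochner_Integration.integral_sum) (simp add: integrable_information)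
  then show ?thesis by (simp add: expectation_block card_block_index)
qed

lemma abs_mean_information_le:
  "\<bar>mean_information N - real ((N + 1) div (n + 1)) ^ CARD('d) * mean_information n\<bar> \<le> tiling_error n N"
proof -
  let ?f = "\<lambda>\<sigma>. information (cube N) \<sigma> - block_sum n ((N + 1) div (n + 1)) \<sigma>"
  have intB: "integrable P (block_sum n q)" for q
    unfolding block_sum_def[abs_def]
    by (intro Bochner_Integration.integrable_sum integrable_information) simp
  have intC: "integrable P (information (cube N))" by (rule integrable_information) simp
  have "mean_information N - real ((N + 1) div (n + 1)) ^ CARD('d) * mean_information n = expectation ?f"
    unfolding expectation_block_sum[symmetric] mean_information_def[of N]
    by (rule Bochner_Integration.integral_diff[symmetric]) (rule intC intB)+
  also have "\<bar>\<dots>\<bar> \<le> expectation (\<lambda>\<sigma>. \<bar>?f \<sigma>\<bar>)"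
    by (rule integral_abs_bound)
  also have "\<dots> \<le> tiling_error n N"
  proof (rule integral_le_const)
    show "integrable P (\<lambda>\<sigma>. \<bar>?f \<sigma>\<bar>)"
      by (intro integrable_abs Bochner_Integration.integrable_diff intC intB)
  qed (simp only: abs_information_cube_le eventually_True)
  finally show ?thesis .
qed

text \<open>\<open>a\<close> and \<open>B\<close> are kept abstract because the comparison is
  applied both to the means and, configuration by configuration, to the information itself.\<close>

lemma eventually_near_block_rate:
  assumes a: "\<And>N. \<bar>a N - B ((N + 1) div (n + 1))\<bar> \<le> tiling_error n N"
    and B: "(\<lambda>q. B q / real q ^ CARD('d)) \<longlonglongrightarrow> \<mu>" and e: "0 < e"
  shows "\<forall>\<^sub>F N in sequentially. \<bar>a N / real N ^ CARD('d) - \<mu> / real (n + 1) ^ CARD('d)\<bar>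
    \<le> c n / real (n + 1) ^ CARD('d) + e"
proof -
  let ?D = "CARD('d)" and ?q = "\<lambda>N. (N + 1) div (n + 1)"
  have fq: "filterlim ?q sequentially sequentially"
    unfolding filterlim_at_top
  proof
    fix Z
    show "\<forall>\<^sub>F N in sequentially. Z \<le> ?q N"
    proof (rule eventually_sequentiallyI)
      fix N
      assume "Z * (n + 1) \<le> N"
      have "Z = Z * (n + 1) div (n + 1)" by (rule nonzero_mult_div_cancel_right[symmetric]) simp
      also have "\<dots> \<le> ?q N" using \<open>Z * (n + 1) \<le> N\<close> by (intro div_le_mono) simp
      finally show "Z \<le> ?q N" .
    qed
  qed
  have "(\<lambda>N. B (?q N) / real (?q N) ^ ?D * (real (?q N) ^ ?D / real N ^ ?D)) \<longlonglongrightarrow> \<mu> * (1 / real (n + 1) ^ ?D)"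
    by (intro tendsto_mult tendsto_tiling_ratio filterlim_compose[OF B fq])
  moreover have "\<forall>\<^sub>F N in sequentially.
      B (?q N) / real (?q N) ^ ?D * (real (?q N) ^ ?D / real N ^ ?D) = B (?q N) / real N ^ ?D"
  proof -
    have "\<forall>\<^sub>F N in sequentially. 1 \<le> ?q N" using fq unfolding filterlim_at_top by blast
    then show ?thesis by eventually_elim simp
  qed
  ultimately have l: "(\<lambda>N. B (?q N) / real N ^ ?D) \<longlonglongrightarrow> \<mu> / real (n + 1) ^ ?D"
    by (simp add: Lim_transform_eventually)
  have "\<forall>\<^sub>F N in sequentially. dist (B (?q N) / real N ^ ?D) (\<mu> / real (n + 1) ^ ?D) < e / 2"
    using e by (intro tendstoD[OF l]) simp
  moreover have "\<forall>\<^sub>F N in sequentially. dist (tiling_error n N / real N ^ ?D) (c n / real (n + 1) ^ ?D) < e / 2"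
    using e by (intro tendstoD[OF tendsto_tiling_error]) simp
  ultimately show ?thesis
    using eventually_gt_at_top[of 0]
  proof eventually_elim
    case (elim N)
    have "\<bar>a N / real N ^ ?D - B (?q N) / real N ^ ?D\<bar> = \<bar>a N - B (?q N)\<bar> / real N ^ ?D"
      using elim(3) by (simp flip: diff_divide_distrib)
    also have "\<dots> \<le> tiling_error n N / real N ^ ?D"
      by (intro divide_right_mono a) simp
    finally show ?case using elim(1,2) unfolding dist_real_def by linarith
  qed
qed

text \<open>\<open>approximate_limits\<close> is applied twice with the same block rates
  \<open>?m\<close>: to the mean information, which makes the \<open>lim\<close> in
  \<open>specific_entropy\<close> a genuine limit, and to the information of almost every
  configuration.\<close>

lemma Shannon_McMillan_Breiman:
  "AE \<sigma> in P. (\<lambda>N. - information (cube N) \<sigma> / real N ^ CARD('d)) \<longlonglongrightarrow> specific_entropy P"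
proof -
  let ?D = "CARD('d)"
  let ?m = "\<lambda>n. mean_information n / real (n + 1) ^ ?D"
  have "(\<lambda>q. real q ^ ?D * mean_information n / real q ^ ?D) \<longlonglongrightarrow> mean_information n" for n
    by (rule Lim_transform_eventually[OF tendsto_const])
      (use eventually_gt_at_top[of 0] in eventually_elim, simp)
  from eventually_near_block_rate[OF abs_mean_information_le this]
  have mean: "(\<lambda>N. mean_information N / real N ^ ?D) \<longlonglongrightarrow> lim ?m"
    by (intro approximate_limits(2)[OF c_limit]) simp
  have "mean_information N = (\<Sum>p\<in>cube N \<rightarrow>\<^sub>E UNIV.
      prob (cylinder (cube N) p) * ln (prob (cylinder (cube N) p)))" for N
    unfolding mean_information_def local_on_expectation[OF finite_cube local_on_information]
    by (intro sum.cong refl) (simp add: information_def cylinder_eq_agree)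
  then have "specific_entropy P = lim (\<lambda>N. - (mean_information N / real N ^ ?D))"
    unfolding specific_entropy_def by simp
  also have "\<dots> = - lim ?m"
    by (intro limI tendsto_minus mean)
  finally have s: "specific_entropy P = - lim ?m" .
  have "AE \<sigma> in P. \<forall>n. (\<lambda>q. block_sum n q \<sigma> / real q ^ ?D) \<longlonglongrightarrow> mean_information n"
    by (simp add: AE_all_countable AE_block_average)
  then show ?thesis
  proof eventually_elim
    case (elim \<sigma>)
    have "(\<lambda>N. information (cube N) \<sigma> / real N ^ ?D) \<longlonglongrightarrow> lim ?m"
      by (intro approximate_limits(2)[OF c_limit] eventually_near_block_rate[OF abs_information_cube_le])
        (use elim in auto)
    from tendsto_minus[OF this] show ?case unfolding s by simp
  qed
qed

end

subsection \<open>The first repetition\<close>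

lemma restrict_eq_iff_agree: "restrict \<tau> V = restrict \<sigma> V \<longleftrightarrow> \<tau> \<in> agree V \<sigma>"
  by (auto simp: agree_def restrict_def fun_eq_iff)

context mixing_gibbs_field
begin

text \<open>Outside \<open>too_late\<close> a repetition exists within \<open>search_range\<close>,
  so the \<open>LEAST\<close> is attained and bounded above. Were the attained value too small, it
  would itself witness \<open>too_early\<close>.\<close>

lemma first_repetition_bounds:
  assumes early: "\<sigma> \<notin> too_early \<epsilon> n" and late: "\<sigma> \<notin> too_late \<epsilon> n" and n: "3 \<le> n" and \<epsilon>: "1 \<le> \<epsilon>"
  defines "r \<equiv> first_repetition n \<sigma>"
  shows "0 < r" "real n powr - \<epsilon> \<le> real r ^ CARD('d) * prob (agree (cube n) \<sigma>)"
    "real r ^ CARD('d) * prob (agree (cube n) \<sigma>) \<le> \<epsilon> * ln (real n)"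
proof -
  let ?P = "prob (agree (cube n) \<sigma>)"
  let ?R = "\<lambda>k. \<exists>x :: int ^ 'd. l1_norm x > 0 \<and> (\<forall>i. 0 \<le> x $ i \<and> x $ i \<le> int k) \<and>
     restrict (shift x \<sigma>) (cube n) = restrict \<sigma> (cube n)"
  let ?k = "search_range \<epsilon> n \<sigma>"
  have R: "?R ?k"
    using late unfolding too_late_def restrict_eq_iff_agree l1_norm_pos_iff by blast
  have "?R r" unfolding r_def first_repetition_def by (rule LeastI[of ?R, OF R])
  then obtain x where x: "x \<noteq> 0" "\<forall>i. 0 \<le> x $ i \<and> x $ i \<le> int r" "shift x \<sigma> \<in> agree (cube n) \<sigma>"
    unfolding restrict_eq_iff_agree l1_norm_pos_iff by blast
  show "0 < r"
  proof (rule ccontr)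
    assume "\<not> 0 < r"
    then have "x $ i = 0" for i using spec[OF x(2), of i] by simp
    then have "x = 0" by (simp add: vec_eq_iff)
    with x(1) show False by contradiction
  qed
  show "real n powr - \<epsilon> \<le> real r ^ CARD('d) * ?P"
  proof (rule ccontr)
    assume "\<not> ?thesis"
    then have "\<sigma> \<in> too_early \<epsilon> n"
      unfolding too_early_def mem_Collect_eq by (intro exI[of _ x] exI[of _ r] conjI x) simp
    with early show False by contradiction
  qed
  have "0 \<le> \<epsilon> * ln (real n) / ?P" using one_le_ln[OF n] \<epsilon> by simp
  then have "real ?k ^ CARD('d) \<le> \<epsilon> * ln (real n) / ?P"
    unfolding search_range_def by (intro nat_floor_root) auto
  moreover have "r \<le> ?k" unfolding r_def first_repetition_def by (rule Least_le[of ?R, OF R])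
  then have "real r ^ CARD('d) \<le> real ?k ^ CARD('d)" by (intro power_mono) auto
  ultimately have "real r ^ CARD('d) \<le> \<epsilon> * ln (real n) / ?P" by linarith
  then show "real r ^ CARD('d) * ?P \<le> \<epsilon> * ln (real n)"
    by (simp only: pos_le_divide_eq[OF prob_agree_pos[OF finite_cube]])
qed

text \<open>Positivity of the first repetition is carried along because the logarithm of the product
  is later split into a sum.\<close>

lemma AE_first_repetition_bounds:
  assumes \<epsilon>: "2 * slab_factor \<le> \<epsilon>"
  shows "AE \<sigma> in P. \<forall>\<^sub>F n in sequentially. 0 < first_repetition n \<sigma> \<and>
    - \<epsilon> * ln (real n) \<le> ln (real (first_repetition n \<sigma>) ^ CARD('d) * prob (agree (cube n) \<sigma>)) \<and>
    ln (real (first_repetition n \<sigma>) ^ CARD('d) * prob (agree (cube n) \<sigma>)) \<le> ln (ln (real n powr \<epsilon>))"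
proof -
  have \<epsilon>1: "1 < \<epsilon>" using \<epsilon> slab_factor_ge_1 by linarith
  show ?thesis
    using AE_not_too_early[OF \<epsilon>1] AE_not_too_late[OF \<epsilon>]
  proof eventually_elim
    case (elim \<sigma>)
    then show ?case
      using eventually_ge_at_top[of 3]
    proof eventually_elim
      case (elim n)
      let ?q = "real (first_repetition n \<sigma>) ^ CARD('d) * prob (agree (cube n) \<sigma>)"
      note b = first_repetition_bounds[OF elim less_imp_le[OF \<epsilon>1]]
      have q: "0 < ?q" using b(1) by simp
      have n: "0 < real n" using elim(3) by simp
      have "ln (real n powr - \<epsilon>) \<le> ln ?q"
        using b(2) n by (intro ln_mono) auto
      moreover have "ln ?q \<le> ln (\<epsilon> * ln (real n))"
        using b(3) q by (intro ln_mono) auto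
      ultimately show ?case using n b(1) by (simp add: ln_powr)
    qed
  qed
qed

text \<open>The sum of d ln r and the information lies between -\<epsilon> ln n and ln (\<epsilon>
  ln n), hence is o(n^d); the limit is therefore that of minus the information divided by
  n^d.\<close>

lemma AE_first_repetition_entropy:
  "AE \<sigma> in P. (\<lambda>n. real CARD('d) / real n ^ CARD('d) * ln (real (first_repetition n \<sigma>)))
     \<longlonglongrightarrow> specific_entropy P"
proof -
  let ?D = "CARD('d)"
  define \<epsilon> where "\<epsilon> = 2 * slab_factor"
  have \<epsilon>: "1 < \<epsilon>" using slab_factor_ge_1 by (simp add: \<epsilon>_def)
  have bounds: "AE \<sigma> in P. \<forall>\<^sub>F n in sequentially. 0 < first_repetition n \<sigma> \<and>
    - \<epsilon> * ln (real n) \<le> ln (real (first_repetition n \<sigma>) ^ ?D * prob (agree (cube n) \<sigma>)) \<and>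
    ln (real (first_repetition n \<sigma>) ^ ?D * prob (agree (cube n) \<sigma>)) \<le> ln (ln (real n powr \<epsilon>))"
    by (rule AE_first_repetition_bounds) (simp add: \<epsilon>_def)
  show ?thesis
    using bounds Shannon_McMillan_Breiman
  proof eventually_elim
    case (elim \<sigma>)
    let ?u = "\<lambda>n. ln (real (first_repetition n \<sigma>) ^ ?D * prob (agree (cube n) \<sigma>)) / real n ^ ?D"
    have "(\<lambda>n. \<epsilon> * ln (real n) / real n) \<longlonglongrightarrow> 0"
      using \<epsilon> by real_asymp
    then have "?u \<longlonglongrightarrow> 0"
    proof (rule Lim_null_comparison[rotated])
      show "\<forall>\<^sub>F n in sequentially. norm (?u n) \<le> \<epsilon> * ln (real n) / real n"
        using elim(1) eventually_ge_at_top[of 3]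
      proof eventually_elim
        case (elim n)
        have l: "1 \<le> ln (real n)" using elim(2) by (rule one_le_ln)
        have "ln (ln (real n powr \<epsilon>)) \<le> \<epsilon> * ln (real n)"
          using l \<epsilon> ln_le_minus_one[of "\<epsilon> * ln (real n)"] elim(2) by (simp add: ln_powr)
        then have "\<bar>ln (real (first_repetition n \<sigma>) ^ ?D * prob (agree (cube n) \<sigma>))\<bar> \<le> \<epsilon> * ln (real n)"
          using elim(1) by linarith
        then have "norm (?u n) \<le> \<epsilon> * ln (real n) / real n ^ ?D"
          by (simp add: divide_right_mono)
        also have "real n \<le> real n ^ ?D" using elim(2) dim by (intro self_le_power) auto
        then have "\<epsilon> * ln (real n) / real n ^ ?D \<le> \<epsilon> * ln (real n) / real n"
          using l \<epsilon> elim(2) by (intro divide_left_mono mult_nonneg_nonneg mult_pos_pos) auto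
        finally show ?case .
      qed
    qed
    from tendsto_add[OF this elim(2)]
    have "(\<lambda>n. ?u n + - information (cube n) \<sigma> / real n ^ ?D) \<longlonglongrightarrow> specific_entropy P"
      by simp
    moreover have "\<forall>\<^sub>F n in sequentially. ?u n + - information (cube n) \<sigma> / real n ^ ?D =
        real ?D / real n ^ ?D * ln (real (first_repetition n \<sigma>))"
      using elim(1)
    proof eventually_elim
      case (elim n)
      then have r: "0 < real (first_repetition n \<sigma>)" by simp
      have "ln (real (first_repetition n \<sigma>) ^ ?D * prob (agree (cube n) \<sigma>)) =
          real ?D * ln (real (first_repetition n \<sigma>)) + information (cube n) \<sigma>"
        using r by (simp add: ln_mult ln_realpow information_def)
      then show ?case by (simp add: add_divide_distrib)
    qed
    ultimately show ?case by (rule Lim_transform_eventually)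
  qed
qed

end

section \<open>The one-letter alphabet and the conclusion\<close>

lemma first_repetition_one_letter:
  fixes \<sigma> :: "('d::finite, 'a) config"
  assumes "\<And>a b :: 'a. a = b"
  shows "first_repetition n \<sigma> = 1"
  unfolding first_repetition_def
proof (rule Least_equality)
  have "shift x \<sigma> = \<sigma>" for x using assms by blast
  moreover have "\<exists>x :: int ^ 'd. 0 < l1_norm x \<and> (\<forall>i. 0 \<le> x $ i \<and> x $ i \<le> int 1)"
    by (rule exI[of _ "\<chi> i. 1"]) (auto simp: l1_norm_def)
  ultimately show "\<exists>x :: int ^ 'd. 0 < l1_norm x \<and> (\<forall>i. 0 \<le> x $ i \<and> x $ i \<le> int 1) \<and>
      restrict (shift x \<sigma>) (cube n) = restrict \<sigma> (cube n)"
    by auto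
next
  fix k
  assume "\<exists>x :: int ^ 'd. 0 < l1_norm x \<and> (\<forall>i. 0 \<le> x $ i \<and> x $ i \<le> int k) \<and>
      restrict (shift x \<sigma>) (cube n) = restrict \<sigma> (cube n)"
  then obtain x :: "int ^ 'd" where x: "x \<noteq> 0" "\<forall>i. 0 \<le> x $ i \<and> x $ i \<le> int k"
    unfolding l1_norm_pos_iff by blast
  show "1 \<le> k"
  proof (rule ccontr)
    assume "\<not> 1 \<le> k"
    then have "x $ i = 0" for i using spec[OF x(2), of i] by simp
    then have "x = 0" by (simp add: vec_eq_iff)
    with x(1) show False by contradiction
  qed
qed

lemma measure_cylinder_one_letter:
  fixes P :: "('d::finite, 'a::finite) config measure"
  assumes "\<And>a b :: 'a. a = b" "prob_space P" "space P = UNIV" "p \<in> V \<rightarrow>\<^sub>E UNIV"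
  shows "measure P (cylinder V p) = 1"
proof -
  have "cylinder V p = space P"
    unfolding cylinder_eq_agree[OF assms(4)] assms(3) using assms(1) by (auto simp: agree_def)
  then show ?thesis using prob_space.prob_space[OF assms(2)] by simp
qed

theorem theorem3:
  fixes U :: "(int ^ 'd::finite) set \<Rightarrow> ('d, 'a::finite) config \<Rightarrow> real"
    and P :: "('d, 'a) config measure"
  assumes dim: "CARD('d) \<ge> 2"
    and gibbs: "translation_invariant_gibbs U P"
    and mixing: "exponentially_phi_mixing P"
  shows "(\<exists>\<epsilon>0>0. \<forall>\<epsilon>>\<epsilon>0. AE \<sigma> in P. \<forall>\<^sub>F n in sequentially.
            - \<epsilon> * ln (real n)
              \<le> ln (real (first_repetition n \<sigma>) ^ CARD('d) *
                    measure P (cylinder (cube n) (restrict \<sigma> (cube n)))) \<and>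
            ln (real (first_repetition n \<sigma>) ^ CARD('d) *
                measure P (cylinder (cube n) (restrict \<sigma> (cube n))))
              \<le> ln (ln (real n powr \<epsilon>))) \<and>
         (AE \<sigma> in P. (\<lambda>n. real CARD('d) / real n ^ CARD('d) * ln (real (first_repetition n \<sigma>)))
            \<longlonglongrightarrow> specific_entropy P)"
\<comment> \<open>With one letter every pattern has probability 1, so prescribing a spin costs
  nothing and \<open>energy_upper\<close> fails for every positive \<delta>.\<close>
proof (cases "2 \<le> CARD('a)")
  case True
  obtain \<delta> C1 C2 c where "mixing_gibbs_field P \<delta> C1 C2 c"
    using mixing_gibbs_fieldI[OF dim gibbs mixing True] by blast
  then interpret mixing_gibbs_field P \<delta> C1 C2 c .
  show ?thesis
  proof (intro conjI exI[of _ "2 * slab_factor"] allI impI)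
    show "0 < 2 * slab_factor" using slab_factor_ge_1 by linarith
    fix \<epsilon>
    assume "2 * slab_factor < \<epsilon>"
    then show "AE \<sigma> in P. \<forall>\<^sub>F n in sequentially.
            - \<epsilon> * ln (real n)
              \<le> ln (real (first_repetition n \<sigma>) ^ CARD('d) *
                    measure P (cylinder (cube n) (restrict \<sigma> (cube n)))) \<and>
            ln (real (first_repetition n \<sigma>) ^ CARD('d) *
                measure P (cylinder (cube n) (restrict \<sigma> (cube n))))
              \<le> ln (ln (real n powr \<epsilon>))"
      using AE_first_repetition_bounds[of \<epsilon>]
      by (simp add: cylinder_restrict) (auto elim!: eventually_mono)
  qed (rule AE_first_repetition_entropy)
next
  case False
  then have eq: "a = b" for a b :: 'a
    using card_le_Suc0_iff_eq[of "UNIV :: 'a set"] by simp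
  interpret stationary_field P by (rule gibbs_stationary_field[OF gibbs])
  note r = first_repetition_one_letter[OF eq]
  note m = measure_cylinder_one_letter[OF eq prob_space_axioms space_P]
  \<comment> \<open>The first repetition and all pattern probabilities equal 1, so the logarithm of
    their product and the entropy are 0. What remains is 0 \<le> ln (\<epsilon> ln n), guaranteed by
    n \<ge> 3 and \<epsilon> > 1.\<close>
  have "specific_entropy P = 0"
    unfolding specific_entropy_def by (simp add: m)
  moreover have "\<forall>\<^sub>F n in sequentially. - \<epsilon> * ln (real n) \<le> 0 \<and> 0 \<le> ln (ln (real n powr \<epsilon>))"
    if "1 < \<epsilon>" for \<epsilon> :: real
    using eventually_ge_at_top[of 3]
  proof eventually_elim
    case (elim n)
    have l: "1 \<le> ln (real n)" using elim by (rule one_le_ln)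
    then have "1 * 1 \<le> \<epsilon> * ln (real n)" using that by (intro mult_mono) auto
    then show ?case using l that elim by (simp add: ln_powr)
  qed
  ultimately show ?thesis
    by (intro conjI exI[of _ 1]) (simp_all add: r m)
qed

end
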